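(* Let $f_1,\dots,f_n:\mathbb{R}^d\to\mathbb{R}$ be differentiable with $\|\nabla f_i(x)-\nabla f_i(y)\|\le \ell\|x-y\|$ for all $x,y$ ($\ell>0$), let $f=\frac1n\sum_{i=1}^n f_i$ satisfy $f^\ast=\inf f>-\infty$ and the Polyak--Łojasiewicz condition $\frac12\|\nabla f(x)\|^2\ge\nu(f(x)-f^\ast)$ for all $x\in\mathbb R^d$ with some $\nu>0$. Let the communication graph be undirected and connected. Let $\mathcal{C}:\mathbb{R}^d\to\mathbb{R}^d$ be a locally-bounded compressor: for some $p\ge1$, $r>0$, $C>0$, $\delta\in(0,1]$, $\big\|\frac{\mathcal{C}(x)}{r}-x\big\|_p\le C(1-\delta)$ for all $x$ with $\|x\|_p\le C$. Let $\{x_{i,k}\}$ be generated by the Unified Compression Algorithm (see context) with $$\alpha\in(0,\kappa_0'),\quad\beta=\tau_1\gamma,\quad\gamma>\kappa_2,\quad\omega\in(0,1/r],\quad\tau_1>\kappa_1,$$ $$s_0\ge\max\Big\{\sqrt{\frac{\kappa_\nu}{n\tilde d^2\psi_5C^2}},\ \frac{\max_i\|x_{i,0}\|_p}{C}\Big\},\qquad s_k=s_0\epsilon^k,$$ where the constants, in particular $\epsilon\in(0,1)$, are those given in the context. Then, with $\bar x_k=\frac1n\sum_ix_{i,k}$, $$f(\bar x_k)-f^\ast+\frac1n\sum_{i=1}^n\|x_{i,k}-\bar x_k\|^2=\mathcal O(\epsilon^{2k}),$$ i.e. the left-hand side is at most a constant independent of $k$ times $\epsilon^{2k}$ for all $k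\ge0$.
   Context: Network: $n\ge2$ agents, weighted undirected connected graph with symmetric nonnegative adjacency matrix $A=[A_{ij}]$, $A_{ij}>0$ iff $(j,i)$ is an edge; Laplacian $L=\mathrm{diag}(\sum_jA_{1j},\dots,\sum_j A_{nj})-A=[L_{ij}]$. $\rho(L)$ is the spectral radius, $\rho_2(L)$ the smallest positive eigenvalue. $\|\cdot\|=\|\cdot\|_2$; $p\in[1,\infty]$. $\hat d=d^{1/p-1/2},\ \tilde d=1$ if $p\in[1,2]$; $\hat d=1,\ \tilde d=d^{1/2-1/p}$ if $p>2$. Unified Compression Algorithm: positive parameters $\alpha,\beta,\gamma,\omega$, positive sequence $\{s_k\}$; $x_{i,0}\in\mathbb{R}^d$ arbitrary, $v_{i,0}=\hat x_{i,-1}=y_{i,-1}=\mathbf 0_d$. For $k=0,1,\dots$ and each $i$: $q_{i,k}=\mathcal{C}((x_{i,k}-\hat x_{i,k-1})/s_k)$, $\hat x_{i,k}=\hat x_{i,k-1}+\omega s_kq_{i,k}$, $y_{i,k}=y_{i,k-1}+\omega s_k\sum_{j=1}^nL_{ij}q_{j,k}$, $x_{i,k+1}=x_{i,k}-\alpha(\beta y_{i,k}+\gamma v_{i,k}+\nabla f_i(x_{i,k}))$, $v_{i,k+1}=v_{i,k}+\alpha\gamma y_{i,k}$. Stacked notation: $\mathbf{x}_k=\mathrm{col}(x_{1,k},\dots,x_{n,k})$, $\mathbf{v}_k=\mathrm{col}(v_{1,k},\dots,v_{n,k})$, $\mathbf{g}_k^0=\mathrm{col}(\nabla f_1(\bar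 x_k),\dots,\nabla f_n(\bar x_k))$, $\bar{\mathbf g}_k^0=\mathbf 1_n\otimes\nabla f(\bar x_k)$. $\mathbf{E}=(\mathbf{I}_n-\frac1n\mathbf 1_n\mathbf 1_n^\top)\otimes\mathbf{I}_d$. $\mathbf{F}=F\otimes \mathbf{I}_d$, $F=[q\ Q]\,\mathrm{diag}(\lambda_{n+1}^{-1},\Lambda_1^{-1})[q\ Q]^\top$, where $L=[q\ Q]\,\mathrm{diag}(0,\Lambda_1)[q\ Q]^\top$ is an orthogonal eigendecomposition, $q=\mathbf 1_n/\sqrt n$, $\Lambda_1=\mathrm{diag}(\lambda_2,\dots,\lambda_n)$, $0<\lambda_2\le\dots\le\lambda_n$, and $\lambda_{n+1}\in[\lambda_2,\lambda_n]$. $\|x\|_A^2=x^\top Ax$. Constants (positive numbers divided by $0$ are $+\infty$): $\kappa_1=4/\rho_2(L)$; $\kappa_2=\max\{2+2\ell^2,\ 5/\rho_2(L),\ (16\ell^2(\kappa_1+1)^2/\rho_2(L))^{1/3},\ 2\sqrt2\,\ell/\rho_2(L)\}$; $\varphi_1=\frac12(\rho_2(L)\beta-(3\gamma+2+2\ell^2))$; $\varphi_2=3\rho^2(L)\beta^2-\rho_2(L)\beta\gamma+(\rho(L)+2)\gamma^2+1+\frac52\ell^2$; $\varphi_3=\frac\gamma2-\frac52\rho_2^{-1}(L)$; $\varphi_4=2\rho(L)\gamma^2+\frac12\rho(L)$; $\varphi_5=\frac18-\frac{(\beta+\gamma)^2}{\gamma^5}\rho_2^{-1}(L)\ell^2-\frac1{2\gamma^2}\rho_2^{-2}(L)\ell^2$;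 $\varphi_6=\frac{\beta+\gamma}{2\gamma^3}\rho_2^{-1}(L)\ell^2+\frac1{2\gamma^2}\rho_2^{-2}(L)\ell^2+\frac12\rho_2^{-2}(L)\ell^2+\frac{\ell^2}2+\frac\ell2$; $\varphi_7=(\rho(L)+1)\gamma+\frac12\rho(L)\beta$; $\varphi_8=3\rho^2(L)\beta^2+(\rho(L)-2\rho_2(L))\beta\gamma+(\rho(L)+2)\gamma^2+1$; $\hat\kappa_0=\min\{\varphi_1/\varphi_2,\varphi_3/\varphi_4,\varphi_5/\varphi_6\}$; $\varepsilon_1=\frac{\tau_1\rho_2(L)-1}{2\tau_1\rho_2(L)}$; $\varepsilon_2=\max\{\frac{1+\tau_1\rho_2(L)}2,\ \frac{1+\tau_1}2+\frac1{2\tau_1\rho_2^2(L)}\}$; $\varepsilon_3=\min\{\varphi_1-\alpha\varphi_2,\ \varphi_3-\alpha\varphi_4\}$; $\varepsilon_5=\omega r(\delta-\delta^2/2)$; $\varepsilon_6=\min\{\nu/2,\varepsilon_3\}/\varepsilon_2$; $\psi_2=\varphi_7+\alpha\varphi_8$; $\psi_3=4(1+\varepsilon_5^{-1})\hat d^2\beta^2\rho^2(L)$; $\psi_4=4(1+\varepsilon_5^{-1})\hat d^2\max\{\beta^2\rho^2(L)+\ell^2,\ \gamma^2\rho(L)\}/\varepsilon_1$; $\psi_5$ is any positive constant with $\psi_5>(1-2\varepsilon_5)\psi_2/\varepsilon_6$; $\kappa_5$ is the smallest positive root $a$ of $1=a\min\{\varphi_1-a\varphi_2,\ \varphi_3-a\varphi_4\}$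 if one exists, else $+\infty$; $\kappa_6'=\sqrt{\frac{\varepsilon_5+2\varepsilon_5^2}{(1-2\varepsilon_5)\psi_3+\psi_4\psi_5}}$; $\kappa_0'=\min\{\hat\kappa_0,\kappa_5,\kappa_6'/(\sqrt n\,\tilde d)\}$; $\kappa_\nu=\frac12\|\mathbf x_0\|_{\mathbf E}^2+\frac12\|\mathbf v_0+\frac1\gamma\mathbf g_0^0\|^2_{\frac{\beta+\gamma}\gamma\mathbf F}+\mathbf x_0^\top\mathbf E\mathbf F(\mathbf v_0+\frac1\gamma\mathbf g_0^0)+\frac1{2\nu}\|\bar{\mathbf g}_0^0\|^2$; $\kappa_9=\sqrt{1-\alpha(\varepsilon_6-(1-2\varepsilon_5)\psi_2/\psi_5)}$; $\kappa_{10}=\sqrt{1-(\varepsilon_5+2\varepsilon_5^2)+\alpha^2n\tilde d^2((1-2\varepsilon_5)\psi_3+\psi_4\psi_5)}$; $\epsilon$ is any number in $(\max\{\kappa_9,\kappa_{10}\},1)$. *)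

theory Defs
  imports "HOL-Analysis.Analysis"
begin

definition diag_mat :: "('n::finite \<Rightarrow> real) \<Rightarrow> real^'n^'n" where
  "diag_mat a = (\<chi> i j. if i = j then a i else 0)"

definition eigenvalue :: "'a::field^'n^'n \<Rightarrow> 'a \<Rightarrow> bool" where
  "eigenvalue M c \<longleftrightarrow> (\<exists>v. v \<noteq> 0 \<and> M *v v = c *s v)"

definition spectral_radius :: "real^'n^'n \<Rightarrow> real" where
  "spectral_radius M = Max (cmod ` {c. eigenvalue (map_matrix complex_of_real M) c})"

definition least_pos_eigenvalue :: "real^'n^'n \<Rightarrow> real" where
  "least_pos_eigenvalue M = Min {c. 0 < c \<and> eigenvalue M c}"

definition kronecker :: "real^'b^'a \<Rightarrow> real^'e^'c \<Rightarrow> real^('b \<times> 'e)^('a \<times> 'c)" where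
  "kronecker M N = (\<chi> i j. M $ fst i $ fst j * N $ snd i $ snd j)"

definition col :: "('n::finite \<Rightarrow> real^'d) \<Rightarrow> real^('n \<times> 'd)" where
  "col z = (\<chi> i. z (fst i) $ snd i)"

text \<open>The weighted square norm $\|x\|_M^2 = x^\top M x$.\<close>

definition wnorm_sq :: "real^'m^'m \<Rightarrow> real^'m \<Rightarrow> real" where
  "wnorm_sq M x = x \<bullet> (M *v x)"

definition laplacian :: "real^'n^'n \<Rightarrow> real^'n^'n" where
  "laplacian A = diag_mat (\<lambda>i. \<Sum>j\<in>UNIV. A $ i $ j) - A"

definition edges :: "real^'n^'n \<Rightarrow> ('n \<times> 'n) set" where
  "edges A = {(j, i). A $ i $ j > 0}"

definition connected_weighted_graph :: "real^'n^'n \<Rightarrow> bool" where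
  "connected_weighted_graph A \<longleftrightarrow>
     transpose A = A \<and> (\<forall>i j. A $ i $ j \<ge> 0) \<and> (\<forall>i j. (i, j) \<in> (edges A)\<^sup>*)"

text \<open>
  The orthogonal matrix \<open>P\<close> is $[q\ Q]$. Its columns are indexed by the unordered type of agents;
  \<open>i1\<close> is the index of the column $q = \mathbf 1_n/\sqrt n$, and \<open>lam i\<close> for \<open>i \<noteq> i1\<close> are the
  diagonal entries of $\Lambda_1$. Hence $\lambda_2$ and $\lambda_n$ are the least and the greatest
  of these entries.
\<close>

definition laplacian_eigendecomposition ::
    "real^'n^'n \<Rightarrow> 'n \<Rightarrow> real^'n^'n \<Rightarrow> ('n \<Rightarrow> real) \<Rightarrow> bool" where
  "laplacian_eigendecomposition L i1 P lam \<longleftrightarrow>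
     orthogonal_matrix P \<and>
     column i1 P = (\<chi> i. 1 / sqrt (real CARD('n))) \<and>
     (\<forall>i. i \<noteq> i1 \<longrightarrow> 0 < lam i) \<and>
     L = P ** diag_mat (\<lambda>i. if i = i1 then 0 else lam i) ** transpose P"

text \<open>The argument \<open>\<mu>\<close> is $\lambda_{n+1}$.\<close>

definition F_mat :: "'n \<Rightarrow> real^'n^'n \<Rightarrow> ('n \<Rightarrow> real) \<Rightarrow> real \<Rightarrow> real^'n^'n" where
  "F_mat i1 P lam \<mu> =
     P ** diag_mat (\<lambda>i. if i = i1 then inverse \<mu> else inverse (lam i)) ** transpose P"

definition E_mat :: "real^'n^'n" where
  "E_mat = mat 1 - (1 / real CARD('n)) *\<^sub>R (\<chi> i j. 1)"

definition lp_norm :: "ereal \<Rightarrow> real^'d \<Rightarrow> real" where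
  "lp_norm p x =
     (if p = \<infinity> then infnorm x
      else (\<Sum>i\<in>UNIV. \<bar>x $ i\<bar> powr real_of_ereal p) powr (1 / real_of_ereal p))"

text \<open>For \<open>p = \<infinity>\<close> the exponent $1/p$ below is \<open>0\<close>.\<close>

definition d_hat :: "nat \<Rightarrow> ereal \<Rightarrow> real" where
  "d_hat d p = (if p \<le> 2 then real d powr (real_of_ereal (1 / p) - 1 / 2) else 1)"

definition d_tilde :: "nat \<Rightarrow> ereal \<Rightarrow> real" where
  "d_tilde d p = (if p \<le> 2 then 1 else real d powr (1 / 2 - real_of_ereal (1 / p)))"

definition gradient :: "('a::real_inner \<Rightarrow> real) \<Rightarrow> 'a \<Rightarrow> 'a" where
  "gradient f x = (THE D. GDERIV f x :> D)"

definition locally_bounded_compressor ::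
    "ereal \<Rightarrow> real \<Rightarrow> real \<Rightarrow> real \<Rightarrow> (real^'d \<Rightarrow> real^'d) \<Rightarrow> bool" where
  "locally_bounded_compressor p r C \<delta> Q \<longleftrightarrow>
     1 \<le> p \<and> 0 < r \<and> 0 < C \<and> 0 < \<delta> \<and> \<delta> \<le> 1 \<and>
     (\<forall>x. lp_norm p x \<le> C \<longrightarrow> lp_norm p (Q x /\<^sub>R r - x) \<le> C * (1 - \<delta>))"

text \<open>
  Agents come first and time second. The sequences \<open>xh\<close> ($\hat x$) and \<open>y\<close> start at time \<open>-1\<close>
  and are therefore indexed by integers; their values before time \<open>-1\<close> are irrelevant.
\<close>

definition unified_compression_algorithm ::
    "real^'n^'n \<Rightarrow> ('n \<Rightarrow> real^'d \<Rightarrow> real) \<Rightarrow> (real^'d \<Rightarrow> real^'d) \<Rightarrow>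
     real \<Rightarrow> real \<Rightarrow> real \<Rightarrow> real \<Rightarrow> (nat \<Rightarrow> real) \<Rightarrow>
     ('n \<Rightarrow> nat \<Rightarrow> real^'d) \<Rightarrow> ('n \<Rightarrow> nat \<Rightarrow> real^'d) \<Rightarrow> ('n \<Rightarrow> nat \<Rightarrow> real^'d) \<Rightarrow>
     ('n \<Rightarrow> int \<Rightarrow> real^'d) \<Rightarrow> ('n \<Rightarrow> int \<Rightarrow> real^'d) \<Rightarrow> bool" where
  "unified_compression_algorithm L f Q \<alpha> \<beta> \<gamma> \<omega> s x v q xh y \<longleftrightarrow>
     0 < \<alpha> \<and> 0 < \<beta> \<and> 0 < \<gamma> \<and> 0 < \<omega> \<and> (\<forall>k. 0 < s k) \<and>
     (\<forall>i. v i 0 = 0 \<and> xh i (-1) = 0 \<and> y i (-1) = 0) \<and>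
     (\<forall>k i.
        q i k = Q ((x i k - xh i (int k - 1)) /\<^sub>R s k) \<and>
        xh i (int k) = xh i (int k - 1) + (\<omega> * s k) *\<^sub>R q i k \<and>
        y i (int k) = y i (int k - 1) + (\<omega> * s k) *\<^sub>R (\<Sum>j\<in>UNIV. L $ i $ j *\<^sub>R q j k) \<and>
        x i (Suc k) =
          x i k - \<alpha> *\<^sub>R (\<beta> *\<^sub>R y i (int k) + \<gamma> *\<^sub>R v i k + gradient (f i) (x i k)) \<and>
        v i (Suc k) = v i k + (\<alpha> * \<gamma>) *\<^sub>R y i (int k))"

end

theory Submission
  imports Defs
begin

text \<open>
  In an orthonormal eigenbasis of the Laplacian the operators $L$, $E$ and $F$ are diagonal, so the
  decrease of the Lyapunov function
  $V_k = \frac12\|x_k\|_E^2 + \frac12\|w_k\|^2_{\frac{\beta+\gamma}{\gamma}F} + x_k^\top E F w_k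
    + n(f(\bar x_k) - f^\ast)$ with $w_k = v_k + g_k^0/\gamma$
  splits into one scalar inequality per eigenvalue in $[\rho_2, \rho]$ and one for the consensus
  direction. The Polyak--Lojasiewicz condition turns the remaining $-\frac\alpha4\|\bar g_k^0\|^2$ into a
  multiple of the optimality gap, whence
  $V_{k+1} \le (1 - \alpha\varepsilon_6) V_k + \alpha\psi_2\|x_k - \hat x_k\|_E^2$.

  The compressor is accurate only on a ball, so two bounds are carried through one induction:
  $V_k \le n \tilde d^2\psi_5 C^2 s_k^2$ and $\|x_{i,k} - \hat x_{i,k-1}\|_p \le C s_k$. The second bounds the
  compression error; with the first it bounds the increments $x_{k+1} - x_k$, which gives the second bound
  one step later. The contraction factors of the two bounds are $\kappa_9^2$ and $\kappa_{10}^2$.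
\<close>

subsection \<open>$\ell^p$ norms\<close>

text \<open>The squares of x and w alone yield no negative term in w. The cross term supplies
  -\<alpha>\<gamma>\<mu>u^2 along an eigenvector with w = \<mu>u, and the weight
  (\<beta>+\<gamma>)/\<gamma> is the one for which the products of x and u of first order in
  \<alpha> cancel. The equilibrium -g^0/\<gamma> of v moves with the average. By smoothness each
  block of g^0 moves by at most l\<alpha> times the norm of the averaged gradient, so this cost is
  charged to the decrease that the descent lemma for f yields. In the consensus direction L vanishes
  and v stays 0, so w = g^0/\<gamma> is not damped there; half of the term -\<alpha>/2 |g^0|^2 of
  the descent lemma pays for it because \<gamma> > 5/\<rho>_2, and the other half is left for the
  Polyak-Lojasiewicz condition. For the compressor, (1-\<omega>r\<delta>)^2 <= 1-2\<epsilon>_5, and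
  Young's inequality with weight \<epsilon>_5 separates the old error from the increment;
  (1+\<epsilon>_5)(1-2\<epsilon>_5) = 1-(\<epsilon>_5+2\<epsilon>_5^2) explains \<kappa>_10.\<close>

definition power_sum :: "real \<Rightarrow> real^'d \<Rightarrow> real" where
  "power_sum a x = (\<Sum>i\<in>UNIV. \<bar>x $ i\<bar> powr a)"

text \<open>Coordinates may vanish, so convexity is needed up to the endpoint 0, where the
  inequality reduces to t^a <= t for 0 < t < 1.\<close>

lemma powr_convex_atLeast_0:
  assumes "1 \<le> a"
  shows "convex_on {0..} (\<lambda>x :: real. x powr a)"
proof (rule convex_onI)
  fix t x y :: real
  assume t: "0 < t" "t < 1" and xy: "x \<in> {0..}" "y \<in> {0..}"
  have le: "u powr a \<le> u" if "0 < u" "u < 1" for u :: real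
    using powr_mono'[of 1 a u] assms that by simp
  consider "x = 0" | "y = 0" | "0 < x" "0 < y" using xy by force
  then show "((1 - t) *\<^sub>R x + t *\<^sub>R y) powr a \<le> (1 - t) * x powr a + t * y powr a"
  proof cases
    case 3
    then show ?thesis using t by (intro convex_onD[OF powr_convex[OF assms]]) auto
  qed (use t assms le in \<open>auto simp: powr_mult intro!: mult_right_mono\<close>)
qed simp

lemma power_sum_nonneg: "0 \<le> power_sum a x"
  unfolding power_sum_def by (intro sum_nonneg) simp

lemma power_sum_eq_0_iff: "power_sum a x = 0 \<longleftrightarrow> x = 0"
proof -
  have "power_sum a x = 0 \<longleftrightarrow> (\<forall>i\<in>UNIV. \<bar>x $ i\<bar> powr a = 0)"
    unfolding power_sum_def by (intro sum_nonneg_eq_0_iff) auto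
  then show ?thesis by (simp add: vec_eq_iff)
qed

lemma lp_norm_ereal: "lp_norm (ereal a) x = power_sum a x powr (1 / a)"
  by (simp add: lp_norm_def power_sum_def)

lemma norm_eq_power_sum: "norm (x :: real^'d) = power_sum 2 x powr (1 / 2)"
proof -
  have "(\<Sum>i\<in>UNIV. (norm (x $ i))\<^sup>2) = power_sum 2 x"
    unfolding power_sum_def by (intro sum.cong) auto
  then show ?thesis
    unfolding norm_vec_def L2_set_def by (simp add: powr_half_sqrt power_sum_nonneg)
qed

text \<open>Every coordinate is at most the a-norm N, so |x_i|^b <= |x_i|^a N^(b-a), and the sum
  over i is at most N^b.\<close>

lemma power_sum_root_antimono:
  assumes "0 < a" "a \<le> b"
  shows "power_sum b x powr (1 / b) \<le> power_sum a x powr (1 / a)"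
proof -
  define N where "N = power_sum a x powr (1 / a)"
  have N0: "0 \<le> N" by (simp add: N_def)
  have Na: "N powr a = power_sum a x"
    using assms power_sum_nonneg[of a x] by (simp add: N_def powr_powr)
  have le: "\<bar>x $ i\<bar> \<le> N" for i
  proof -
    have "\<bar>x $ i\<bar> powr a \<le> power_sum a x"
      unfolding power_sum_def by (rule member_le_sum) auto
    then have "(\<bar>x $ i\<bar> powr a) powr (1 / a) \<le> N"
      unfolding N_def using assms by (intro powr_mono2) auto
    then show ?thesis using assms by (simp add: powr_powr)
  qed
  have "power_sum b x \<le> (\<Sum>i\<in>UNIV. \<bar>x $ i\<bar> powr a * N powr (b - a))"
    unfolding power_sum_def
  proof (rule sum_mono)
    fix i
    have "\<bar>x $ i\<bar> powr b = \<bar>x $ i\<bar> powr a * \<bar>x $ i\<bar> powr (b - a)"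
      by (simp flip: powr_add)
    also have "\<dots> \<le> \<bar>x $ i\<bar> powr a * N powr (b - a)"
      using assms le by (intro mult_left_mono powr_mono2) auto
    finally show "\<bar>x $ i\<bar> powr b \<le> \<bar>x $ i\<bar> powr a * N powr (b - a)" .
  qed
  also have "\<dots> = N powr a * N powr (b - a)"
    by (simp add: Na power_sum_def flip: sum_distrib_right)
  also have "\<dots> = N powr b" by (simp flip: powr_add)
  finally have "power_sum b x powr (1 / b) \<le> (N powr b) powr (1 / b)"
    using assms by (intro powr_mono2 power_sum_nonneg) auto
  then show ?thesis using assms N0 by (simp add: powr_powr N_def[symmetric])
qed

text \<open>Jensen's inequality for the convex function u^(b/a) with uniform weights 1/d, that is,
  the power mean inequality.\<close>

lemma power_sum_root_le:
  fixes x :: "real^'d"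
  assumes "0 < a" "a \<le> b"
  shows "power_sum a x powr (1 / a) \<le> real CARD('d) powr (1 / a - 1 / b) * power_sum b x powr (1 / b)"
proof -
  let ?d = "real CARD('d)"
  have d: "0 < ?d" by simp
  have "(\<Sum>i\<in>UNIV. (1 / ?d) *\<^sub>R (\<bar>x $ i\<bar> powr a)) powr (b / a)
        \<le> (\<Sum>i\<in>UNIV. (1 / ?d) * (\<bar>x $ i\<bar> powr a) powr (b / a))"
    using assms by (intro convex_on_sum[OF _ _ powr_convex_atLeast_0]) auto
  then have "(power_sum a x / ?d) powr (b / a) \<le> power_sum b x / ?d"
    using assms by (simp add: power_sum_def powr_powr sum_divide_distrib)
  then have "((power_sum a x / ?d) powr (b / a)) powr (1 / b) \<le> (power_sum b x / ?d) powr (1 / b)"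
    using assms by (intro powr_mono2) auto
  then have "(power_sum a x / ?d) powr (1 / a) \<le> (power_sum b x / ?d) powr (1 / b)"
    using assms by (simp add: powr_powr)
  then have "power_sum a x powr (1 / a) / ?d powr (1 / a) \<le> power_sum b x powr (1 / b) / ?d powr (1 / b)"
    using d power_sum_nonneg by (simp add: powr_divide)
  then show ?thesis using d by (simp add: powr_diff field_simps)
qed

text \<open>Minkowski's inequality from convexity alone: (x+y)/(s+t) is a convex combination of x/s
  and y/t, two vectors of a-norm 1, with weights s/(s+t) and t/(s+t).\<close>

lemma power_sum_root_triangle:
  fixes x y :: "real^'d"
  assumes "1 \<le> a"
  shows "power_sum a (x + y) powr (1 / a) \<le> power_sum a x powr (1 / a) + power_sum a y powr (1 / a)"
proof (cases "x = 0 \<or> y = 0")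
  case True
  then show ?thesis by auto
next
  case False
  define s t where "s = power_sum a x powr (1 / a)" and "t = power_sum a y powr (1 / a)"
  have pos: "0 < s" "0 < t"
    using False power_sum_eq_0_iff[of a] by (auto simp: s_def t_def)
  have pw: "s powr a = power_sum a x" "t powr a = power_sum a y"
    using assms by (simp_all add: s_def t_def powr_powr power_sum_nonneg)
  have "power_sum a (x + y) \<le>
      (\<Sum>i\<in>UNIV. (s + t) powr a * (s / (s + t) * (\<bar>x $ i\<bar> / s) powr a + t / (s + t) * (\<bar>y $ i\<bar> / t) powr a))"
    unfolding power_sum_def
  proof (rule sum_mono)
    fix i
    have conv: "((1 - t / (s + t)) *\<^sub>R (\<bar>x $ i\<bar> / s) + (t / (s + t)) *\<^sub>R (\<bar>y $ i\<bar> / t)) powr a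
      \<le> (1 - t / (s + t)) * (\<bar>x $ i\<bar> / s) powr a + t / (s + t) * (\<bar>y $ i\<bar> / t) powr a"
      using pos by (intro convex_onD[OF powr_convex_atLeast_0[OF assms]]) auto
    have e: "1 - t / (s + t) = s / (s + t)"
      using pos by (simp add: field_simps)
    have "(\<bar>x $ i\<bar> + \<bar>y $ i\<bar>) / (s + t) = (1 - t / (s + t)) *\<^sub>R (\<bar>x $ i\<bar> / s) + (t / (s + t)) *\<^sub>R (\<bar>y $ i\<bar> / t)"
      unfolding e using pos by (simp add: add_divide_distrib)
    with conv have c2: "((\<bar>x $ i\<bar> + \<bar>y $ i\<bar>) / (s + t)) powr a
        \<le> s / (s + t) * (\<bar>x $ i\<bar> / s) powr a + t / (s + t) * (\<bar>y $ i\<bar> / t) powr a"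
      unfolding e by simp
    have "\<bar>(x + y) $ i\<bar> powr a \<le> (\<bar>x $ i\<bar> + \<bar>y $ i\<bar>) powr a"
      using assms by (intro powr_mono2) auto
    also have "\<dots> = (s + t) powr a * ((\<bar>x $ i\<bar> + \<bar>y $ i\<bar>) / (s + t)) powr a"
      using pos by (simp add: powr_divide)
    also have "\<dots> \<le> (s + t) powr a * (s / (s + t) * (\<bar>x $ i\<bar> / s) powr a + t / (s + t) * (\<bar>y $ i\<bar> / t) powr a)"
      by (rule mult_left_mono[OF c2]) simp
    finally show "\<bar>(x + y) $ i\<bar> powr a \<le> \<dots>" .
  qed
  also have "\<dots> = (s + t) powr a * (s / (s + t) * (power_sum a x / s powr a) + t / (s + t) * (power_sum a y / t powr a))"
    using pos by (simp add: powr_divide power_sum_def sum_distrib_left distrib_left sum.distrib sum_divide_distrib)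
  also have "\<dots> = (s + t) powr a * (s / (s + t) + t / (s + t))"
    using pos by (simp flip: pw)
  also have "\<dots> = (s + t) powr a"
    using pos by (simp flip: add_divide_distrib)
  finally have "power_sum a (x + y) powr (1 / a) \<le> ((s + t) powr a) powr (1 / a)"
    using assms by (intro powr_mono2 power_sum_nonneg) auto
  then show ?thesis using assms pos by (simp add: powr_powr s_def t_def)
qed

lemma lp_norm_nonneg: "0 \<le> lp_norm p x"
  by (auto simp: lp_norm_def infnorm_pos_le)

lemma lp_norm_cases:
  assumes "1 \<le> p"
  obtains a where "p = ereal a" "1 \<le> a" | "p = \<infinity>"
  using assms by (cases p) auto

lemma lp_norm_triangle:
  assumes "1 \<le> p"
  shows "lp_norm p (x + y) \<le> lp_norm p x + lp_norm p y"
  using assms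
proof (cases rule: lp_norm_cases)
  case (1 a)
  then show ?thesis using power_sum_root_triangle by (simp add: lp_norm_ereal)
next
  case 2
  then show ?thesis by (simp add: lp_norm_def infnorm_triangle)
qed

lemma lp_norm_scaleR:
  assumes "1 \<le> p"
  shows "lp_norm p (c *\<^sub>R x) = \<bar>c\<bar> * lp_norm p x"
  using assms
proof (cases rule: lp_norm_cases)
  case (1 a)
  have "power_sum a (c *\<^sub>R x) = \<bar>c\<bar> powr a * power_sum a x"
    by (simp add: power_sum_def abs_mult powr_mult sum_distrib_left)
  then show ?thesis using 1 by (simp add: lp_norm_ereal powr_mult powr_powr power_sum_nonneg)
next
  case 2
  then show ?thesis by (simp add: lp_norm_def infnorm_mul)
qed

text \<open>Together with \<open>lp_norm_le_norm\<close> this passes between the p-norm, in which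
  the compressor is accurate, and the Euclidean norm of the energy estimates.\<close>

lemma norm_le_lp_norm:
  fixes x :: "real^'d"
  assumes "1 \<le> p"
  shows "norm x \<le> d_tilde CARD('d) p * lp_norm p x"
  using assms
proof (cases rule: lp_norm_cases)
  case (1 a)
  then have inv: "real_of_ereal (1 / p) = 1 / a"
    by (simp add: one_ereal_def)
  show ?thesis
  proof (cases "a \<le> 2")
    case True
    then show ?thesis using 1 power_sum_root_antimono[of a 2 x]
      by (simp add: lp_norm_ereal norm_eq_power_sum d_tilde_def)
  next
    case False
    then show ?thesis using 1 power_sum_root_le[of 2 a x] inv
      by (simp add: lp_norm_ereal norm_eq_power_sum d_tilde_def)
  qed
next
  case 2
  have "norm x \<le> sqrt CARD('d) * infnorm x"
    using norm_le_infnorm[of x] by simp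
  then show ?thesis using 2 by (simp add: lp_norm_def d_tilde_def powr_half_sqrt)
qed

lemma lp_norm_le_norm:
  fixes x :: "real^'d"
  assumes "1 \<le> p"
  shows "lp_norm p x \<le> d_hat CARD('d) p * norm x"
  using assms
proof (cases rule: lp_norm_cases)
  case (1 a)
  then have inv: "real_of_ereal (1 / p) = 1 / a"
    by (simp add: one_ereal_def)
  show ?thesis
  proof (cases "a \<le> 2")
    case True
    then show ?thesis using 1 power_sum_root_le[of a 2 x] inv
      by (simp add: lp_norm_ereal norm_eq_power_sum d_hat_def)
  next
    case False
    then show ?thesis using 1 power_sum_root_antimono[of 2 a x]
      by (simp add: lp_norm_ereal norm_eq_power_sum d_hat_def)
  qed
next
  case 2
  then show ?thesis by (simp add: lp_norm_def d_hat_def infnorm_le_norm)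
qed

lemma d_tilde_pos: "0 < d \<Longrightarrow> 0 < d_tilde d p"
  by (simp add: d_tilde_def)

subsection \<open>Scalar inequality for one eigenvalue\<close>

lemma young_mult: "0 < c \<Longrightarrow> a * b \<le> c / 2 * a\<^sup>2 + b\<^sup>2 / (2 * c)" for a b c :: real
proof -
  assume c: "0 < c"
  have "0 \<le> (c * a - b)\<^sup>2 / (2 * c)" using c by simp
  also have "\<dots> = c / 2 * a\<^sup>2 + b\<^sup>2 / (2 * c) - a * b"
    using c by (simp add: field_simps power2_eq_square)
  finally show ?thesis by simp
qed

text \<open>Each product is split by Young's inequality. Of the available -\<alpha>\<gamma>\<mu>u^2,
  one quarter pays for the error e and one quarter for the drift t; the remaining half, less the
  cost of h, is the coefficient of \<mu>u^2. The weight b is left free; it is used with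
  (\<beta>+\<gamma>)/\<gamma>.\<close>

lemma coordinate_first_order:
  fixes x u e h t \<mu> \<rho>\<^sub>2 \<rho> \<alpha> \<beta> \<gamma> :: real
  assumes \<mu>: "0 < \<rho>\<^sub>2" "\<rho>\<^sub>2 \<le> \<mu>" "\<mu> \<le> \<rho>" and pos: "0 < \<alpha>" "0 < \<beta>" "0 < \<gamma>"
  shows "- \<alpha> * \<beta> * \<mu> * x * (x + e) - \<alpha> * x * h + \<alpha> * \<gamma> * \<mu> * u * e + \<alpha> * \<gamma> * x * (x + e) - \<alpha> * h * u
         - \<alpha> * \<gamma> * \<mu> * u\<^sup>2 + b * \<mu> * u * t + x * t
    \<le> - \<alpha> * (\<rho>\<^sub>2 * \<beta> / 2 - 3 * \<gamma> / 2 - 1) * x\<^sup>2 - \<alpha> * (\<gamma> / 2 - 1 / (2 * \<rho>\<^sub>2)) * (\<mu> * u\<^sup>2)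
      + \<alpha> * ((\<rho> + 1) * \<gamma> + \<rho> * \<beta> / 2) * e\<^sup>2 + \<alpha> * h\<^sup>2 + (b\<^sup>2 * \<mu> / (\<alpha> * \<gamma>) + 1 / (2 * \<alpha>)) * t\<^sup>2"
proof -
  have \<mu>0: "0 < \<mu>" and \<rho>0: "0 < \<rho>" using \<mu> by auto
  \<comment> \<open>Polarization: 2x(x+e) = x^2 + (x+e)^2 - e^2. The middle square has the right
    sign; \<mu> is bounded below at x^2 and above at e^2.\<close>
  have 1: "- \<alpha> * \<beta> * \<mu> * x * (x + e) \<le> - \<alpha> * \<rho>\<^sub>2 * \<beta> / 2 * x\<^sup>2 + \<alpha> * \<rho> * \<beta> / 2 * e\<^sup>2"
  proof -
    have "0 \<le> (\<alpha> * \<beta> * \<mu> / 2) * (x + e)\<^sup>2" using pos \<mu>0 by simp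
    moreover have "\<alpha> * \<beta> / 2 * x\<^sup>2 * \<rho>\<^sub>2 \<le> \<alpha> * \<beta> / 2 * x\<^sup>2 * \<mu>"
      using pos \<mu> by (intro mult_left_mono) auto
    moreover have "\<alpha> * \<beta> / 2 * e\<^sup>2 * \<mu> \<le> \<alpha> * \<beta> / 2 * e\<^sup>2 * \<rho>"
      using pos \<mu> by (intro mult_left_mono) auto
    ultimately show ?thesis by (simp add: power2_eq_square algebra_simps)
  qed
  have 2: "\<alpha> * \<gamma> * \<mu> * u * e \<le> \<alpha> * \<gamma> / 4 * (\<mu> * u\<^sup>2) + \<alpha> * \<gamma> * \<rho> * e\<^sup>2"
  proof -
    have "0 \<le> \<alpha> * \<gamma> * \<mu> * (u / 2 - e)\<^sup>2" using pos \<mu>0 by simp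
    moreover have "\<alpha> * \<gamma> * e\<^sup>2 * \<mu> \<le> \<alpha> * \<gamma> * e\<^sup>2 * \<rho>"
      using pos \<mu> by (intro mult_left_mono) auto
    ultimately show ?thesis by (simp add: power2_eq_square algebra_simps)
  qed
  have 3: "- \<alpha> * x * h \<le> \<alpha> / 2 * x\<^sup>2 + \<alpha> / 2 * h\<^sup>2"
  proof -
    have "0 \<le> \<alpha> / 2 * (x + h)\<^sup>2" using pos by simp
    then show ?thesis by (simp add: power2_eq_square algebra_simps)
  qed
  have 4: "\<alpha> * \<gamma> * x * (x + e) \<le> 3 / 2 * (\<alpha> * \<gamma>) * x\<^sup>2 + \<alpha> * \<gamma> / 2 * e\<^sup>2"
  proof -
    have "0 \<le> \<alpha> * \<gamma> / 2 * (x - e)\<^sup>2" using pos by simp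
    then show ?thesis by (simp add: power2_eq_square algebra_simps)
  qed
  have 5: "- \<alpha> * h * u \<le> \<alpha> / 2 * h\<^sup>2 + \<alpha> / (2 * \<rho>\<^sub>2) * (\<mu> * u\<^sup>2)"
  proof -
    have "0 \<le> \<alpha> / 2 * (h + u)\<^sup>2" using pos by simp
    moreover have "\<alpha> / (2 * \<rho>\<^sub>2) * u\<^sup>2 * \<rho>\<^sub>2 \<le> \<alpha> / (2 * \<rho>\<^sub>2) * u\<^sup>2 * \<mu>"
      using pos \<mu> by (intro mult_left_mono) auto
    ultimately show ?thesis using \<mu> by (simp add: power2_eq_square algebra_simps)
  qed
  have 6: "b * \<mu> * u * t \<le> \<alpha> * \<gamma> / 4 * (\<mu> * u\<^sup>2) + b\<^sup>2 * \<mu> / (\<alpha> * \<gamma>) * t\<^sup>2"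
  proof -
    have "\<mu> * (u * (b * t)) \<le> \<mu> * (\<alpha> * \<gamma> / 2 / 2 * u\<^sup>2 + (b * t)\<^sup>2 / (2 * (\<alpha> * \<gamma> / 2)))"
      using pos \<mu>0 by (intro mult_left_mono young_mult) auto
    then show ?thesis by (simp add: power_mult_distrib algebra_simps)
  qed
  have 7: "x * t \<le> \<alpha> / 2 * x\<^sup>2 + t\<^sup>2 / (2 * \<alpha>)"
    using pos by (intro young_mult) auto
  \<comment> \<open>Slack that raises \<gamma>/2 to \<gamma> in the coefficient of e^2, so that it
    matches \<open>\<phi>\<^sub>7\<close>.\<close>
  have 8: "0 \<le> \<alpha> * \<gamma> / 2 * e\<^sup>2" using pos by simp
  have "?thesis \<longleftrightarrow> - \<alpha> * \<beta> * \<mu> * x * (x + e) - \<alpha> * x * h + \<alpha> * \<gamma> * \<mu> * u * e + \<alpha> * \<gamma> * x * (x + e) - \<alpha> * h * u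
         - \<alpha> * \<gamma> * (\<mu> * u\<^sup>2) + b * \<mu> * u * t + x * t
    \<le> (- \<alpha> * \<rho>\<^sub>2 * \<beta> / 2 * x\<^sup>2 + \<alpha> * \<rho> * \<beta> / 2 * e\<^sup>2) + (\<alpha> * \<gamma> / 4 * (\<mu> * u\<^sup>2) + \<alpha> * \<gamma> * \<rho> * e\<^sup>2)
    + (\<alpha> / 2 * x\<^sup>2 + \<alpha> / 2 * h\<^sup>2) + (3 / 2 * (\<alpha> * \<gamma>) * x\<^sup>2 + \<alpha> * \<gamma> / 2 * e\<^sup>2)
    + (\<alpha> / 2 * h\<^sup>2 + \<alpha> / (2 * \<rho>\<^sub>2) * (\<mu> * u\<^sup>2)) + (\<alpha> * \<gamma> / 4 * (\<mu> * u\<^sup>2) + b\<^sup>2 * \<mu> / (\<alpha> * \<gamma>) * t\<^sup>2)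
    + (\<alpha> / 2 * x\<^sup>2 + t\<^sup>2 / (2 * \<alpha>)) - \<alpha> * \<gamma> * (\<mu> * u\<^sup>2) + \<alpha> * \<gamma> / 2 * e\<^sup>2"
    by (simp add: algebra_simps)
  then show ?thesis using 1 2 3 4 5 6 7 8 by linarith
qed

text \<open>Collects the terms with \<alpha>^2 and the products of t with quantities of order
  \<alpha>. The latter are split so that t^2 receives no factor 1/\<alpha>.\<close>

lemma coordinate_second_order:
  fixes x u e h t \<mu> \<rho>\<^sub>2 \<rho> \<alpha> \<beta> \<gamma> :: real
  assumes \<mu>: "0 < \<rho>\<^sub>2" "\<rho>\<^sub>2 \<le> \<mu>" "\<mu> \<le> \<rho>" and pos: "0 < \<alpha>" "0 < \<beta>" "0 < \<gamma>" and \<beta>\<gamma>: "\<gamma> \<le> \<rho>\<^sub>2 * \<beta>"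
    and z: "z = x + e"
  shows "\<alpha>\<^sup>2 * (\<beta> * \<mu> * z + \<gamma> * \<mu> * u + h)\<^sup>2 / 2 + \<alpha>\<^sup>2 * \<gamma> * (\<gamma> - \<beta>) / 2 * \<mu> * z\<^sup>2
         - \<alpha>\<^sup>2 * \<gamma>\<^sup>2 * \<mu> * u * z - \<alpha>\<^sup>2 * \<gamma> * h * z + \<alpha> * \<gamma> * \<mu> * z * t - \<alpha> * \<gamma> * \<mu> * u * t - \<alpha> * h * t
    \<le> \<alpha>\<^sup>2 * (3 * \<rho>\<^sup>2 * \<beta>\<^sup>2 - \<rho>\<^sub>2 * \<beta> * \<gamma> + (\<rho> + 2) * \<gamma>\<^sup>2 + 1) * x\<^sup>2
      + \<alpha>\<^sup>2 * (2 * \<rho> * \<gamma>\<^sup>2 + \<rho> / 2) * (\<mu> * u\<^sup>2)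
      + \<alpha>\<^sup>2 * (3 * \<rho>\<^sup>2 * \<beta>\<^sup>2 + (\<rho> - 2 * \<rho>\<^sub>2) * \<beta> * \<gamma> + (\<rho> + 2) * \<gamma>\<^sup>2 + 1) * e\<^sup>2
      + 5 / 2 * \<alpha>\<^sup>2 * h\<^sup>2 + (\<gamma>\<^sup>2 * \<mu>\<^sup>2 / 2 + \<gamma>\<^sup>2 / 2 + 1 / 2) * t\<^sup>2"
proof -
  have \<mu>0: "0 < \<mu>" and \<rho>0: "0 < \<rho>" using \<mu> by auto
  have 1: "(\<beta> * \<mu> * z + \<gamma> * \<mu> * u + h)\<^sup>2 / 2 \<le> 3 / 2 * \<beta>\<^sup>2 * \<mu>\<^sup>2 * z\<^sup>2 + 3 / 2 * \<gamma>\<^sup>2 * (\<mu>\<^sup>2 * u\<^sup>2) + 3 / 2 * h\<^sup>2"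
  proof -
    have "(a + b + c)\<^sup>2 / 2 \<le> 3 / 2 * a\<^sup>2 + 3 / 2 * b\<^sup>2 + 3 / 2 * c\<^sup>2" for a b c :: real
    proof -
      have "0 \<le> (a - b)\<^sup>2 + (b - c)\<^sup>2 + (a - c)\<^sup>2" by simp
      then show ?thesis by (simp add: power2_eq_square algebra_simps)
    qed
    from this[of "\<beta> * \<mu> * z" "\<gamma> * \<mu> * u" h] show ?thesis
      by (simp add: power_mult_distrib algebra_simps)
  qed
  have 2: "- \<gamma>\<^sup>2 * \<mu> * u * z \<le> \<gamma>\<^sup>2 / 2 * (\<mu>\<^sup>2 * u\<^sup>2) + \<gamma>\<^sup>2 / 2 * z\<^sup>2"
  proof -
    have "0 \<le> \<gamma>\<^sup>2 / 2 * (\<mu> * u + z)\<^sup>2" by simp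
    then show ?thesis by (simp add: power2_eq_square algebra_simps)
  qed
  have 3: "- \<gamma> * h * z \<le> h\<^sup>2 / 2 + \<gamma>\<^sup>2 / 2 * z\<^sup>2"
  proof -
    have "0 \<le> (h + \<gamma> * z)\<^sup>2 / 2" by simp
    then show ?thesis by (simp add: power2_eq_square algebra_simps)
  qed
  have 4: "\<alpha> * \<gamma> * \<mu> * z * t \<le> \<alpha>\<^sup>2 / 2 * z\<^sup>2 + \<gamma>\<^sup>2 * \<mu>\<^sup>2 / 2 * t\<^sup>2"
  proof -
    have "0 \<le> (\<alpha> * z - \<gamma> * \<mu> * t)\<^sup>2 / 2" by simp
    then show ?thesis by (simp add: power2_eq_square algebra_simps)
  qed
  have 5: "- \<alpha> * \<gamma> * \<mu> * u * t \<le> \<alpha>\<^sup>2 / 2 * (\<mu>\<^sup>2 * u\<^sup>2) + \<gamma>\<^sup>2 / 2 * t\<^sup>2"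
  proof -
    have "0 \<le> (\<alpha> * \<mu> * u + \<gamma> * t)\<^sup>2 / 2" by simp
    then show ?thesis by (simp add: power2_eq_square algebra_simps)
  qed
  have 6: "- \<alpha> * h * t \<le> \<alpha>\<^sup>2 / 2 * h\<^sup>2 + t\<^sup>2 / 2"
  proof -
    have "0 \<le> (\<alpha> * h + t)\<^sup>2 / 2" by simp
    then show ?thesis by (simp add: power2_eq_square algebra_simps)
  qed
  have 7: "\<mu>\<^sup>2 * u\<^sup>2 \<le> \<rho> * (\<mu> * u\<^sup>2)"
    using \<mu> \<mu>0 by (simp add: power2_eq_square mult_right_mono)
  \<comment> \<open>The linear summand may decrease in \<mu>, so \<mu> cannot be replaced by \<rho>
    termwise. After factoring out \<rho>-\<mu>, the hypothesis \<gamma> <= \<rho>_2\<beta> lets the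
    quadratic summand dominate.\<close>
  have q: "(3 / 2 * \<beta>\<^sup>2 * \<mu>\<^sup>2 + \<gamma> * (\<gamma> - \<beta>) / 2 * \<mu>) \<le> 3 / 2 * \<beta>\<^sup>2 * \<rho>\<^sup>2 + \<gamma> * (\<gamma> - \<beta>) / 2 * \<rho>"
  proof -
    have "\<beta> * \<gamma> \<le> \<beta> * (\<beta> * (\<rho> + \<mu>))"
    proof (rule mult_left_mono)
      have "\<rho>\<^sub>2 * \<beta> \<le> (\<rho> + \<mu>) * \<beta>" using \<mu> \<rho>0 pos by (intro mult_right_mono) auto
      then show "\<gamma> \<le> \<beta> * (\<rho> + \<mu>)" using \<beta>\<gamma> by (simp add: mult.commute)
    qed (use pos in auto)
    moreover have "\<beta> * (\<beta> * (\<rho> + \<mu>)) = \<beta>\<^sup>2 * (\<rho> + \<mu>)"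
      by (simp add: power2_eq_square)
    moreover have "0 \<le> \<beta>\<^sup>2 * (\<rho> + \<mu>)" "0 \<le> \<gamma>\<^sup>2" using \<mu>0 \<rho>0 by auto
    ultimately have "0 \<le> 3 / 2 * (\<beta>\<^sup>2 * (\<rho> + \<mu>)) + \<gamma>\<^sup>2 / 2 - \<beta> * \<gamma> / 2"
      by linarith
    then have "0 \<le> 3 / 2 * \<beta>\<^sup>2 * (\<rho> + \<mu>) + \<gamma>\<^sup>2 / 2 - \<beta> * \<gamma> / 2"
      by (simp only: mult.assoc)
    then have "0 \<le> (\<rho> - \<mu>) * (3 / 2 * \<beta>\<^sup>2 * (\<rho> + \<mu>) + \<gamma>\<^sup>2 / 2 - \<beta> * \<gamma> / 2)"
      using \<mu> by simp
    then show ?thesis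
      by (simp add: power2_eq_square algebra_simps add_divide_distrib diff_divide_distrib)
  qed
  define c where "c = 3 / 2 * \<beta>\<^sup>2 * \<rho>\<^sup>2 + \<gamma> * (\<gamma> - \<beta>) / 2 * \<rho> + \<gamma>\<^sup>2 + 1 / 2"
  \<comment> \<open>The sign of \<open>c\<close> permits enlarging z^2 to 2x^2 + 2e^2.\<close>
  have c0: "0 \<le> c"
  proof -
    have "\<gamma> * \<beta> * \<rho> \<le> (\<rho> * \<beta>) * (\<rho> * \<beta>)"
    proof -
      have "\<gamma> \<le> \<rho> * \<beta>" using order_trans[OF \<beta>\<gamma> mult_right_mono[OF order_trans[OF \<mu>(2,3)], of \<beta>]] pos by simp
      then have "\<gamma> * (\<rho> * \<beta>) \<le> (\<rho> * \<beta>) * (\<rho> * \<beta>)" using \<rho>0 pos by (intro mult_right_mono) auto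
      then show ?thesis by (simp add: mult_ac)
    qed
    moreover have "0 \<le> (\<rho> * \<beta>) * (\<rho> * \<beta>)" "0 \<le> \<gamma>\<^sup>2 * \<rho>" "0 \<le> \<gamma>\<^sup>2" using \<rho>0 by auto
    moreover have "c = 3 / 2 * ((\<rho> * \<beta>) * (\<rho> * \<beta>)) + \<gamma>\<^sup>2 * \<rho> / 2 - \<gamma> * \<beta> * \<rho> / 2 + \<gamma>\<^sup>2 + 1 / 2"
      by (simp add: c_def power2_eq_square algebra_simps diff_divide_distrib)
    ultimately show ?thesis by linarith
  qed
  have "(3 / 2 * \<beta>\<^sup>2 * \<mu>\<^sup>2 + \<gamma> * (\<gamma> - \<beta>) / 2 * \<mu> + \<gamma>\<^sup>2 + 1 / 2) * z\<^sup>2 \<le> c * z\<^sup>2"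
    using q by (intro mult_right_mono) (auto simp: c_def)
  also have "\<dots> \<le> c * (2 * x\<^sup>2 + 2 * e\<^sup>2)"
  proof (rule mult_left_mono)
    have "0 \<le> (x - e)\<^sup>2" by simp
    then show "z\<^sup>2 \<le> 2 * x\<^sup>2 + 2 * e\<^sup>2" by (simp add: z power2_eq_square algebra_simps)
  qed (rule c0)
  also have "\<dots> = (2 * c) * x\<^sup>2 + (2 * c) * e\<^sup>2" by (simp add: algebra_simps)
  also have "\<dots> \<le> (3 * \<rho>\<^sup>2 * \<beta>\<^sup>2 - \<rho>\<^sub>2 * \<beta> * \<gamma> + (\<rho> + 2) * \<gamma>\<^sup>2 + 1) * x\<^sup>2
      + (3 * \<rho>\<^sup>2 * \<beta>\<^sup>2 + (\<rho> - 2 * \<rho>\<^sub>2) * \<beta> * \<gamma> + (\<rho> + 2) * \<gamma>\<^sup>2 + 1) * e\<^sup>2"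
  proof (intro add_mono mult_right_mono)
    \<comment> \<open>Twice \<open>c\<close> contains -\<rho>\<beta>\<gamma>; the target
      coefficients contain -\<rho>_2\<beta>\<gamma> and (\<rho>-2\<rho>_2)\<beta>\<gamma>, both at
      least as large.\<close>
    have "\<rho>\<^sub>2 * (\<beta> * \<gamma>) \<le> \<rho> * (\<beta> * \<gamma>)" using \<mu> pos by (intro mult_right_mono) auto
    then show "2 * c \<le> 3 * \<rho>\<^sup>2 * \<beta>\<^sup>2 - \<rho>\<^sub>2 * \<beta> * \<gamma> + (\<rho> + 2) * \<gamma>\<^sup>2 + 1"
      "2 * c \<le> 3 * \<rho>\<^sup>2 * \<beta>\<^sup>2 + (\<rho> - 2 * \<rho>\<^sub>2) * \<beta> * \<gamma> + (\<rho> + 2) * \<gamma>\<^sup>2 + 1"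
      unfolding c_def by (simp_all add: power2_eq_square algebra_simps diff_divide_distrib)
  qed auto
  finally have "\<alpha>\<^sup>2 * ((3 / 2 * \<beta>\<^sup>2 * \<mu>\<^sup>2 + \<gamma> * (\<gamma> - \<beta>) / 2 * \<mu> + \<gamma>\<^sup>2 + 1 / 2) * z\<^sup>2)
    \<le> \<alpha>\<^sup>2 * ((3 * \<rho>\<^sup>2 * \<beta>\<^sup>2 - \<rho>\<^sub>2 * \<beta> * \<gamma> + (\<rho> + 2) * \<gamma>\<^sup>2 + 1) * x\<^sup>2 + (3 * \<rho>\<^sup>2 * \<beta>\<^sup>2 + (\<rho> - 2 * \<rho>\<^sub>2) * \<beta> * \<gamma> + (\<rho> + 2) * \<gamma>\<^sup>2 + 1) * e\<^sup>2)"
    by (intro mult_left_mono) auto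
  then have 8: "\<alpha>\<^sup>2 * ((3 / 2 * \<beta>\<^sup>2 * \<mu>\<^sup>2 + \<gamma> * (\<gamma> - \<beta>) / 2 * \<mu> + \<gamma>\<^sup>2 + 1 / 2) * z\<^sup>2)
    \<le> \<alpha>\<^sup>2 * (3 * \<rho>\<^sup>2 * \<beta>\<^sup>2 - \<rho>\<^sub>2 * \<beta> * \<gamma> + (\<rho> + 2) * \<gamma>\<^sup>2 + 1) * x\<^sup>2 + \<alpha>\<^sup>2 * (3 * \<rho>\<^sup>2 * \<beta>\<^sup>2 + (\<rho> - 2 * \<rho>\<^sub>2) * \<beta> * \<gamma> + (\<rho> + 2) * \<gamma>\<^sup>2 + 1) * e\<^sup>2"
    by (simp only: distrib_left[of "\<alpha>\<^sup>2" "_ * x\<^sup>2"] mult.assoc[of "\<alpha>\<^sup>2"])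
  have "\<alpha>\<^sup>2 * ((2 * \<gamma>\<^sup>2 + 1 / 2) * (\<mu>\<^sup>2 * u\<^sup>2)) \<le> \<alpha>\<^sup>2 * ((2 * \<gamma>\<^sup>2 + 1 / 2) * (\<rho> * (\<mu> * u\<^sup>2)))"
    by (intro mult_left_mono 7) auto
  also have "\<dots> = \<alpha>\<^sup>2 * (2 * \<rho> * \<gamma>\<^sup>2 + \<rho> / 2) * (\<mu> * u\<^sup>2)"
    by (simp add: distrib_left distrib_right)
  finally have 9: "\<alpha>\<^sup>2 * ((2 * \<gamma>\<^sup>2 + 1 / 2) * (\<mu>\<^sup>2 * u\<^sup>2)) \<le> \<dots>" .
  have 10: "\<alpha>\<^sup>2 * ((\<beta> * \<mu> * z + \<gamma> * \<mu> * u + h)\<^sup>2 / 2 + (- \<gamma>\<^sup>2 * \<mu> * u * z) + (- \<gamma> * h * z))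
    \<le> \<alpha>\<^sup>2 * ((3 / 2 * \<beta>\<^sup>2 * \<mu>\<^sup>2 * z\<^sup>2 + 3 / 2 * \<gamma>\<^sup>2 * (\<mu>\<^sup>2 * u\<^sup>2) + 3 / 2 * h\<^sup>2)
      + (\<gamma>\<^sup>2 / 2 * (\<mu>\<^sup>2 * u\<^sup>2) + \<gamma>\<^sup>2 / 2 * z\<^sup>2) + (h\<^sup>2 / 2 + \<gamma>\<^sup>2 / 2 * z\<^sup>2))"
    by (intro mult_left_mono add_mono 1 2 3) auto
  have "\<alpha>\<^sup>2 * (\<beta> * \<mu> * z + \<gamma> * \<mu> * u + h)\<^sup>2 / 2 + \<alpha>\<^sup>2 * \<gamma> * (\<gamma> - \<beta>) / 2 * \<mu> * z\<^sup>2
         - \<alpha>\<^sup>2 * \<gamma>\<^sup>2 * \<mu> * u * z - \<alpha>\<^sup>2 * \<gamma> * h * z + \<alpha> * \<gamma> * \<mu> * z * t - \<alpha> * \<gamma> * \<mu> * u * t - \<alpha> * h * t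
    = \<alpha>\<^sup>2 * ((\<beta> * \<mu> * z + \<gamma> * \<mu> * u + h)\<^sup>2 / 2 + (- \<gamma>\<^sup>2 * \<mu> * u * z) + (- \<gamma> * h * z))
      + \<alpha>\<^sup>2 * (\<gamma> * (\<gamma> - \<beta>) / 2 * \<mu> * z\<^sup>2) + \<alpha> * \<gamma> * \<mu> * z * t + (- \<alpha> * \<gamma> * \<mu> * u * t) + (- \<alpha> * h * t)"
    by (simp add: distrib_left right_diff_distrib mult.assoc)
  also have "\<dots> \<le> \<alpha>\<^sup>2 * ((3 / 2 * \<beta>\<^sup>2 * \<mu>\<^sup>2 * z\<^sup>2 + 3 / 2 * \<gamma>\<^sup>2 * (\<mu>\<^sup>2 * u\<^sup>2) + 3 / 2 * h\<^sup>2)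
      + (\<gamma>\<^sup>2 / 2 * (\<mu>\<^sup>2 * u\<^sup>2) + \<gamma>\<^sup>2 / 2 * z\<^sup>2) + (h\<^sup>2 / 2 + \<gamma>\<^sup>2 / 2 * z\<^sup>2))
      + \<alpha>\<^sup>2 * (\<gamma> * (\<gamma> - \<beta>) / 2 * \<mu> * z\<^sup>2) + (\<alpha>\<^sup>2 / 2 * z\<^sup>2 + \<gamma>\<^sup>2 * \<mu>\<^sup>2 / 2 * t\<^sup>2)
      + (\<alpha>\<^sup>2 / 2 * (\<mu>\<^sup>2 * u\<^sup>2) + \<gamma>\<^sup>2 / 2 * t\<^sup>2) + (\<alpha>\<^sup>2 / 2 * h\<^sup>2 + t\<^sup>2 / 2)"
    by (intro add_mono 10 4 5 6 order_refl)
  also have "\<dots> = \<alpha>\<^sup>2 * ((3 / 2 * \<beta>\<^sup>2 * \<mu>\<^sup>2 + \<gamma> * (\<gamma> - \<beta>) / 2 * \<mu> + \<gamma>\<^sup>2 + 1 / 2) * z\<^sup>2)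
      + \<alpha>\<^sup>2 * ((2 * \<gamma>\<^sup>2 + 1 / 2) * (\<mu>\<^sup>2 * u\<^sup>2)) + 5 / 2 * \<alpha>\<^sup>2 * h\<^sup>2 + (\<gamma>\<^sup>2 * \<mu>\<^sup>2 / 2 + \<gamma>\<^sup>2 / 2 + 1 / 2) * t\<^sup>2"
  proof -
    define v g where "v = \<mu>\<^sup>2 * u\<^sup>2" and "g = \<gamma> * (\<gamma> - \<beta>) / 2 * \<mu>"
    show ?thesis unfolding v_def[symmetric] g_def[symmetric] by (simp add: distrib_left distrib_right)
  qed
  also have "\<dots> \<le> (\<alpha>\<^sup>2 * (3 * \<rho>\<^sup>2 * \<beta>\<^sup>2 - \<rho>\<^sub>2 * \<beta> * \<gamma> + (\<rho> + 2) * \<gamma>\<^sup>2 + 1) * x\<^sup>2 + \<alpha>\<^sup>2 * (3 * \<rho>\<^sup>2 * \<beta>\<^sup>2 + (\<rho> - 2 * \<rho>\<^sub>2) * \<beta> * \<gamma> + (\<rho> + 2) * \<gamma>\<^sup>2 + 1) * e\<^sup>2)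
      + \<alpha>\<^sup>2 * (2 * \<rho> * \<gamma>\<^sup>2 + \<rho> / 2) * (\<mu> * u\<^sup>2) + 5 / 2 * \<alpha>\<^sup>2 * h\<^sup>2 + (\<gamma>\<^sup>2 * \<mu>\<^sup>2 / 2 + \<gamma>\<^sup>2 / 2 + 1 / 2) * t\<^sup>2"
    by (intro add_mono 8 9 order_refl)
  finally show ?thesis by (simp only: add_ac)
qed

text \<open>
  Here \<open>x\<close>, \<open>e\<close>, \<open>h\<close> are the coordinates of $x_k$, $\hat x_k - x_k$, $g_k - g_k^0$ along an eigenvector with
  eigenvalue \<open>\<mu>\<close>, while $w_k$ and $g_{k+1}^0 - g_k^0$ have the coordinates \<open>\<mu> * u\<close> and \<open>\<gamma> * \<mu> * t\<close>: this scaling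
  makes both sides free of division by \<open>\<mu>\<close>.
\<close>

lemma coordinate_descent:
  fixes x u e h t \<mu> \<rho>\<^sub>2 \<rho> \<alpha> \<beta> \<gamma> :: real
  assumes \<mu>: "0 < \<rho>\<^sub>2" "\<rho>\<^sub>2 \<le> \<mu>" "\<mu> \<le> \<rho>" and pos: "0 < \<alpha>" "0 < \<beta>" "0 < \<gamma>" and \<beta>\<gamma>: "\<gamma> \<le> \<rho>\<^sub>2 * \<beta>"
    and x': "x' = x - \<alpha> * (\<beta> * \<mu> * (x + e) + \<gamma> * \<mu> * u + h)"
    and u': "u' = u + \<alpha> * \<gamma> * (x + e) + t"
  shows "x'\<^sup>2 / 2 + (\<beta> + \<gamma>) / \<gamma> * \<mu> * u'\<^sup>2 / 2 + x' * u'
    \<le> x\<^sup>2 / 2 + (\<beta> + \<gamma>) / \<gamma> * \<mu> * u\<^sup>2 / 2 + x * u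
      + (- \<alpha> * (\<rho>\<^sub>2 * \<beta> / 2 - 3 * \<gamma> / 2 - 1)
         + \<alpha>\<^sup>2 * (3 * \<rho>\<^sup>2 * \<beta>\<^sup>2 - \<rho>\<^sub>2 * \<beta> * \<gamma> + (\<rho> + 2) * \<gamma>\<^sup>2 + 1)) * x\<^sup>2
      + (- \<alpha> * (\<gamma> / 2 - 1 / (2 * \<rho>\<^sub>2)) + \<alpha>\<^sup>2 * (2 * \<rho> * \<gamma>\<^sup>2 + \<rho> / 2)) * (\<mu> * u\<^sup>2)
      + (\<alpha> * ((\<rho> + 1) * \<gamma> + \<rho> * \<beta> / 2)
         + \<alpha>\<^sup>2 * (3 * \<rho>\<^sup>2 * \<beta>\<^sup>2 + (\<rho> - 2 * \<rho>\<^sub>2) * \<beta> * \<gamma> + (\<rho> + 2) * \<gamma>\<^sup>2 + 1)) * e\<^sup>2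
      + (\<alpha> + 5 / 2 * \<alpha>\<^sup>2) * h\<^sup>2
      + ((\<beta> + \<gamma>)\<^sup>2 / (\<alpha> * \<gamma> ^ 5 * \<rho>\<^sub>2) + 1 / (2 * \<alpha> * \<gamma>\<^sup>2 * \<rho>\<^sub>2\<^sup>2) + (\<beta> + \<gamma>) / (2 * \<gamma> ^ 3 * \<rho>\<^sub>2)
         + 1 / (2 * \<gamma>\<^sup>2 * \<rho>\<^sub>2\<^sup>2) + 1 / (2 * \<rho>\<^sub>2\<^sup>2) + 1 / 2) * (\<gamma> * \<mu> * t)\<^sup>2"
proof -
  have \<mu>0: "0 < \<mu>" and \<rho>0: "0 < \<rho>" using \<mu> by auto
  define b where "b = (\<beta> + \<gamma>) / \<gamma>"
  have b: "b * \<gamma> = \<beta> + \<gamma>" using pos by (simp add: b_def)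
  define z where "z = x + e"
  \<comment> \<open>The factor \<open>b * \<gamma>\<close> is kept intact so that the next step can
    replace it by \<beta>+\<gamma>; there the first-order products of x and u cancel and only
    \<alpha>\<gamma>\<mu>ue survives.\<close>
  have "x'\<^sup>2 / 2 + b * \<mu> * u'\<^sup>2 / 2 + x' * u' - (x\<^sup>2 / 2 + b * \<mu> * u\<^sup>2 / 2 + x * u)
     = x * (- \<alpha> * (\<beta> * \<mu> * z + \<gamma> * \<mu> * u + h)) + \<alpha>\<^sup>2 * (\<beta> * \<mu> * z + \<gamma> * \<mu> * u + h)\<^sup>2 / 2
       + (\<alpha> * (b * \<gamma>) * \<mu> * u * z + b * \<mu> * u * t) + (\<alpha>\<^sup>2 * (b * \<gamma>) * \<gamma> * \<mu> * z\<^sup>2 / 2 + \<alpha> * (b * \<gamma>) * \<mu> * z * t + b * \<mu> * t\<^sup>2 / 2)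
       + x * (\<alpha> * \<gamma> * z + t) - \<alpha> * (\<beta> * \<mu> * z + \<gamma> * \<mu> * u + h) * (u + \<alpha> * \<gamma> * z + t)"
  proof -
    define s where "s = \<beta> * \<mu> * z + \<gamma> * \<mu> * u + h"
    show ?thesis unfolding x' u' z_def[symmetric] s_def[symmetric]
      by (simp add: power2_eq_square algebra_simps add_divide_distrib diff_divide_distrib)
  qed
  also have "\<dots> = (- \<alpha> * \<beta> * \<mu> * x * (x + e) - \<alpha> * x * h + \<alpha> * \<gamma> * \<mu> * u * e + \<alpha> * \<gamma> * x * (x + e) - \<alpha> * h * u
         - \<alpha> * \<gamma> * \<mu> * u\<^sup>2 + b * \<mu> * u * t + x * t)
       + (\<alpha>\<^sup>2 * (\<beta> * \<mu> * z + \<gamma> * \<mu> * u + h)\<^sup>2 / 2 + \<alpha>\<^sup>2 * \<gamma> * (\<gamma> - \<beta>) / 2 * \<mu> * z\<^sup>2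
         - \<alpha>\<^sup>2 * \<gamma>\<^sup>2 * \<mu> * u * z - \<alpha>\<^sup>2 * \<gamma> * h * z + \<alpha> * \<gamma> * \<mu> * z * t - \<alpha> * \<gamma> * \<mu> * u * t - \<alpha> * h * t)
       + b * \<mu> * t\<^sup>2 / 2"
  proof -
    define s where "s = (\<beta> * \<mu> * z + \<gamma> * \<mu> * u + h)\<^sup>2"
    show ?thesis unfolding b s_def[symmetric] by (simp add: z_def power2_eq_square algebra_simps add_divide_distrib diff_divide_distrib)
  qed
  also have "\<dots> \<le> (- \<alpha> * (\<rho>\<^sub>2 * \<beta> / 2 - 3 * \<gamma> / 2 - 1) * x\<^sup>2 - \<alpha> * (\<gamma> / 2 - 1 / (2 * \<rho>\<^sub>2)) * (\<mu> * u\<^sup>2)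
      + \<alpha> * ((\<rho> + 1) * \<gamma> + \<rho> * \<beta> / 2) * e\<^sup>2 + \<alpha> * h\<^sup>2 + (b\<^sup>2 * \<mu> / (\<alpha> * \<gamma>) + 1 / (2 * \<alpha>)) * t\<^sup>2)
    + (\<alpha>\<^sup>2 * (3 * \<rho>\<^sup>2 * \<beta>\<^sup>2 - \<rho>\<^sub>2 * \<beta> * \<gamma> + (\<rho> + 2) * \<gamma>\<^sup>2 + 1) * x\<^sup>2
      + \<alpha>\<^sup>2 * (2 * \<rho> * \<gamma>\<^sup>2 + \<rho> / 2) * (\<mu> * u\<^sup>2)
      + \<alpha>\<^sup>2 * (3 * \<rho>\<^sup>2 * \<beta>\<^sup>2 + (\<rho> - 2 * \<rho>\<^sub>2) * \<beta> * \<gamma> + (\<rho> + 2) * \<gamma>\<^sup>2 + 1) * e\<^sup>2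
      + 5 / 2 * \<alpha>\<^sup>2 * h\<^sup>2 + (\<gamma>\<^sup>2 * \<mu>\<^sup>2 / 2 + \<gamma>\<^sup>2 / 2 + 1 / 2) * t\<^sup>2)
    + b * \<mu> * t\<^sup>2 / 2"
    by (intro add_mono coordinate_first_order coordinate_second_order \<mu> pos \<beta>\<gamma> z_def order_refl)
  finally have main: "x'\<^sup>2 / 2 + b * \<mu> * u'\<^sup>2 / 2 + x' * u' - (x\<^sup>2 / 2 + b * \<mu> * u\<^sup>2 / 2 + x * u) \<le> \<dots>" .
  define D where "D = \<gamma> * \<mu> * t"
  define c\<^sub>1 where "c\<^sub>1 = b\<^sup>2 / (\<alpha> * \<gamma>) + b / 2"
  define c\<^sub>2 where "c\<^sub>2 = 1 / (2 * \<alpha>) + \<gamma>\<^sup>2 / 2 + 1 / 2"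
  have c0: "0 \<le> c\<^sub>1" "0 \<le> c\<^sub>2" using pos by (auto simp: c\<^sub>1_def c\<^sub>2_def b_def)
  \<comment> \<open>As t = D/(\<gamma>\<mu>), the lower bound \<rho>_2 of \<mu> makes the cost of
    the drift independent of the eigenvalue.\<close>
  have 1: "\<mu> * t\<^sup>2 \<le> D\<^sup>2 / (\<gamma>\<^sup>2 * \<rho>\<^sub>2)"
  proof -
    have "\<mu> * t\<^sup>2 * \<rho>\<^sub>2 \<le> \<mu> * t\<^sup>2 * \<mu>" using \<mu> \<mu>0 by (intro mult_left_mono) auto
    then show ?thesis using \<mu> pos by (simp add: D_def power_mult_distrib field_simps power2_eq_square[of \<mu>])
  qed
  have 2: "t\<^sup>2 \<le> D\<^sup>2 / (\<gamma>\<^sup>2 * \<rho>\<^sub>2\<^sup>2)"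
  proof -
    have "t\<^sup>2 * \<rho>\<^sub>2\<^sup>2 \<le> t\<^sup>2 * \<mu>\<^sup>2" using \<mu> \<mu>0 by (intro mult_left_mono power_mono) auto
    then show ?thesis using \<mu> pos by (simp add: D_def power_mult_distrib field_simps)
  qed
  have "(b\<^sup>2 * \<mu> / (\<alpha> * \<gamma>) + 1 / (2 * \<alpha>)) * t\<^sup>2 + (\<gamma>\<^sup>2 * \<mu>\<^sup>2 / 2 + \<gamma>\<^sup>2 / 2 + 1 / 2) * t\<^sup>2 + b * \<mu> * t\<^sup>2 / 2
    = c\<^sub>1 * (\<mu> * t\<^sup>2) + c\<^sub>2 * t\<^sup>2 + D\<^sup>2 / 2"
    by (simp add: c\<^sub>1_def c\<^sub>2_def D_def power_mult_distrib algebra_simps)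
  also have "\<dots> \<le> c\<^sub>1 * (D\<^sup>2 / (\<gamma>\<^sup>2 * \<rho>\<^sub>2)) + c\<^sub>2 * (D\<^sup>2 / (\<gamma>\<^sup>2 * \<rho>\<^sub>2\<^sup>2)) + D\<^sup>2 / 2"
    by (intro add_mono mult_left_mono 1 2 c0 order_refl)
  also have "\<dots> = ((\<beta> + \<gamma>)\<^sup>2 / (\<alpha> * \<gamma> ^ 5 * \<rho>\<^sub>2) + 1 / (2 * \<alpha> * \<gamma>\<^sup>2 * \<rho>\<^sub>2\<^sup>2) + (\<beta> + \<gamma>) / (2 * \<gamma> ^ 3 * \<rho>\<^sub>2)
         + 1 / (2 * \<gamma>\<^sup>2 * \<rho>\<^sub>2\<^sup>2) + 1 / (2 * \<rho>\<^sub>2\<^sup>2) + 1 / 2) * D\<^sup>2"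
  proof -
    have "c\<^sub>1 * (D\<^sup>2 / (\<gamma>\<^sup>2 * \<rho>\<^sub>2)) = ((\<beta> + \<gamma>)\<^sup>2 / (\<alpha> * \<gamma> ^ 5 * \<rho>\<^sub>2) + (\<beta> + \<gamma>) / (2 * \<gamma> ^ 3 * \<rho>\<^sub>2)) * D\<^sup>2"
    proof -
      define m where "m = \<beta> + \<gamma>"
      show ?thesis
        by (simp add: c\<^sub>1_def b_def distrib_right distrib_left add_divide_distrib eval_nat_numeral mult_ac flip: m_def)
    qed
    moreover have "c\<^sub>2 * (D\<^sup>2 / (\<gamma>\<^sup>2 * \<rho>\<^sub>2\<^sup>2)) = (1 / (2 * \<alpha> * \<gamma>\<^sup>2 * \<rho>\<^sub>2\<^sup>2) + 1 / (2 * \<rho>\<^sub>2\<^sup>2) + 1 / (2 * \<gamma>\<^sup>2 * \<rho>\<^sub>2\<^sup>2)) * D\<^sup>2"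
      using pos by (simp add: c\<^sub>2_def distrib_right distrib_left add_divide_distrib mult_ac)
    ultimately show ?thesis by (simp add: distrib_right)
  qed
  finally have tt: "(b\<^sup>2 * \<mu> / (\<alpha> * \<gamma>) + 1 / (2 * \<alpha>)) * t\<^sup>2 + (\<gamma>\<^sup>2 * \<mu>\<^sup>2 / 2 + \<gamma>\<^sup>2 / 2 + 1 / 2) * t\<^sup>2 + b * \<mu> * t\<^sup>2 / 2 \<le> \<dots>" .
  \<comment> \<open>The regrouping is stated for opaque coefficients, so that nothing but
    distributivity is involved.\<close>
  have collect: "v' \<le> v + (- \<alpha> * A + \<alpha>\<^sup>2 * A') * a + (- \<alpha> * B + \<alpha>\<^sup>2 * B') * w + (\<alpha> * E + \<alpha>\<^sup>2 * E') * c
      + (\<alpha> + 5 / 2 * \<alpha>\<^sup>2) * k + T"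
    if "v' - v \<le> (- \<alpha> * A * a - \<alpha> * B * w + \<alpha> * E * c + \<alpha> * k + T\<^sub>1)
        + (\<alpha>\<^sup>2 * A' * a + \<alpha>\<^sup>2 * B' * w + \<alpha>\<^sup>2 * E' * c + 5 / 2 * \<alpha>\<^sup>2 * k + T\<^sub>2) + T\<^sub>3"
      and "T\<^sub>1 + T\<^sub>2 + T\<^sub>3 \<le> T"
    for v v' A A' B B' E E' a w c k T T\<^sub>1 T\<^sub>2 T\<^sub>3 :: real
    using that by (simp add: algebra_simps)
  show ?thesis
    unfolding b_def[symmetric] D_def[symmetric] by (rule collect[OF main tt])
qed

subsection \<open>Eigencoordinates of the Laplacian\<close>

text \<open>The action of the Kronecker product of M with the identity, on stacked vectors given as
  families of blocks. This avoids pairs of indices; \<open>kronecker_mult_col\<close> makes the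
  link.\<close>

definition block_mult :: "real^'n^'m \<Rightarrow> ('n \<Rightarrow> 'a::real_vector) \<Rightarrow> 'm \<Rightarrow> 'a" where
  "block_mult M z i = (\<Sum>j\<in>UNIV. M $ i $ j *\<^sub>R z j)"

lemma block_mult_mult: "block_mult (M ** N) z = block_mult M (block_mult N z)"
proof
  fix i
  have "block_mult (M ** N) z i = (\<Sum>j\<in>UNIV. \<Sum>k\<in>UNIV. (M $ i $ k * N $ k $ j) *\<^sub>R z j)"
    by (simp add: block_mult_def matrix_matrix_mult_def scaleR_sum_left)
  also have "\<dots> = (\<Sum>k\<in>UNIV. \<Sum>j\<in>UNIV. (M $ i $ k * N $ k $ j) *\<^sub>R z j)"
    by (rule sum.swap)
  also have "\<dots> = block_mult M (block_mult N z) i"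
    by (simp add: block_mult_def scaleR_sum_right)
  finally show "block_mult (M ** N) z i = block_mult M (block_mult N z) i" .
qed

lemma block_mult_mat_1 [simp]: "block_mult (mat 1) z = z"
  by (rule ext) (simp add: block_mult_def mat_def if_distrib [of "\<lambda>c. c *\<^sub>R _"] cong: if_cong)

lemma block_mult_diag: "block_mult (diag_mat a) z i = a i *\<^sub>R z i"
  by (simp add: block_mult_def diag_mat_def if_distrib [of "\<lambda>c. c *\<^sub>R _"] cong: if_cong)

lemma block_mult_add: "block_mult M (\<lambda>i. z i + w i) i = block_mult M z i + block_mult M w i"
  by (simp add: block_mult_def scaleR_right_distrib sum.distrib)

lemma block_mult_scaleR: "block_mult M (\<lambda>i. c *\<^sub>R z i) i = c *\<^sub>R block_mult M z i"
  by (simp add: block_mult_def scaleR_sum_right mult.commute)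

lemma block_mult_diff: "block_mult M (\<lambda>i. z i - w i) i = block_mult M z i - block_mult M w i"
  by (simp add: block_mult_def scaleR_right_diff_distrib sum_subtractf)

lemma block_mult_const: "block_mult M (\<lambda>i. c) i = (\<Sum>j\<in>UNIV. M $ i $ j) *\<^sub>R c"
  by (simp add: block_mult_def scaleR_sum_left)

lemma sum_inner_block_mult:
  fixes x :: "'m::finite \<Rightarrow> 'a::real_inner"
  shows "(\<Sum>i\<in>UNIV. x i \<bullet> block_mult M z i) = (\<Sum>j\<in>UNIV. block_mult (transpose M) x j \<bullet> z j)"
proof -
  have "(\<Sum>i\<in>UNIV. x i \<bullet> block_mult M z i) = (\<Sum>i\<in>UNIV. \<Sum>j\<in>UNIV. M $ i $ j * (x i \<bullet> z j))"
    by (simp add: block_mult_def inner_sum_right)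
  also have "\<dots> = (\<Sum>j\<in>UNIV. \<Sum>i\<in>UNIV. M $ i $ j * (x i \<bullet> z j))"
    by (rule sum.swap)
  finally show ?thesis
    by (simp add: block_mult_def inner_sum_left transpose_def)
qed

lemma inner_col: "col x \<bullet> col z = (\<Sum>i\<in>UNIV. x i \<bullet> z i)"
  by (simp add: col_def inner_vec_def sum.cartesian_product case_prod_unfold)

lemma kronecker_mult_col:
  fixes z :: "'n::finite \<Rightarrow> real^'d::finite"
  shows "kronecker M (mat 1) *v col z = col (block_mult M z)"
proof -
  have "(\<Sum>j\<in>UNIV. M $ i $ fst j * (mat 1 :: real^'d^'d) $ c $ snd j * z (fst j) $ snd j)
      = (\<Sum>j\<in>UNIV. M $ i $ j * z j $ c)" for i c
  proof -
    have "(\<Sum>j\<in>UNIV. M $ i $ fst j * (mat 1 :: real^'d^'d) $ c $ snd j * z (fst j) $ snd j)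
      = (\<Sum>j\<in>UNIV. \<Sum>b\<in>UNIV. M $ i $ j * (mat 1 :: real^'d^'d) $ c $ b * z j $ b)"
      by (simp add: sum.cartesian_product case_prod_unfold)
    also have "\<dots> = (\<Sum>j\<in>UNIV. \<Sum>b\<in>UNIV. if b = c then M $ i $ j * z j $ c else 0)"
      by (intro sum.cong) (auto simp: mat_def)
    finally show ?thesis by simp
  qed
  then show ?thesis
    by (simp add: vec_eq_iff kronecker_def col_def matrix_vector_mult_def block_mult_def)
qed

text \<open>Columns of \<open>P\<close> are eigenvectors; conversely, a nonzero entry of
  \<open>R *v v\<close> singles out the eigenvalue of v. The field is arbitrary because \<rho>_2 is
  defined by real eigenvalues and the spectral radius by complex ones.\<close>

lemma eigenvalue_diagonalizable:
  fixes M P D R :: "'a::field^'n^'n"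
  assumes M: "M = P ** D ** R" and RP: "R ** P = mat 1"
    and D: "\<And>i j. D $ i $ j = (if i = j then a i else 0)"
  shows "{c. eigenvalue M c} = range a"
proof -
  have PR: "P ** R = mat 1" by (rule matrix_left_right_inverse1[OF RP])
  have Dv: "(D *v u) $ i = a i * u $ i" for u i
    by (simp add: matrix_vector_mult_def D if_distrib [of "\<lambda>c. c * _"] cong: if_cong)
  have "eigenvalue M c \<longleftrightarrow> c \<in> range a" for c
  proof
    assume "eigenvalue M c"
    then obtain v where v: "v \<noteq> 0" "M *v v = c *s v" by (auto simp: eigenvalue_def)
    define u where "u = R *v v"
    have "P *v u = v" by (simp add: u_def matrix_vector_mul_assoc PR)
    then have "u \<noteq> 0" using v by auto
    then obtain i where i: "u $ i \<noteq> 0" by (auto simp: vec_eq_iff)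
    have "D *v u = R *v (M *v v)"
      by (simp add: u_def M matrix_vector_mul_assoc matrix_mul_assoc RP)
    also have "\<dots> = c *s u" by (simp add: v u_def vector_scalar_commute)
    finally have "a i * u $ i = c * u $ i" by (metis Dv vector_smult_component)
    then show "c \<in> range a" using i by auto
  next
    assume "c \<in> range a"
    then obtain i where c: "c = a i" by auto
    define v where "v = P *v axis i 1"
    have Rv: "R *v v = axis i 1" by (simp add: v_def matrix_vector_mul_assoc RP)
    then have "v \<noteq> 0" by (auto simp: axis_eq_0_iff)
    moreover have "M *v v = P *v (D *v axis i 1)"
      by (simp add: M Rv flip: matrix_vector_mul_assoc)
    moreover have "D *v axis i 1 = c *s axis i 1"
      by (simp add: vec_eq_iff Dv c axis_def)
    ultimately show "eigenvalue M c"
      by (auto simp: eigenvalue_def v_def vector_scalar_commute)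
  qed
  then show ?thesis by blast
qed

lemma map_matrix_of_real_mult:
  "map_matrix complex_of_real (M ** N) = map_matrix complex_of_real M ** map_matrix complex_of_real N"
  by (simp add: vec_eq_iff map_matrix_def matrix_matrix_mult_def)

lemma sum_UNIV_split:
  fixes f :: "'n::finite \<Rightarrow> 'a::comm_monoid_add"
  shows "(\<Sum>i\<in>UNIV. f i) = f a + (\<Sum>i\<in>-{a}. f i)"
  unfolding Compl_eq_Diff_UNIV by (rule sum.remove) auto

locale eigenbasis =
  fixes P :: "real^'n^'n" and i1 :: 'n and lam :: "'n \<Rightarrow> real" and L :: "real^'n^'n"
  assumes decomposition: "laplacian_eigendecomposition L i1 P lam"
begin

definition eigval :: "'n \<Rightarrow> real" where "eigval i = (if i = i1 then 0 else lam i)"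

text \<open>Coordinates in the eigenbasis, one block per eigenvector; \<open>coord z i1\<close> is
  the consensus component.\<close>

definition coord :: "('n \<Rightarrow> 'a::real_vector) \<Rightarrow> 'n \<Rightarrow> 'a" where
  "coord = block_mult (transpose P)"

lemma
  shows orth: "transpose P ** P = mat 1" "P ** transpose P = mat 1"
    and P_column_i1: "P $ j $ i1 = 1 / sqrt (real CARD('n))"
    and lam_pos: "i \<noteq> i1 \<Longrightarrow> 0 < lam i"
    and L_eq: "L = P ** diag_mat eigval ** transpose P"
proof -
  have "column i1 P $ j = 1 / sqrt (real CARD('n))"
    using decomposition by (simp add: laplacian_eigendecomposition_def)
  then show "P $ j $ i1 = 1 / sqrt (real CARD('n))" by (simp add: column_def)
qed (use decomposition in \<open>auto simp: laplacian_eigendecomposition_def orthogonal_matrix_def eigval_def[abs_def]\<close>)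

lemma coord_diag_block_mult:
  assumes "M = P ** diag_mat a ** transpose P"
  shows "coord (block_mult M z) i = a i *\<^sub>R coord z i"
proof -
  have "coord (block_mult M z) = block_mult (transpose P ** P) (block_mult (diag_mat a) (coord z))"
    by (simp add: coord_def assms block_mult_mult)
  then show ?thesis by (simp add: orth block_mult_diag)
qed

lemma coord_add: "coord (\<lambda>j. z1 j + z2 j) i = coord z1 i + coord z2 i"
  by (simp add: coord_def block_mult_add)

lemma coord_diff: "coord (\<lambda>j. z1 j - z2 j) i = coord z1 i - coord z2 i"
  by (simp add: coord_def block_mult_diff)

lemma coord_scaleR: "coord (\<lambda>j. a *\<^sub>R z j) i = a *\<^sub>R coord z i"
  by (simp add: coord_def block_mult_scaleR)

lemma coord_L: "coord (\<lambda>j. block_mult L z j) i = eigval i *\<^sub>R coord z i"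
  by (simp add: coord_diag_block_mult[OF L_eq])

lemma sum_inner_diag_block_mult:
  fixes x z :: "'n \<Rightarrow> 'a::real_inner"
  assumes "M = P ** diag_mat a ** transpose P"
  shows "(\<Sum>i\<in>UNIV. x i \<bullet> block_mult M z i) = (\<Sum>i\<in>UNIV. a i * (coord x i \<bullet> coord z i))"
proof -
  have "(\<Sum>i\<in>UNIV. x i \<bullet> block_mult M z i)
      = (\<Sum>i\<in>UNIV. x i \<bullet> block_mult P (block_mult (diag_mat a) (coord z)) i)"
    by (simp add: coord_def assms block_mult_mult)
  then show ?thesis
    by (simp add: sum_inner_block_mult block_mult_diag flip: coord_def)
qed

lemma sum_inner_coord: "(\<Sum>i\<in>UNIV. coord x i \<bullet> coord z i) = (\<Sum>i\<in>UNIV. x i \<bullet> z i)"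
  for x z :: "'n \<Rightarrow> 'a::real_inner"
  unfolding coord_def sum_inner_block_mult by (simp add: orth flip: block_mult_mult)

lemma sum_norm_coord: "(\<Sum>i\<in>UNIV. (norm (coord z i))\<^sup>2) = (\<Sum>i\<in>UNIV. (norm (z i))\<^sup>2)"
  for z :: "'n \<Rightarrow> 'a::real_inner"
  using sum_inner_coord[of z z] by (simp add: power2_norm_eq_inner)

lemma sum_norm_coord_split:
  "(norm (coord z i1))\<^sup>2 + (\<Sum>i\<in>-{i1}. (norm (coord z i))\<^sup>2) = (\<Sum>i\<in>UNIV. (norm (z i))\<^sup>2)"
  for z :: "'n \<Rightarrow> 'a::real_inner"
  using sum_UNIV_split[of "\<lambda>i. (norm (coord z i))\<^sup>2" i1] sum_norm_coord[of z] by simp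

lemma coord_mean: "coord z i1 = sqrt (real CARD('n)) *\<^sub>R ((1 / real CARD('n)) *\<^sub>R (\<Sum>i\<in>UNIV. z i))"
proof -
  have "coord z i1 = (1 / sqrt (real CARD('n))) *\<^sub>R (\<Sum>i\<in>UNIV. z i)"
    by (simp add: coord_def block_mult_def transpose_def P_column_i1 scaleR_sum_right)
  also have "1 / sqrt (real CARD('n)) = sqrt (real CARD('n)) * (1 / real CARD('n))"
    by (simp add: real_div_sqrt field_simps)
  finally show ?thesis by simp
qed

text \<open>The other columns of \<open>P\<close> are orthogonal to the constant column
  \<open>i1\<close>, so their entries sum to 0.\<close>

lemma coord_const: "i \<noteq> i1 \<Longrightarrow> coord (\<lambda>j. c) i = 0"
proof -
  assume i: "i \<noteq> i1"
  have "(transpose P ** P) $ i $ i1 = 0" using i by (simp add: orth mat_def)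
  then have "(\<Sum>j\<in>UNIV. P $ j $ i) / sqrt (real CARD('n)) = 0"
    by (simp add: matrix_matrix_mult_def transpose_def P_column_i1 sum_divide_distrib)
  then show ?thesis by (simp add: coord_def block_mult_const transpose_def)
qed

text \<open>Subtracting the mean removes the coordinate at \<open>i1\<close> and changes no other,
  so Parseval's identity applies. This turns the consensus error of the theorem into a sum over
  eigenvectors.\<close>

lemma sum_norm_deviation:
  fixes z :: "'n \<Rightarrow> 'a::real_inner"
  assumes "m = (1 / real CARD('n)) *\<^sub>R (\<Sum>i\<in>UNIV. z i)"
  shows "(\<Sum>i\<in>UNIV. (norm (z i - m))\<^sup>2) = (\<Sum>i\<in>-{i1}. (norm (coord z i))\<^sup>2)"
proof -
  have "coord (\<lambda>i. z i - m) i1 = 0"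
    unfolding coord_diff coord_mean by (simp add: assms sum_constant_scaleR)
  moreover have "coord (\<lambda>i. z i - m) j = coord z j" if "j \<noteq> i1" for j
    unfolding coord_diff by (simp add: coord_const that)
  ultimately show ?thesis
    using sum_norm_coord_split[of "\<lambda>i. z i - m"] by simp
qed

text \<open>The identity is the sum of the rank-one projections onto the columns of
  \<open>P\<close>, and the projection for \<open>i1\<close> is the averaging matrix that
  \<open>E_mat\<close> subtracts.\<close>

lemma E_mat_eq: "(E_mat :: real^'n^'n) = P ** diag_mat (\<lambda>i. if i = i1 then 0 else 1) ** transpose P"
proof -
  have D: "(P ** diag_mat a) $ i $ k = P $ i $ k * a k" for a i k
    by (simp add: matrix_matrix_mult_def diag_mat_def if_distrib [of "(*) _"] cong: if_cong)
  have "(P ** diag_mat (\<lambda>i. if i = i1 then 0 else 1) ** transpose P) $ i $ j = E_mat $ i $ j" for i j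
  proof -
    have "(\<Sum>k\<in>UNIV. P $ i $ k * P $ j $ k) = mat 1 $ i $ j"
      unfolding orth(2)[symmetric] by (simp add: matrix_matrix_mult_def transpose_def)
    then have "P $ i $ i1 * P $ j $ i1 + (\<Sum>k\<in>-{i1}. P $ i $ k * P $ j $ k) = mat 1 $ i $ j"
      unfolding sum_UNIV_split[of _ i1] .
    moreover have "(P ** diag_mat (\<lambda>i. if i = i1 then 0 else 1) ** transpose P) $ i $ j
        = (\<Sum>k\<in>-{i1}. P $ i $ k * P $ j $ k)"
    proof -
      have "(P ** diag_mat (\<lambda>i. if i = i1 then 0 else 1) ** transpose P) $ i $ j
        = (\<Sum>k\<in>UNIV. (P ** diag_mat (\<lambda>i. if i = i1 then 0 else 1)) $ i $ k * P $ j $ k)"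
        by (simp add: matrix_matrix_mult_def[of "_ ** _"] transpose_def)
      also have "\<dots> = (\<Sum>k\<in>-{i1}. P $ i $ k * P $ j $ k)"
        unfolding D by (rule sum.mono_neutral_cong_right) auto
      finally show ?thesis .
    qed
    ultimately show ?thesis by (simp add: E_mat_def P_column_i1)
  qed
  then show ?thesis by (simp add: vec_eq_iff)
qed

lemma eigenvalues: "{c. eigenvalue L c} = range eigval"
  by (rule eigenvalue_diagonalizable[OF L_eq orth(1)]) (simp add: diag_mat_def)

lemma complex_eigenvalues: "{c. eigenvalue (map_matrix complex_of_real L) c} = range (\<lambda>i. complex_of_real (eigval i))"
proof (rule eigenvalue_diagonalizable)
  show "map_matrix complex_of_real L = map_matrix complex_of_real P ** map_matrix complex_of_real (diag_mat eigval)
      ** map_matrix complex_of_real (transpose P)"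
    unfolding L_eq by (simp only: map_matrix_of_real_mult)
  have "map_matrix complex_of_real (transpose P) ** map_matrix complex_of_real P
      = map_matrix complex_of_real (mat 1)"
    by (simp only: orth flip: map_matrix_of_real_mult)
  also have "\<dots> = mat 1" by (simp add: vec_eq_iff map_matrix_def mat_def)
  finally show "map_matrix complex_of_real (transpose P) ** map_matrix complex_of_real P = mat 1" .
qed (simp add: map_matrix_def diag_mat_def)

text \<open>The index i supplies the positive eigenvalue \<open>lam i\<close>, so the minimum is
  taken over a nonempty set.\<close>

lemma least_pos_eigenvalue_le: "i \<noteq> i1 \<Longrightarrow> least_pos_eigenvalue L \<le> lam i"
  and least_pos_eigenvalue_pos: "i \<noteq> i1 \<Longrightarrow> 0 < least_pos_eigenvalue L"
proof -
  assume i: "i \<noteq> i1"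
  define S where "S = {c. 0 < c \<and> eigenvalue L c}"
  have S: "S = {c. 0 < c} \<inter> range eigval" unfolding S_def eigenvalues[symmetric] by auto
  then have fin: "finite S" by simp
  have mem: "lam i \<in> S" using i lam_pos by (auto simp: S eigval_def image_iff)
  have eq: "least_pos_eigenvalue L = Min S" by (simp add: least_pos_eigenvalue_def S_def)
  show "least_pos_eigenvalue L \<le> lam i" unfolding eq by (rule Min_le[OF fin mem])
  have "Min S \<in> S" using fin mem by (intro Min_in) auto
  then show "0 < least_pos_eigenvalue L" by (simp add: eq S)
qed

lemma le_spectral_radius: "i \<noteq> i1 \<Longrightarrow> lam i \<le> spectral_radius L"
proof -
  assume i: "i \<noteq> i1"
  have "cmod (complex_of_real (lam i)) \<in> cmod ` range (\<lambda>i. complex_of_real (eigval i))"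
    using i by (auto simp: eigval_def image_iff intro!: exI[of _ i])
  then have "cmod (complex_of_real (lam i)) \<le> spectral_radius L"
    unfolding spectral_radius_def complex_eigenvalues by (intro Max_ge) auto
  then show ?thesis by simp
qed

lemma wnorm_sq_E: "wnorm_sq (kronecker E_mat (mat 1)) (col x) = (\<Sum>i\<in>-{i1}. (norm (coord x i))\<^sup>2)"
proof -
  have "wnorm_sq (kronecker E_mat (mat 1)) (col x)
      = (\<Sum>i\<in>UNIV. (if i = i1 then 0 else 1) * (coord x i \<bullet> coord x i))"
    by (simp add: wnorm_sq_def kronecker_mult_col inner_col sum_inner_diag_block_mult[OF E_mat_eq])
  also have "\<dots> = (\<Sum>i\<in>-{i1}. (norm (coord x i))\<^sup>2)"
    by (rule sum.mono_neutral_cong_right) (auto simp: power2_norm_eq_inner)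
  finally show ?thesis .
qed

text \<open>Unlike E, the matrix F also weighs the consensus direction, by 1/m where m is
  lambda_{n+1}.\<close>

lemma wnorm_sq_F:
  "wnorm_sq (c *\<^sub>R kronecker (F_mat i1 P lam m) (mat 1)) (col x)
    = c * ((norm (coord x i1))\<^sup>2 / m + (\<Sum>i\<in>-{i1}. (norm (coord x i))\<^sup>2 / lam i))"
proof -
  have "wnorm_sq (c *\<^sub>R kronecker (F_mat i1 P lam m) (mat 1)) (col x)
      = c * (\<Sum>i\<in>UNIV. (if i = i1 then inverse m else inverse (lam i)) * (coord x i \<bullet> coord x i))"
    by (simp add: wnorm_sq_def scaleR_matrix_vector_assoc[symmetric] kronecker_mult_col inner_col
        sum_inner_diag_block_mult[OF F_mat_def])
  also have "(\<Sum>i\<in>UNIV. (if i = i1 then inverse m else inverse (lam i)) * (coord x i \<bullet> coord x i))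
      = (norm (coord x i1))\<^sup>2 / m
        + (\<Sum>i\<in>-{i1}. (if i = i1 then inverse m else inverse (lam i)) * (coord x i \<bullet> coord x i))"
    unfolding sum_UNIV_split[of _ i1] by (simp add: power2_norm_eq_inner divide_inverse)
  also have "(\<Sum>i\<in>-{i1}. (if i = i1 then inverse m else inverse (lam i)) * (coord x i \<bullet> coord x i))
      = (\<Sum>i\<in>-{i1}. (norm (coord x i))\<^sup>2 / lam i)"
    by (rule sum.cong) (auto simp: power2_norm_eq_inner divide_inverse mult.commute)
  finally show ?thesis .
qed

lemma inner_EF:
  "col x \<bullet> ((kronecker E_mat (mat 1) ** kronecker (F_mat i1 P lam m) (mat 1)) *v col z)
    = (\<Sum>i\<in>-{i1}. (coord x i \<bullet> coord z i) / lam i)"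
proof -
  have "col x \<bullet> ((kronecker E_mat (mat 1) ** kronecker (F_mat i1 P lam m) (mat 1)) *v col z)
    = (\<Sum>i\<in>UNIV. (if i = i1 then 0 else 1) * (coord x i \<bullet> coord (block_mult (F_mat i1 P lam m) z) i))"
    by (simp add: kronecker_mult_col inner_col sum_inner_diag_block_mult[OF E_mat_eq]
        flip: matrix_vector_mul_assoc)
  also have "\<dots> = (\<Sum>i\<in>-{i1}. (coord x i \<bullet> coord z i) / lam i)"
    by (rule sum.mono_neutral_cong_right)
      (auto simp: coord_diag_block_mult[OF F_mat_def] divide_inverse mult.commute)
  finally show ?thesis .
qed

end

subsection \<open>Gradients\<close>

text \<open>\<open>gradient\<close> is a definite description, so uniqueness of the derivative is
  what makes it usable.\<close>

lemma gradient_eq: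
  fixes f :: "'a::euclidean_space \<Rightarrow> real"
  assumes "GDERIV f z :> D"
  shows "gradient f z = D"
proof -
  have "D' = D" if "GDERIV f z :> D'" for D'
  proof -
    have "(\<lambda>h. h \<bullet> D') = (\<lambda>h. h \<bullet> D)"
      using that assms by (auto simp: gderiv_def intro: has_derivative_unique)
    then have "\<forall>h. h \<bullet> D' = h \<bullet> D" by metis
    then show ?thesis by (simp only: vector_eq_ldot)
  qed
  with assms show ?thesis unfolding gradient_def by blast
qed

text \<open>The derivative is represented by a vector through its values on the standard
  basis.\<close>

lemma GDERIV_gradient:
  fixes f :: "'a::euclidean_space \<Rightarrow> real"
  assumes "f differentiable (at z)"
  shows "GDERIV f z :> gradient f z"
proof -
  from assms obtain f' where f': "(f has_derivative f') (at z)" by (auto simp: differentiable_def)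
  then have "linear f'" by (rule has_derivative_linear)
  then have "f' = (\<lambda>h. h \<bullet> (\<Sum>b\<in>Basis. f' b *\<^sub>R b))"
    by (intro ext, subst (1) euclidean_representation[symmetric])
      (simp add: linear_sum linear_cmul inner_sum_right mult.commute)
  with f' have "GDERIV f z :> (\<Sum>b\<in>Basis. f' b *\<^sub>R b)" by (simp add: gderiv_def)
  then show ?thesis using gradient_eq by metis
qed

lemma GDERIV_sum:
  assumes "\<And>i. i \<in> S \<Longrightarrow> GDERIV (f i) z :> g i"
  shows "GDERIV (\<lambda>z. \<Sum>i\<in>S. f i z) z :> (\<Sum>i\<in>S. g i)"
  using assms unfolding gderiv_def inner_sum_right by (intro has_derivative_sum) auto

lemma GDERIV_cmult:
  assumes "GDERIV f z :> g"
  shows "GDERIV (\<lambda>z. c * f z) z :> c *\<^sub>R g"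
  using assms unfolding gderiv_def by (simp add: has_derivative_mult_right)

text \<open>The descent lemma. Along the segment from z to w, the difference \<open>F\<close>
  between f and its quadratic upper model is nonincreasing, by Cauchy-Schwarz and the Lipschitz
  bound.\<close>

lemma lipschitz_gradient_upper_bound:
  fixes f :: "'a::real_inner \<Rightarrow> real"
  assumes deriv: "\<And>z. GDERIV f z :> g z"
    and lip: "\<And>z w. norm (g z - g w) \<le> l * norm (z - w)"
  shows "f w \<le> f z + g z \<bullet> (w - z) + l / 2 * (norm (w - z))\<^sup>2"
proof -
  define d where "d = w - z"
  define F where "F t = f (z + t *\<^sub>R d) - t * (g z \<bullet> d) - l / 2 * t\<^sup>2 * (norm d)\<^sup>2" for t
  have F': "(F has_real_derivative (g (z + t *\<^sub>R d) - g z) \<bullet> d - l * t * (norm d)\<^sup>2) (at t)" for t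
  proof -
    have "((\<lambda>t. z + t *\<^sub>R d) has_derivative (\<lambda>s. s *\<^sub>R d)) (at t)"
      by (auto intro!: derivative_eq_intros)
    then have "((\<lambda>t. f (z + t *\<^sub>R d)) has_derivative (\<lambda>s. (s *\<^sub>R d) \<bullet> g (z + t *\<^sub>R d))) (at t)"
      using deriv[of "z + t *\<^sub>R d"] unfolding gderiv_def
      by (rule has_derivative_compose)
    moreover have "(\<lambda>s. (s *\<^sub>R d) \<bullet> g (z + t *\<^sub>R d)) = (*) (g (z + t *\<^sub>R d) \<bullet> d)"
      by (auto simp: inner_commute mult.commute)
    ultimately have "((\<lambda>t. f (z + t *\<^sub>R d)) has_real_derivative g (z + t *\<^sub>R d) \<bullet> d) (at t)"
      by (simp add: has_field_derivative_def)
    then show ?thesis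
      unfolding F_def by (auto intro!: derivative_eq_intros simp: inner_diff_left)
  qed
  have "F 1 \<le> F 0"
  proof (rule DERIV_nonpos_imp_nonincreasing[where f = F and a = 0 and b = 1])
    fix t :: real
    assume t: "0 \<le> t" "t \<le> 1"
    have "(g (z + t *\<^sub>R d) - g z) \<bullet> d \<le> norm (g (z + t *\<^sub>R d) - g z) * norm d"
      by (rule norm_cauchy_schwarz)
    also have "\<dots> \<le> (l * norm (z + t *\<^sub>R d - z)) * norm d"
      by (intro mult_right_mono lip) auto
    also have "\<dots> = l * t * (norm d)\<^sup>2" using t by (simp add: power2_eq_square)
    finally show "\<exists>y. (F has_real_derivative y) (at t) \<and> y \<le> 0"
      using F' by (intro exI conjI) auto
  qed simp
  then show ?thesis by (simp add: F_def d_def)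
qed

subsection \<open>Energy of the consensus error\<close>

lemma norm_sq_components: "(norm (x :: real^'d))\<^sup>2 = (\<Sum>c\<in>UNIV. (x $ c)\<^sup>2)"
  unfolding power2_norm_eq_inner inner_vec_def by (simp add: power2_eq_square)

text \<open>The scalar inequality for each component, with u = w/\<mu> and t = D/(\<gamma>\<mu>),
  summed over the components. Coefficients enter through equations so that they stay atomic in the
  sums.\<close>

lemma coordinate_descent_vec:
  fixes x w e h D x' w' :: "real^'d" and \<mu> \<rho>\<^sub>2 \<rho> \<alpha> \<beta> \<gamma> :: real
  assumes \<mu>: "0 < \<rho>\<^sub>2" "\<rho>\<^sub>2 \<le> \<mu>" "\<mu> \<le> \<rho>" and pos: "0 < \<alpha>" "0 < \<beta>" "0 < \<gamma>" and \<beta>\<gamma>: "\<gamma> \<le> \<rho>\<^sub>2 * \<beta>"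
    and x': "x' = x - \<alpha> *\<^sub>R ((\<beta> * \<mu>) *\<^sub>R (x + e) + \<gamma> *\<^sub>R w + h)"
    and w': "w' = w + (\<alpha> * \<gamma> * \<mu>) *\<^sub>R (x + e) + (1 / \<gamma>) *\<^sub>R D"
    and b: "b = (\<beta> + \<gamma>) / \<gamma>"
    and cx: "cx = - \<alpha> * (\<rho>\<^sub>2 * \<beta> / 2 - 3 * \<gamma> / 2 - 1)
         + \<alpha>\<^sup>2 * (3 * \<rho>\<^sup>2 * \<beta>\<^sup>2 - \<rho>\<^sub>2 * \<beta> * \<gamma> + (\<rho> + 2) * \<gamma>\<^sup>2 + 1)"
    and cw: "cw = - \<alpha> * (\<gamma> / 2 - 1 / (2 * \<rho>\<^sub>2)) + \<alpha>\<^sup>2 * (2 * \<rho> * \<gamma>\<^sup>2 + \<rho> / 2)"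
    and ce: "ce = \<alpha> * ((\<rho> + 1) * \<gamma> + \<rho> * \<beta> / 2)
         + \<alpha>\<^sup>2 * (3 * \<rho>\<^sup>2 * \<beta>\<^sup>2 + (\<rho> - 2 * \<rho>\<^sub>2) * \<beta> * \<gamma> + (\<rho> + 2) * \<gamma>\<^sup>2 + 1)"
    and ch: "ch = \<alpha> + 5 / 2 * \<alpha>\<^sup>2"
    and cd: "cd = (\<beta> + \<gamma>)\<^sup>2 / (\<alpha> * \<gamma> ^ 5 * \<rho>\<^sub>2) + 1 / (2 * \<alpha> * \<gamma>\<^sup>2 * \<rho>\<^sub>2\<^sup>2) + (\<beta> + \<gamma>) / (2 * \<gamma> ^ 3 * \<rho>\<^sub>2)
         + 1 / (2 * \<gamma>\<^sup>2 * \<rho>\<^sub>2\<^sup>2) + 1 / (2 * \<rho>\<^sub>2\<^sup>2) + 1 / 2"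
  shows "(norm x')\<^sup>2 / 2 + b / 2 * ((norm w')\<^sup>2 / \<mu>) + (x' \<bullet> w') / \<mu>
    \<le> (norm x)\<^sup>2 / 2 + b / 2 * ((norm w)\<^sup>2 / \<mu>) + (x \<bullet> w) / \<mu>
      + cx * (norm x)\<^sup>2 + cw * ((norm w)\<^sup>2 / \<mu>) + ce * (norm e)\<^sup>2 + ch * (norm h)\<^sup>2 + cd * (norm D)\<^sup>2"
proof -
  have \<mu>0: "0 < \<mu>" using \<mu> by simp
  have comp: "(x' $ c)\<^sup>2 / 2 + b / 2 * ((w' $ c)\<^sup>2 / \<mu>) + (x' $ c * w' $ c) / \<mu>
    \<le> (x $ c)\<^sup>2 / 2 + b / 2 * ((w $ c)\<^sup>2 / \<mu>) + (x $ c * w $ c) / \<mu>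
      + cx * (x $ c)\<^sup>2 + cw * ((w $ c)\<^sup>2 / \<mu>) + ce * (e $ c)\<^sup>2 + ch * (h $ c)\<^sup>2 + cd * (D $ c)\<^sup>2" for c
  proof -
    define u u' t where "u = w $ c / \<mu>" and "u' = w' $ c / \<mu>" and "t = D $ c / (\<gamma> * \<mu>)"
    have xc: "x' $ c = x $ c - \<alpha> * (\<beta> * \<mu> * (x $ c + e $ c) + \<gamma> * \<mu> * u + h $ c)"
      using \<mu>0 by (simp add: x' u_def)
    have uc: "u' = u + \<alpha> * \<gamma> * (x $ c + e $ c) + t"
      using \<mu>0 pos by (simp add: w' u_def u'_def t_def add_divide_distrib)
    have "(x' $ c)\<^sup>2 / 2 + b * \<mu> * u'\<^sup>2 / 2 + x' $ c * u'
      \<le> (x $ c)\<^sup>2 / 2 + b * \<mu> * u\<^sup>2 / 2 + x $ c * u + cx * (x $ c)\<^sup>2 + cw * (\<mu> * u\<^sup>2) + ce * (e $ c)\<^sup>2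
        + ch * (h $ c)\<^sup>2 + cd * (\<gamma> * \<mu> * t)\<^sup>2"
      unfolding b cx cw ce ch cd by (rule coordinate_descent[OF \<mu> pos \<beta>\<gamma> xc uc])
    moreover have "\<mu> * u\<^sup>2 = (w $ c)\<^sup>2 / \<mu>" "\<mu> * u'\<^sup>2 = (w' $ c)\<^sup>2 / \<mu>" "\<gamma> * \<mu> * t = D $ c"
      using \<mu>0 pos by (simp_all add: u_def u'_def t_def power2_eq_square)
    ultimately show ?thesis by (simp add: u_def u'_def mult.assoc)
  qed
  have "(\<Sum>c\<in>UNIV. (x' $ c)\<^sup>2 / 2 + b / 2 * ((w' $ c)\<^sup>2 / \<mu>) + (x' $ c * w' $ c) / \<mu>)
    \<le> (\<Sum>c\<in>UNIV. (x $ c)\<^sup>2 / 2 + b / 2 * ((w $ c)\<^sup>2 / \<mu>) + (x $ c * w $ c) / \<mu>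
      + cx * (x $ c)\<^sup>2 + cw * ((w $ c)\<^sup>2 / \<mu>) + ce * (e $ c)\<^sup>2 + ch * (h $ c)\<^sup>2 + cd * (D $ c)\<^sup>2)"
    by (intro sum_mono comp)
  then show ?thesis
    unfolding norm_sq_components inner_vec_def
    by (simp add: sum.distrib flip: sum_distrib_left sum_divide_distrib)
qed

context eigenbasis
begin

text \<open>\<open>sq_E\<close>, \<open>sq_EF\<close> and \<open>cross_EF\<close> are the forms z^T
  E z, z^T E F z and x^T E F z in eigencoordinates. The consensus part of the F-norm is kept apart
  because it evolves differently.\<close>

definition sq_E :: "('n \<Rightarrow> 'a::real_inner) \<Rightarrow> real" where
  "sq_E z = (\<Sum>i\<in>-{i1}. (norm (coord z i))\<^sup>2)"

definition sq_EF :: "('n \<Rightarrow> 'a::real_inner) \<Rightarrow> real" where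
  "sq_EF z = (\<Sum>i\<in>-{i1}. (norm (coord z i))\<^sup>2 / lam i)"

definition cross_EF :: "('n \<Rightarrow> 'a::real_inner) \<Rightarrow> ('n \<Rightarrow> 'a) \<Rightarrow> real" where
  "cross_EF x z = (\<Sum>i\<in>-{i1}. (coord x i \<bullet> coord z i) / lam i)"

text \<open>With b = (\<beta>+\<gamma>)/\<gamma> and m = lambda_{n+1} this is the Lyapunov function
  without the optimality gap.\<close>

definition consensus_energy :: "real \<Rightarrow> real \<Rightarrow> ('n \<Rightarrow> 'a::real_inner) \<Rightarrow> ('n \<Rightarrow> 'a) \<Rightarrow> real" where
  "consensus_energy b m x w
     = sq_E x / 2 + b / 2 * ((norm (coord w i1))\<^sup>2 / m + sq_EF w) + cross_EF x w"

text \<open>Off the consensus direction the vector inequality is summed over eigenvectors. In the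
  consensus direction w moves only by D/\<gamma>, and Young's inequality leaves a positive multiple
  of |w|^2 that the energy itself cannot absorb; this last summand is settled in
  \<open>descent_combination\<close>.\<close>

lemma consensus_energy_step:
  fixes x w e h D x' w' :: "'n \<Rightarrow> real^'d"
  assumes \<rho>\<^sub>2: "0 < \<rho>\<^sub>2" and lam: "\<And>i. i \<noteq> i1 \<Longrightarrow> \<rho>\<^sub>2 \<le> lam i" "\<And>i. i \<noteq> i1 \<Longrightarrow> lam i \<le> \<rho>" and m: "\<rho>\<^sub>2 \<le> m"
    and pos: "0 < \<alpha>" "0 < \<beta>" "0 < \<gamma>" and \<beta>\<gamma>: "\<gamma> \<le> \<rho>\<^sub>2 * \<beta>"
    and x': "\<And>j. x' j = x j - \<alpha> *\<^sub>R (\<beta> *\<^sub>R block_mult L (\<lambda>j. x j + e j) j + \<gamma> *\<^sub>R w j + h j)"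
    and w': "\<And>j. w' j = w j + (\<alpha> * \<gamma>) *\<^sub>R block_mult L (\<lambda>j. x j + e j) j + (1 / \<gamma>) *\<^sub>R D j"
    and b: "b = (\<beta> + \<gamma>) / \<gamma>"
    and cx: "cx = - \<alpha> * (\<rho>\<^sub>2 * \<beta> / 2 - 3 * \<gamma> / 2 - 1)
         + \<alpha>\<^sup>2 * (3 * \<rho>\<^sup>2 * \<beta>\<^sup>2 - \<rho>\<^sub>2 * \<beta> * \<gamma> + (\<rho> + 2) * \<gamma>\<^sup>2 + 1)"
    and cw: "cw = - \<alpha> * (\<gamma> / 2 - 1 / (2 * \<rho>\<^sub>2)) + \<alpha>\<^sup>2 * (2 * \<rho> * \<gamma>\<^sup>2 + \<rho> / 2)"
    and ce: "ce = \<alpha> * ((\<rho> + 1) * \<gamma> + \<rho> * \<beta> / 2)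
         + \<alpha>\<^sup>2 * (3 * \<rho>\<^sup>2 * \<beta>\<^sup>2 + (\<rho> - 2 * \<rho>\<^sub>2) * \<beta> * \<gamma> + (\<rho> + 2) * \<gamma>\<^sup>2 + 1)"
    and ch: "ch = \<alpha> + 5 / 2 * \<alpha>\<^sup>2"
    and cd: "cd = (\<beta> + \<gamma>)\<^sup>2 / (\<alpha> * \<gamma> ^ 5 * \<rho>\<^sub>2) + 1 / (2 * \<alpha> * \<gamma>\<^sup>2 * \<rho>\<^sub>2\<^sup>2) + (\<beta> + \<gamma>) / (2 * \<gamma> ^ 3 * \<rho>\<^sub>2)
         + 1 / (2 * \<gamma>\<^sup>2 * \<rho>\<^sub>2\<^sup>2) + 1 / (2 * \<rho>\<^sub>2\<^sup>2) + 1 / 2"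
  shows "consensus_energy b m x' w'
    \<le> consensus_energy b m x w + cx * sq_E x + cw * sq_EF w + ce * sq_E e + ch * sq_E h
      + cd * (\<Sum>i\<in>UNIV. (norm (D i))\<^sup>2) + \<alpha> * \<gamma> / 4 * ((norm (coord w i1))\<^sup>2 / m)"
proof -
  have m0: "0 < m" using \<rho>\<^sub>2 m by simp
  have xi: "coord x' i = coord x i - \<alpha> *\<^sub>R ((\<beta> * eigval i) *\<^sub>R (coord x i + coord e i) + \<gamma> *\<^sub>R coord w i + coord h i)" for i
    unfolding x'[abs_def] coord_diff coord_scaleR coord_add coord_L by simp
  have wi: "coord w' i = coord w i + (\<alpha> * \<gamma> * eigval i) *\<^sub>R (coord x i + coord e i) + (1 / \<gamma>) *\<^sub>R coord D i" for i
    unfolding w'[abs_def] coord_diff coord_scaleR coord_add coord_L by simp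
  have off: "(norm (coord x' i))\<^sup>2 / 2 + b / 2 * ((norm (coord w' i))\<^sup>2 / lam i) + (coord x' i \<bullet> coord w' i) / lam i
    \<le> (norm (coord x i))\<^sup>2 / 2 + b / 2 * ((norm (coord w i))\<^sup>2 / lam i) + (coord x i \<bullet> coord w i) / lam i
      + cx * (norm (coord x i))\<^sup>2 + cw * ((norm (coord w i))\<^sup>2 / lam i) + ce * (norm (coord e i))\<^sup>2
      + ch * (norm (coord h i))\<^sup>2 + cd * (norm (coord D i))\<^sup>2" if "i \<in> -{i1}" for i
  proof (rule coordinate_descent_vec[OF \<rho>\<^sub>2 _ _ pos \<beta>\<gamma> _ _ b cx cw ce ch cd])
    have "eigval i = lam i" using that by (simp add: eigval_def)
    then show "coord x' i = coord x i - \<alpha> *\<^sub>R ((\<beta> * lam i) *\<^sub>R (coord x i + coord e i) + \<gamma> *\<^sub>R coord w i + coord h i)"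
      "coord w' i = coord w i + (\<alpha> * \<gamma> * lam i) *\<^sub>R (coord x i + coord e i) + (1 / \<gamma>) *\<^sub>R coord D i"
      using xi wi by simp_all
  qed (use that lam in auto)
  have "(\<Sum>i\<in>-{i1}. (norm (coord x' i))\<^sup>2 / 2 + b / 2 * ((norm (coord w' i))\<^sup>2 / lam i) + (coord x' i \<bullet> coord w' i) / lam i)
    \<le> (\<Sum>i\<in>-{i1}. (norm (coord x i))\<^sup>2 / 2 + b / 2 * ((norm (coord w i))\<^sup>2 / lam i) + (coord x i \<bullet> coord w i) / lam i
      + cx * (norm (coord x i))\<^sup>2 + cw * ((norm (coord w i))\<^sup>2 / lam i) + ce * (norm (coord e i))\<^sup>2
      + ch * (norm (coord h i))\<^sup>2 + cd * (norm (coord D i))\<^sup>2)"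
    by (rule sum_mono) (rule off)
  then have off_sum: "sq_E x' / 2 + b / 2 * sq_EF w' + cross_EF x' w'
    \<le> sq_E x / 2 + b / 2 * sq_EF w + cross_EF x w + cx * sq_E x + cw * sq_EF w + ce * sq_E e + ch * sq_E h + cd * sq_E D"
    unfolding sq_E_def sq_EF_def cross_EF_def sum.distrib
    by (simp only: sum_distrib_left[symmetric] sum_divide_distrib[symmetric])
  have mean: "b / 2 * ((norm (coord w' i1))\<^sup>2 / m)
    \<le> b / 2 * ((norm (coord w i1))\<^sup>2 / m) + \<alpha> * \<gamma> / 4 * ((norm (coord w i1))\<^sup>2 / m) + cd * (norm (coord D i1))\<^sup>2"
  proof -
    define W DD where "W = coord w i1" and "DD = coord D i1"
    have b0: "0 < b" using b pos by simp
    have w1: "coord w' i1 = W + (1 / \<gamma>) *\<^sub>R DD" using wi[of i1] by (simp add: eigval_def W_def DD_def)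
    have "(norm (coord w' i1))\<^sup>2 = (norm W)\<^sup>2 + 2 / \<gamma> * (W \<bullet> DD) + (norm DD)\<^sup>2 / \<gamma>\<^sup>2"
      unfolding w1 power2_norm_eq_inner
      by (simp add: inner_add_left inner_add_right inner_commute power2_eq_square)
    then have "b / 2 * ((norm (coord w' i1))\<^sup>2 / m)
      = b / 2 * ((norm W)\<^sup>2 / m) + (b / \<gamma> * (W \<bullet> DD) + b / (2 * \<gamma>\<^sup>2) * (norm DD)\<^sup>2) / m"
      by (simp add: add_divide_distrib distrib_left)
    also have "b / \<gamma> * (W \<bullet> DD) + b / (2 * \<gamma>\<^sup>2) * (norm DD)\<^sup>2
      \<le> \<alpha> * \<gamma> / 4 * (norm W)\<^sup>2 + (b\<^sup>2 / (\<alpha> * \<gamma> ^ 3) + b / (2 * \<gamma>\<^sup>2)) * (norm DD)\<^sup>2"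
    proof -
      have "W \<bullet> DD \<le> norm W * norm DD" by (rule norm_cauchy_schwarz)
      then have "b / \<gamma> * (W \<bullet> DD) \<le> b / \<gamma> * (norm W * norm DD)"
        using b0 pos by (intro mult_left_mono) auto
      also have "\<dots> = norm W * (b / \<gamma> * norm DD)" by simp
      also have "\<dots> \<le> \<alpha> * \<gamma> / 2 / 2 * (norm W)\<^sup>2 + (b / \<gamma> * norm DD)\<^sup>2 / (2 * (\<alpha> * \<gamma> / 2))"
        using pos by (intro young_mult) auto
      also have "(b / \<gamma> * norm DD)\<^sup>2 / (2 * (\<alpha> * \<gamma> / 2)) = b\<^sup>2 / (\<alpha> * \<gamma> ^ 3) * (norm DD)\<^sup>2"
        by (simp add: power_mult_distrib power_divide eval_nat_numeral mult_ac)
      finally show ?thesis by (simp add: distrib_right)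
    qed
    also have "(\<alpha> * \<gamma> / 4 * (norm W)\<^sup>2 + (b\<^sup>2 / (\<alpha> * \<gamma> ^ 3) + b / (2 * \<gamma>\<^sup>2)) * (norm DD)\<^sup>2) / m
      = \<alpha> * \<gamma> / 4 * ((norm W)\<^sup>2 / m) + (b\<^sup>2 / (\<alpha> * \<gamma> ^ 3) + b / (2 * \<gamma>\<^sup>2)) / m * (norm DD)\<^sup>2"
      by (simp add: add_divide_distrib distrib_right)
    also have "(b\<^sup>2 / (\<alpha> * \<gamma> ^ 3) + b / (2 * \<gamma>\<^sup>2)) / m * (norm DD)\<^sup>2 \<le> cd * (norm DD)\<^sup>2"
    proof (rule mult_right_mono)
      \<comment> \<open>With m >= \<rho>_2, the first and third summands of \<open>cd\<close>
        already cover the consensus direction.\<close>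
      have "(b\<^sup>2 / (\<alpha> * \<gamma> ^ 3) + b / (2 * \<gamma>\<^sup>2)) / m \<le> (b\<^sup>2 / (\<alpha> * \<gamma> ^ 3) + b / (2 * \<gamma>\<^sup>2)) / \<rho>\<^sub>2"
        using b0 pos m \<rho>\<^sub>2 by (intro divide_left_mono) auto
      also have "\<dots> = (\<beta> + \<gamma>)\<^sup>2 / (\<alpha> * \<gamma> ^ 5 * \<rho>\<^sub>2) + (\<beta> + \<gamma>) / (2 * \<gamma> ^ 3 * \<rho>\<^sub>2)"
        by (simp add: b add_divide_distrib[of _ _ \<rho>\<^sub>2] power_divide eval_nat_numeral mult_ac)
      also have "\<dots> \<le> cd"
      proof -
        have "0 \<le> 1 / (2 * \<alpha> * \<gamma>\<^sup>2 * \<rho>\<^sub>2\<^sup>2)" "0 \<le> 1 / (2 * \<gamma>\<^sup>2 * \<rho>\<^sub>2\<^sup>2)" "0 \<le> 1 / (2 * \<rho>\<^sub>2\<^sup>2)"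
          using pos by auto
        then show ?thesis unfolding cd by linarith
      qed
      finally show "(b\<^sup>2 / (\<alpha> * \<gamma> ^ 3) + b / (2 * \<gamma>\<^sup>2)) / m \<le> cd" .
    qed simp
    finally show ?thesis using m0 by (simp add: W_def DD_def divide_right_mono)
  qed
  have "cd * (\<Sum>i\<in>UNIV. (norm (D i))\<^sup>2) = cd * (norm (coord D i1))\<^sup>2 + cd * sq_E D"
    unfolding sum_norm_coord_split[symmetric] by (simp add: distrib_left sq_E_def)
  then show ?thesis
    using off_sum mean unfolding consensus_energy_def distrib_left[of "b / 2"] by linarith
qed

end

text \<open>Arithmetic on the quantities of one step. X, E and W\<alpha>-free parts of w are squared
  seminorms: X of x, E of the compression error, and \<open>W\<^sub>0\<close>,
  \<open>W\<^sub>1\<close> of w along and off the consensus direction. H and Z are the parts of g -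
  g^0 off and along it, Dn is the squared change of g^0, and G, \<open>G\<^sub>0\<close> are the
  squared consensus components of g and g^0.\<close>

lemma descent_combination:
  fixes V V' X W\<^sub>0 W\<^sub>1 E H Z Dn G G\<^sub>0 F F' m l \<rho>\<^sub>2 \<rho> \<alpha> \<beta> \<gamma> :: real
  assumes \<rho>\<^sub>2: "0 < \<rho>\<^sub>2" "\<rho>\<^sub>2 \<le> m" and pos: "0 < \<alpha>" "0 < \<beta>" "0 < \<gamma>" "0 < \<rho>" and \<gamma>: "5 / \<rho>\<^sub>2 < \<gamma>"
    and cx: "cx = - \<alpha> * (\<rho>\<^sub>2 * \<beta> / 2 - 3 * \<gamma> / 2 - 1)
         + \<alpha>\<^sup>2 * (3 * \<rho>\<^sup>2 * \<beta>\<^sup>2 - \<rho>\<^sub>2 * \<beta> * \<gamma> + (\<rho> + 2) * \<gamma>\<^sup>2 + 1)"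
    and cw: "cw = - \<alpha> * (\<gamma> / 2 - 1 / (2 * \<rho>\<^sub>2)) + \<alpha>\<^sup>2 * (2 * \<rho> * \<gamma>\<^sup>2 + \<rho> / 2)"
    and ce: "ce = \<alpha> * ((\<rho> + 1) * \<gamma> + \<rho> * \<beta> / 2)
         + \<alpha>\<^sup>2 * (3 * \<rho>\<^sup>2 * \<beta>\<^sup>2 + (\<rho> - 2 * \<rho>\<^sub>2) * \<beta> * \<gamma> + (\<rho> + 2) * \<gamma>\<^sup>2 + 1)"
    and ch: "ch = \<alpha> + 5 / 2 * \<alpha>\<^sup>2"
    and cd: "cd = (\<beta> + \<gamma>)\<^sup>2 / (\<alpha> * \<gamma> ^ 5 * \<rho>\<^sub>2) + 1 / (2 * \<alpha> * \<gamma>\<^sup>2 * \<rho>\<^sub>2\<^sup>2) + (\<beta> + \<gamma>) / (2 * \<gamma> ^ 3 * \<rho>\<^sub>2)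
         + 1 / (2 * \<gamma>\<^sup>2 * \<rho>\<^sub>2\<^sup>2) + 1 / (2 * \<rho>\<^sub>2\<^sup>2) + 1 / 2"
    and \<phi>\<^sub>1_def: "\<phi>\<^sub>1 = (1 / 2) * (\<rho>\<^sub>2 * \<beta> - (3 * \<gamma> + 2 + 2 * l\<^sup>2))"
    and \<phi>\<^sub>2_def: "\<phi>\<^sub>2 = 3 * \<rho>\<^sup>2 * \<beta>\<^sup>2 - \<rho>\<^sub>2 * \<beta> * \<gamma> + (\<rho> + 2) * \<gamma>\<^sup>2 + 1 + (5 / 2) * l\<^sup>2"
    and \<phi>\<^sub>3_def: "\<phi>\<^sub>3 = \<gamma> / 2 - (5 / 2) * (1 / \<rho>\<^sub>2)"
    and \<phi>\<^sub>4_def: "\<phi>\<^sub>4 = 2 * \<rho> * \<gamma>\<^sup>2 + (1 / 2) * \<rho>"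
    and \<phi>\<^sub>5_def: "\<phi>\<^sub>5 = 1 / 8 - (\<beta> + \<gamma>)\<^sup>2 / \<gamma> ^ 5 * (1 / \<rho>\<^sub>2) * l\<^sup>2
                        - 1 / (2 * \<gamma>\<^sup>2) * (1 / \<rho>\<^sub>2\<^sup>2) * l\<^sup>2"
    and \<phi>\<^sub>6_def: "\<phi>\<^sub>6 = (\<beta> + \<gamma>) / (2 * \<gamma> ^ 3) * (1 / \<rho>\<^sub>2) * l\<^sup>2
                        + 1 / (2 * \<gamma>\<^sup>2) * (1 / \<rho>\<^sub>2\<^sup>2) * l\<^sup>2
                        + (1 / 2) * (1 / \<rho>\<^sub>2\<^sup>2) * l\<^sup>2 + l\<^sup>2 / 2 + l / 2"
    and \<phi>\<^sub>7_def: "\<phi>\<^sub>7 = (\<rho> + 1) * \<gamma> + (1 / 2) * \<rho> * \<beta>"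
    and \<phi>\<^sub>8_def: "\<phi>\<^sub>8 = 3 * \<rho>\<^sup>2 * \<beta>\<^sup>2 + (\<rho> - 2 * \<rho>\<^sub>2) * \<beta> * \<gamma> + (\<rho> + 2) * \<gamma>\<^sup>2 + 1"
    and V': "V' \<le> V + cx * X + cw * W\<^sub>1 + ce * E + ch * H + cd * Dn + \<alpha> * \<gamma> / 4 * W\<^sub>0"
    and W\<^sub>0: "W\<^sub>0 = G\<^sub>0 / \<gamma>\<^sup>2 / m"
    and HZ: "H + Z \<le> l\<^sup>2 * X" and Dn: "Dn \<le> l\<^sup>2 * \<alpha>\<^sup>2 * G"
    and F': "F' \<le> F - \<alpha> / 2 * (G + G\<^sub>0 - Z) + \<alpha>\<^sup>2 * l / 2 * G"
    and nonneg: "0 \<le> W\<^sub>1" "0 \<le> G" "0 \<le> G\<^sub>0" "0 \<le> Z"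
  shows "V' + F' \<le> V + F - \<alpha> * (\<phi>\<^sub>1 - \<alpha> * \<phi>\<^sub>2) * X - \<alpha> * (\<phi>\<^sub>3 - \<alpha> * \<phi>\<^sub>4) * (W\<^sub>0 + W\<^sub>1)
    - \<alpha> * (\<phi>\<^sub>5 - \<alpha> * \<phi>\<^sub>6) * G - \<alpha> / 4 * G\<^sub>0 + \<alpha> * (\<phi>\<^sub>7 + \<alpha> * \<phi>\<^sub>8) * E"
proof -
  have m: "0 < m" using \<rho>\<^sub>2 by simp
  \<comment> \<open>The descent lemma charges Z with \<alpha>/2, which is at most the factor
    \<open>ch\<close> of H; raised to \<open>ch\<close>, both parts are bounded jointly by l^2
    X.\<close>
  have X_bound: "cx * X + ch * H + \<alpha> / 2 * Z \<le> - \<alpha> * (\<phi>\<^sub>1 - \<alpha> * \<phi>\<^sub>2) * X"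
  proof -
    have "ch * H + \<alpha> / 2 * Z \<le> ch * H + ch * Z"
      using pos nonneg by (intro add_left_mono mult_right_mono) (auto simp: ch)
    also have "\<dots> \<le> ch * (l\<^sup>2 * X)"
      unfolding distrib_left[symmetric] using HZ pos by (intro mult_left_mono) (auto simp: ch)
    finally have 1: "ch * H + \<alpha> / 2 * Z \<le> ch * (l\<^sup>2 * X)" .
    have "cx * X + ch * (l\<^sup>2 * X) = - \<alpha> * (\<phi>\<^sub>1 - \<alpha> * \<phi>\<^sub>2) * X"
      unfolding cx ch \<phi>\<^sub>1_def \<phi>\<^sub>2_def by (simp add: field_simps power2_eq_square)
    with 1 show ?thesis by linarith
  qed
  have W_bound: "cw * W\<^sub>1 + \<alpha> * \<gamma> / 4 * W\<^sub>0 - \<alpha> / 4 * G\<^sub>0 \<le> - \<alpha> * (\<phi>\<^sub>3 - \<alpha> * \<phi>\<^sub>4) * (W\<^sub>0 + W\<^sub>1)"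
  proof -
    have W0: "0 \<le> W\<^sub>0" using nonneg m by (simp add: W\<^sub>0)
    have \<phi>4: "0 \<le> \<phi>\<^sub>4" using pos by (simp add: \<phi>\<^sub>4_def)
    have "cw = - \<alpha> * (\<phi>\<^sub>3 - \<alpha> * \<phi>\<^sub>4) - 2 * \<alpha> / \<rho>\<^sub>2"
      using \<rho>\<^sub>2 unfolding cw \<phi>\<^sub>3_def \<phi>\<^sub>4_def by (simp add: field_simps power2_eq_square)
    then have "cw * W\<^sub>1 = - \<alpha> * (\<phi>\<^sub>3 - \<alpha> * \<phi>\<^sub>4) * W\<^sub>1 - 2 * \<alpha> / \<rho>\<^sub>2 * W\<^sub>1"
      by (simp add: left_diff_distrib)
    moreover have "0 \<le> 2 * \<alpha> / \<rho>\<^sub>2 * W\<^sub>1" using pos \<rho>\<^sub>2 nonneg by simp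
    moreover have "\<alpha> * \<gamma> / 4 * W\<^sub>0 - \<alpha> / 4 * G\<^sub>0 \<le> - \<alpha> * (\<phi>\<^sub>3 - \<alpha> * \<phi>\<^sub>4) * W\<^sub>0"
    proof -
      \<comment> \<open>\<open>G\<^sub>0\<close> equals \<gamma>^2 m \<open>W\<^sub>0\<close>, so
        \<gamma>m >= 3 yields 3\<alpha>\<gamma>/4 times \<open>W\<^sub>0\<close>: a quarter for the
        term left by the energy and two quarters for the \<gamma>/2 in
        \<open>\<phi>\<^sub>3\<close>.\<close>
      have "5 < \<gamma> * \<rho>\<^sub>2" using \<gamma> \<rho>\<^sub>2 by (simp add: field_simps)
      also have "\<gamma> * \<rho>\<^sub>2 \<le> \<gamma> * m" using pos \<rho>\<^sub>2 by simp
      finally have "3 \<le> \<gamma> * m" by simp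
      then have "3 * \<gamma> \<le> \<gamma> * m * \<gamma>" using pos by (intro mult_right_mono) auto
      then have "3 * \<gamma> * W\<^sub>0 \<le> \<gamma> * m * \<gamma> * W\<^sub>0" using W0 by (rule mult_right_mono)
      also have "\<gamma> * m * \<gamma> * W\<^sub>0 = G\<^sub>0" using pos m by (simp add: W\<^sub>0 power2_eq_square)
      finally have "\<alpha> / 4 * (3 * \<gamma> * W\<^sub>0) \<le> \<alpha> / 4 * G\<^sub>0" using pos by (intro mult_left_mono) auto
      moreover have "- \<alpha> * (\<phi>\<^sub>3 - \<alpha> * \<phi>\<^sub>4) * W\<^sub>0 = - \<alpha> / 2 * \<gamma> * W\<^sub>0 + 5 / 2 * (\<alpha> / \<rho>\<^sub>2 * W\<^sub>0) + \<alpha>\<^sup>2 * \<phi>\<^sub>4 * W\<^sub>0"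
        unfolding \<phi>\<^sub>3_def by (simp add: field_simps power2_eq_square)
      moreover have "0 \<le> \<alpha> / \<rho>\<^sub>2 * W\<^sub>0" "0 \<le> \<alpha>\<^sup>2 * \<phi>\<^sub>4 * W\<^sub>0" using pos \<rho>\<^sub>2 W0 \<phi>4 by auto
      ultimately show ?thesis by (simp add: field_simps)
    qed
    ultimately show ?thesis by (simp add: distrib_left)
  qed
  have G_bound: "cd * Dn - \<alpha> / 2 * G + \<alpha>\<^sup>2 * l / 2 * G \<le> - \<alpha> * (\<phi>\<^sub>5 - \<alpha> * \<phi>\<^sub>6) * G"
  proof -
    have "0 \<le> cd" using pos \<rho>\<^sub>2 by (auto simp: cd intro!: add_nonneg_nonneg)
    then have "cd * Dn \<le> cd * (l\<^sup>2 * \<alpha>\<^sup>2 * G)" using Dn by (intro mult_left_mono)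
    \<comment> \<open>\<open>\<phi>\<^sub>5\<close> starts from 1/8, so the identity is for
      \<alpha>/8; passing from the gained \<alpha>/2 is a weakening since G >= 0. The summands of
      \<open>cd\<close> with 1/\<alpha> form the rest of \<open>\<phi>\<^sub>5\<close>, the others
      go to \<open>\<phi>\<^sub>6\<close>.\<close>
    moreover have "cd * (l\<^sup>2 * \<alpha>\<^sup>2 * G) - \<alpha> / 8 * G + \<alpha>\<^sup>2 * l / 2 * G = - \<alpha> * (\<phi>\<^sub>5 - \<alpha> * \<phi>\<^sub>6) * G"
    proof -
      have "cd * \<alpha>\<^sup>2 = \<alpha> * ((\<beta> + \<gamma>)\<^sup>2 / \<gamma> ^ 5 * (1 / \<rho>\<^sub>2)) + \<alpha> * (1 / (2 * \<gamma>\<^sup>2) * (1 / \<rho>\<^sub>2\<^sup>2))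
        + \<alpha>\<^sup>2 * ((\<beta> + \<gamma>) / (2 * \<gamma> ^ 3) * (1 / \<rho>\<^sub>2)) + \<alpha>\<^sup>2 * (1 / (2 * \<gamma>\<^sup>2) * (1 / \<rho>\<^sub>2\<^sup>2))
        + \<alpha>\<^sup>2 * (1 / 2 * (1 / \<rho>\<^sub>2\<^sup>2)) + \<alpha>\<^sup>2 / 2"
      proof -
        have "a / (\<alpha> * \<gamma> ^ 5 * \<rho>\<^sub>2) * \<alpha>\<^sup>2 = \<alpha> * (a / \<gamma> ^ 5 * (1 / \<rho>\<^sub>2))"
          "1 / (2 * \<alpha> * \<gamma>\<^sup>2 * \<rho>\<^sub>2\<^sup>2) * \<alpha>\<^sup>2 = \<alpha> * (1 / (2 * \<gamma>\<^sup>2) * (1 / \<rho>\<^sub>2\<^sup>2))" for a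
          using pos by (simp_all add: power2_eq_square[of \<alpha>])
        then show ?thesis unfolding cd distrib_right by simp
      qed
      then have eq: "cd * (l\<^sup>2 * \<alpha>\<^sup>2 * G) = (\<alpha> * ((\<beta> + \<gamma>)\<^sup>2 / \<gamma> ^ 5 * (1 / \<rho>\<^sub>2)) + \<alpha> * (1 / (2 * \<gamma>\<^sup>2) * (1 / \<rho>\<^sub>2\<^sup>2))
        + \<alpha>\<^sup>2 * ((\<beta> + \<gamma>) / (2 * \<gamma> ^ 3) * (1 / \<rho>\<^sub>2)) + \<alpha>\<^sup>2 * (1 / (2 * \<gamma>\<^sup>2) * (1 / \<rho>\<^sub>2\<^sup>2))
        + \<alpha>\<^sup>2 * (1 / 2 * (1 / \<rho>\<^sub>2\<^sup>2)) + \<alpha>\<^sup>2 / 2) * (l\<^sup>2 * G)"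
        by (metis (no_types, lifting) mult.assoc mult.commute)
      have collect: "(\<alpha> * a + \<alpha> * b + \<alpha>\<^sup>2 * c + \<alpha>\<^sup>2 * b + \<alpha>\<^sup>2 * d + \<alpha>\<^sup>2 / 2) * (l\<^sup>2 * G) - \<alpha> / 8 * G + \<alpha>\<^sup>2 * l / 2 * G
        = - \<alpha> * (1 / 8 - a * l\<^sup>2 - b * l\<^sup>2 - \<alpha> * (c * l\<^sup>2 + b * l\<^sup>2 + d * l\<^sup>2 + l\<^sup>2 / 2 + l / 2)) * G" for a b c d
        by (simp add: algebra_simps power2_eq_square)
      show ?thesis unfolding \<phi>\<^sub>5_def \<phi>\<^sub>6_def eq by (rule collect)
    qed
    moreover have "0 \<le> \<alpha> * G" using pos nonneg by simp
    ultimately show ?thesis by simp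
  qed
  have "ce = \<alpha> * (\<phi>\<^sub>7 + \<alpha> * \<phi>\<^sub>8)"
    unfolding ce \<phi>\<^sub>7_def \<phi>\<^sub>8_def by (simp add: distrib_left power2_eq_square mult.assoc)
  then have E_eq: "ce * E = \<alpha> * (\<phi>\<^sub>7 + \<alpha> * \<phi>\<^sub>8) * E" by simp
  have "F' \<le> F - \<alpha> / 2 * G - \<alpha> / 2 * G\<^sub>0 + \<alpha> / 2 * Z + \<alpha>\<^sup>2 * l / 2 * G"
    using F' by (simp add: algebra_simps add_divide_distrib diff_divide_distrib)
  with V' X_bound W_bound G_bound E_eq show ?thesis by linarith
qed

subsection \<open>The algorithm\<close>

text \<open>Fixes a run with smooth costs only; the compressor bound, the Polyak-Lojasiewicz
  condition and the parameter ranges enter where they are used.\<close>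

locale compressed_run = eigenbasis P i1 lam L
  for P :: "real^'n^'n" and i1 :: "'n::finite" and lam :: "'n \<Rightarrow> real" and L :: "real^'n^'n" +
  fixes f :: "'n \<Rightarrow> real^'d::finite \<Rightarrow> real" and Q :: "real^'d \<Rightarrow> real^'d" and l \<alpha> \<beta> \<gamma> \<omega> :: real
    and s :: "nat \<Rightarrow> real" and x v q :: "'n \<Rightarrow> nat \<Rightarrow> real^'d" and xh y :: "'n \<Rightarrow> int \<Rightarrow> real^'d"
  assumes differentiable: "\<And>i z. f i differentiable (at z)"
    and smooth: "\<And>i z w. norm (gradient (f i) z - gradient (f i) w) \<le> l * norm (z - w)"
    and algorithm: "unified_compression_algorithm L f Q \<alpha> \<beta> \<gamma> \<omega> s x v q xh y"
begin

definition avg :: "('n \<Rightarrow> 'a::real_vector) \<Rightarrow> 'a" where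
  "avg z = (1 / real CARD('n)) *\<^sub>R (\<Sum>i\<in>UNIV. z i)"

definition xbar :: "nat \<Rightarrow> real^'d" where "xbar k = avg (\<lambda>i. x i k)"

definition favg :: "real^'d \<Rightarrow> real" where "favg z = (1 / real CARD('n)) * (\<Sum>i\<in>UNIV. f i z)"

definition g0 :: "nat \<Rightarrow> 'n \<Rightarrow> real^'d" where "g0 k j = gradient (f j) (xbar k)"

definition gk :: "nat \<Rightarrow> 'n \<Rightarrow> real^'d" where "gk k j = gradient (f j) (x j k)"

text \<open>The deviation of $v_k$ from its equilibrium value $-g_k^0/\gamma$.\<close>

definition w :: "nat \<Rightarrow> 'n \<Rightarrow> real^'d" where "w k j = v j k + (1 / \<gamma>) *\<^sub>R g0 k j"

definition err :: "nat \<Rightarrow> 'n \<Rightarrow> real^'d" where "err k j = xh j (int k) - x j k"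

lemma params_pos: "0 < \<alpha>" "0 < \<beta>" "0 < \<gamma>" "0 < \<omega>" "0 < s k"
  and initial: "v i 0 = 0" "xh i (-1) = 0" "y i (-1) = 0"
  and q_eq: "q i k = Q ((x i k - xh i (int k - 1)) /\<^sub>R s k)"
  and xh_eq: "xh i (int k) = xh i (int k - 1) + (\<omega> * s k) *\<^sub>R q i k"
  and y_rec: "y i (int k) = y i (int k - 1) + (\<omega> * s k) *\<^sub>R (\<Sum>j\<in>UNIV. L $ i $ j *\<^sub>R q j k)"
  and x_rec: "x i (Suc k) = x i k - \<alpha> *\<^sub>R (\<beta> *\<^sub>R y i (int k) + \<gamma> *\<^sub>R v i k + gradient (f i) (x i k))"
  and v_rec: "v i (Suc k) = v i k + (\<alpha> * \<gamma>) *\<^sub>R y i (int k)"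
  using algorithm unfolding unified_compression_algorithm_def by blast+

lemma coord_i1: "coord z i1 = sqrt (real CARD('n)) *\<^sub>R avg z"
  unfolding avg_def by (rule coord_mean)

text \<open>Both sides receive the same increments and vanish at time -1, so y is the Laplacian of
  the compressed states.\<close>

lemma y_eq: "y i (int k) = block_mult L (\<lambda>j. xh j (int k)) i"
proof -
  have step: "y i (int k) = block_mult L (\<lambda>j. xh j (int k)) i"
    if "\<And>i. y i (int k - 1) = block_mult L (\<lambda>j. xh j (int k - 1)) i" for i k
  proof -
    have "block_mult L (\<lambda>j. xh j (int k)) i
        = block_mult L (\<lambda>j. xh j (int k - 1)) i + (\<omega> * s k) *\<^sub>R block_mult L (\<lambda>j. q j k) i"
      unfolding xh_eq[of _ k] block_mult_add block_mult_scaleR ..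
    then show ?thesis unfolding y_rec[of i k] that by (simp add: block_mult_def)
  qed
  \<comment> \<open>The induction concerns time k - 1, so that its base case is the initial time
    -1.\<close>
  have "\<forall>i. y i (int k - 1) = block_mult L (\<lambda>j. xh j (int k - 1)) i" for k
  proof (induction k)
    case 0
    show ?case by (simp add: initial block_mult_def)
  next
    case (Suc k)
    then show ?case using step[of k] by simp
  qed
  then show ?thesis using step by blast
qed

lemma xh_err: "xh j (int k) = x j k + err k j"
  by (simp add: err_def)

text \<open>Adding and subtracting g^0 turns \<gamma>v + g into \<gamma>w + (g - g^0), where the
  difference is controlled by the consensus error.\<close>

lemma x_step: "x j (Suc k) = x j k
    - \<alpha> *\<^sub>R (\<beta> *\<^sub>R block_mult L (\<lambda>j. x j k + err k j) j + \<gamma> *\<^sub>R w k j + (gk k j - g0 k j))"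
  using params_pos by (simp add: x_rec y_eq w_def gk_def xh_err scaleR_right_distrib)

lemma w_step: "w (Suc k) j = w k j + (\<alpha> * \<gamma>) *\<^sub>R block_mult L (\<lambda>j. x j k + err k j) j
    + (1 / \<gamma>) *\<^sub>R (g0 (Suc k) j - g0 k j)"
  by (simp add: w_def v_rec y_eq xh_err algebra_simps)

text \<open>v starts at 0 and is moved only within the range of L, which is orthogonal to the
  consensus direction.\<close>

lemma coord_v_i1: "coord (\<lambda>j. v j k) i1 = 0"
proof (induction k)
  case 0
  show ?case by (simp add: initial coord_def block_mult_def)
next
  case (Suc k)
  then show ?case
    unfolding v_rec y_eq coord_add coord_scaleR coord_L by (simp add: eigval_def)
qed

lemma coord_w_i1: "coord (w k) i1 = (1 / \<gamma>) *\<^sub>R coord (g0 k) i1"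
  unfolding w_def[abs_def] coord_add coord_scaleR coord_v_i1 by simp

text \<open>All terms with L have zero consensus component, so the compression error does not enter
  directly, and \<gamma>w cancels the g^0 subtracted in \<open>x_step\<close>.\<close>

lemma xbar_step: "xbar (Suc k) = xbar k - \<alpha> *\<^sub>R avg (gk k)"
proof -
  have n: "sqrt (real CARD('n)) \<noteq> 0" by simp
  have "coord (\<lambda>j. x j (Suc k)) i1 = coord (\<lambda>j. x j k) i1 - \<alpha> *\<^sub>R coord (gk k) i1"
    unfolding x_step coord_diff coord_scaleR coord_add coord_L
    using params_pos by (simp add: eigval_def coord_w_i1)
  then have "sqrt (real CARD('n)) *\<^sub>R xbar (Suc k) = sqrt (real CARD('n)) *\<^sub>R (xbar k - \<alpha> *\<^sub>R avg (gk k))"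
    unfolding coord_i1 xbar_def by (simp add: scaleR_right_diff_distrib)
  then show ?thesis using n by (simp only: scaleR_cancel_left) simp
qed

lemma gradient_favg: "gradient favg z = avg (\<lambda>i. gradient (f i) z)"
  and GDERIV_favg: "GDERIV favg z :> gradient favg z"
proof -
  have *: "GDERIV favg z :> avg (\<lambda>i. gradient (f i) z)"
    unfolding favg_def[abs_def] avg_def
    by (intro GDERIV_cmult GDERIV_sum GDERIV_gradient differentiable)
  show eq: "gradient favg z = avg (\<lambda>i. gradient (f i) z)" by (rule gradient_eq[OF *])
  show "GDERIV favg z :> gradient favg z" unfolding eq by (rule *)
qed

lemma favg_smooth: "norm (gradient favg z - gradient favg u) \<le> l * norm (z - u)"
proof -
  have "gradient favg z - gradient favg u = avg (\<lambda>i. gradient (f i) z - gradient (f i) u)"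
    by (simp add: gradient_favg avg_def sum_subtractf scaleR_right_diff_distrib)
  also have "norm \<dots> \<le> (1 / real CARD('n)) * (\<Sum>i\<in>(UNIV::'n set). l * norm (z - u))"
    unfolding avg_def norm_scaleR
    by (intro mult_mono order_trans[OF norm_sum] sum_mono smooth) (auto simp: sum_nonneg)
  finally show ?thesis by simp
qed

lemma norm_coord_g0: "(norm (coord (g0 k) i1))\<^sup>2 = real CARD('n) * (norm (gradient favg (xbar k)))\<^sup>2"
  unfolding coord_i1 by (simp add: gradient_favg g0_def[abs_def] power_mult_distrib)

lemma norm_coord_gk: "(norm (coord (gk k) i1))\<^sup>2 = real CARD('n) * (norm (avg (gk k)))\<^sup>2"
  unfolding coord_i1 by (simp add: power_mult_distrib)

lemma sum_norm_g0_diff: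
  "(\<Sum>j\<in>UNIV. (norm (g0 (Suc k) j - g0 k j))\<^sup>2) \<le> l\<^sup>2 * \<alpha>\<^sup>2 * (norm (coord (gk k) i1))\<^sup>2"
proof -
  have "(\<Sum>j\<in>UNIV. (norm (g0 (Suc k) j - g0 k j))\<^sup>2) \<le> (\<Sum>j\<in>(UNIV::'n set). (l * norm (xbar (Suc k) - xbar k))\<^sup>2)"
    unfolding g0_def by (intro sum_mono power_mono smooth) auto
  also have "\<dots> = l\<^sup>2 * \<alpha>\<^sup>2 * (norm (coord (gk k) i1))\<^sup>2"
    by (simp add: xbar_step norm_coord_gk power_mult_distrib)
  finally show ?thesis .
qed

lemma sq_E_x: "sq_E (\<lambda>j. x j k) = (\<Sum>j\<in>UNIV. (norm (x j k - xbar k))\<^sup>2)"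
  unfolding sq_E_def by (rule sum_norm_deviation[symmetric]) (simp add: xbar_def avg_def)

lemma sum_norm_gk_diff:
  "(norm (coord (\<lambda>j. gk k j - g0 k j) i1))\<^sup>2 + sq_E (\<lambda>j. gk k j - g0 k j) \<le> l\<^sup>2 * sq_E (\<lambda>j. x j k)"
proof -
  have "(\<Sum>j\<in>UNIV. (norm (gk k j - g0 k j))\<^sup>2) \<le> (\<Sum>j\<in>UNIV. (l * norm (x j k - xbar k))\<^sup>2)"
    unfolding g0_def gk_def by (intro sum_mono power_mono smooth) auto
  then show ?thesis
    unfolding sq_E_x sum_norm_coord_split sq_E_def
    by (simp add: power_mult_distrib sum_distrib_left)
qed

text \<open>The descent lemma for the step of the average, with the inner product of the two
  averaged gradients polarized; the factor n turns their norms into consensus components.\<close>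

lemma favg_step:
  "real CARD('n) * favg (xbar (Suc k)) \<le> real CARD('n) * favg (xbar k)
    - \<alpha> / 2 * ((norm (coord (gk k) i1))\<^sup>2 + (norm (coord (g0 k) i1))\<^sup>2
        - (norm (coord (\<lambda>j. gk k j - g0 k j) i1))\<^sup>2)
    + \<alpha>\<^sup>2 * l / 2 * (norm (coord (gk k) i1))\<^sup>2"
proof -
  define a b where "a = avg (gk k)" and "b = gradient favg (xbar k)"
  have "favg (xbar (Suc k)) \<le> favg (xbar k) + b \<bullet> (xbar (Suc k) - xbar k)
      + l / 2 * (norm (xbar (Suc k) - xbar k))\<^sup>2"
    unfolding b_def by (rule lipschitz_gradient_upper_bound[OF GDERIV_favg favg_smooth])
  also have "xbar (Suc k) - xbar k = - \<alpha> *\<^sub>R a" by (simp add: xbar_step a_def)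
  also have "b \<bullet> (- \<alpha> *\<^sub>R a) = - \<alpha> / 2 * ((norm a)\<^sup>2 + (norm b)\<^sup>2 - (norm (a - b))\<^sup>2)"
    by (simp add: power2_norm_eq_inner inner_diff_left inner_diff_right inner_commute)
  finally have "real CARD('n) * favg (xbar (Suc k)) \<le> real CARD('n) * (favg (xbar k)
      + - \<alpha> / 2 * ((norm a)\<^sup>2 + (norm b)\<^sup>2 - (norm (a - b))\<^sup>2) + l / 2 * (norm (- \<alpha> *\<^sub>R a))\<^sup>2)"
    by (intro mult_left_mono) auto
  moreover have "(norm (coord (\<lambda>j. gk k j - g0 k j) i1))\<^sup>2 = real CARD('n) * (norm (a - b))\<^sup>2"
    unfolding coord_diff coord_i1 scaleR_right_diff_distrib[symmetric]
    by (simp add: gradient_favg g0_def[abs_def] power_mult_distrib a_def b_def)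
  ultimately show ?thesis
    unfolding norm_coord_g0 norm_coord_gk a_def[symmetric] b_def[symmetric]
    by (simp add: power_mult_distrib algebra_simps)
qed

end

section \<open>Coercivity of the consensus energy\<close>

context eigenbasis
begin

lemma sq_E_nonneg: "0 \<le> sq_E z"
  unfolding sq_E_def by (intro sum_nonneg) auto

lemma sq_EF_nonneg: "0 \<le> sq_EF z"
  unfolding sq_EF_def by (intro sum_nonneg divide_nonneg_pos) (auto intro: lam_pos)

lemma sq_E_le: "sq_E z \<le> (\<Sum>i\<in>UNIV. (norm (z i))\<^sup>2)"
  unfolding sum_norm_coord_split[symmetric] sq_E_def by simp

lemma cross_EF_bound:
  assumes \<rho>\<^sub>2: "0 < \<rho>\<^sub>2" "\<And>i. i \<noteq> i1 \<Longrightarrow> \<rho>\<^sub>2 \<le> lam i" and a: "0 < a"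
  shows "\<bar>cross_EF x w\<bar> \<le> a / 2 * sq_E x + 1 / (2 * a * \<rho>\<^sub>2) * sq_EF w"
proof -
  have "\<bar>cross_EF x w\<bar> \<le> (\<Sum>i\<in>-{i1}. \<bar>(coord x i \<bullet> coord w i) / lam i\<bar>)"
    unfolding cross_EF_def by (rule sum_abs)
  also have "\<dots> \<le> (\<Sum>i\<in>-{i1}. a / 2 * (norm (coord x i))\<^sup>2 + 1 / (2 * a * \<rho>\<^sub>2) * ((norm (coord w i))\<^sup>2 / lam i))"
  proof (rule sum_mono)
    fix i assume "i \<in> -{i1}"
    then have i: "\<rho>\<^sub>2 \<le> lam i" "0 < lam i" using \<rho>\<^sub>2 lam_pos by auto
    have "\<bar>(coord x i \<bullet> coord w i) / lam i\<bar> \<le> norm (coord x i) * norm (coord w i) / lam i"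
      using i Cauchy_Schwarz_ineq2[of "coord x i" "coord w i"] by (simp add: abs_divide divide_right_mono)
    also have "\<dots> = norm (coord x i) * (norm (coord w i) / lam i)" by simp
    also have "\<dots> \<le> a / 2 * (norm (coord x i))\<^sup>2 + (norm (coord w i) / lam i)\<^sup>2 / (2 * a)"
      by (rule young_mult[OF a])
    also have "(norm (coord w i) / lam i)\<^sup>2 / (2 * a) = (norm (coord w i))\<^sup>2 / lam i / (2 * a * lam i)"
      by (simp add: power2_eq_square mult_ac)
    also have "\<dots> \<le> (norm (coord w i))\<^sup>2 / lam i / (2 * a * \<rho>\<^sub>2)"
      using i \<rho>\<^sub>2 a by (intro divide_left_mono) auto
    finally show "\<bar>(coord x i \<bullet> coord w i) / lam i\<bar>
      \<le> a / 2 * (norm (coord x i))\<^sup>2 + 1 / (2 * a * \<rho>\<^sub>2) * ((norm (coord w i))\<^sup>2 / lam i)"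
      by (simp add: mult_ac)
  qed
  also have "\<dots> = a / 2 * sq_E x + 1 / (2 * a * \<rho>\<^sub>2) * sq_EF w"
    unfolding sum.distrib sq_E_def sq_EF_def by (simp only: sum_distrib_left)
  finally show ?thesis .
qed

text \<open>The cross term is split with parameter 1/(\<tau>\<rho>_2) for the lower bound and
  \<tau>\<rho>_2 for the upper one; these choices produce \<epsilon>_1 and \<epsilon>_2. The first
  takes exactly \<tau>/2 from the weight (1+\<tau>)/2 of \<open>W\<^sub>1\<close>.\<close>

lemma consensus_energy_bounds:
  assumes \<rho>\<^sub>2: "0 < \<rho>\<^sub>2" "\<And>i. i \<noteq> i1 \<Longrightarrow> \<rho>\<^sub>2 \<le> lam i" and m: "0 < m" and \<tau>: "1 < \<tau> * \<rho>\<^sub>2"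
    and \<epsilon>\<^sub>1: "\<epsilon>\<^sub>1 = (\<tau> * \<rho>\<^sub>2 - 1) / (2 * \<tau> * \<rho>\<^sub>2)"
    and \<epsilon>\<^sub>2: "\<epsilon>\<^sub>2 = max ((1 + \<tau> * \<rho>\<^sub>2) / 2) ((1 + \<tau>) / 2 + 1 / (2 * \<tau> * \<rho>\<^sub>2\<^sup>2))"
  shows "\<epsilon>\<^sub>1 * (sq_E x + ((norm (coord w i1))\<^sup>2 / m + sq_EF w)) \<le> consensus_energy (1 + \<tau>) m x w"
    and "consensus_energy (1 + \<tau>) m x w \<le> \<epsilon>\<^sub>2 * (sq_E x + ((norm (coord w i1))\<^sup>2 / m + sq_EF w))"
proof -
  have \<tau>0: "0 < \<tau>" using \<tau> \<rho>\<^sub>2 by (metis less_trans zero_less_mult_pos2 zero_less_one)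
  define X W\<^sub>0 W\<^sub>1 where "X = sq_E x" and "W\<^sub>0 = (norm (coord w i1))\<^sup>2 / m" and "W\<^sub>1 = sq_EF w"
  have nonneg: "0 \<le> X" "0 \<le> W\<^sub>0" "0 \<le> W\<^sub>1"
    using m by (auto simp: X_def W\<^sub>0_def W\<^sub>1_def sq_E_nonneg sq_EF_nonneg)
  have energy: "consensus_energy (1 + \<tau>) m x w = X / 2 + (1 + \<tau>) / 2 * (W\<^sub>0 + W\<^sub>1) + cross_EF x w"
    by (simp add: consensus_energy_def X_def W\<^sub>0_def W\<^sub>1_def)
  show "\<epsilon>\<^sub>1 * (sq_E x + ((norm (coord w i1))\<^sup>2 / m + sq_EF w)) \<le> consensus_energy (1 + \<tau>) m x w"
  proof -
    have \<epsilon>1: "\<epsilon>\<^sub>1 = 1 / 2 - 1 / (2 * (\<tau> * \<rho>\<^sub>2))"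
      using \<tau>0 \<rho>\<^sub>2 by (simp add: \<epsilon>\<^sub>1 field_simps)
    have "0 < 1 / (2 * (\<tau> * \<rho>\<^sub>2))" using \<tau>0 \<rho>\<^sub>2 by simp
    then have half: "\<epsilon>\<^sub>1 \<le> 1 / 2" unfolding \<epsilon>1 by linarith
    have "\<bar>cross_EF x w\<bar> \<le> 1 / (\<tau> * \<rho>\<^sub>2) / 2 * X + 1 / (2 * (1 / (\<tau> * \<rho>\<^sub>2)) * \<rho>\<^sub>2) * W\<^sub>1"
      unfolding X_def W\<^sub>1_def using \<tau>0 \<rho>\<^sub>2 by (intro cross_EF_bound) auto
    then have "\<bar>cross_EF x w\<bar> \<le> 1 / (2 * (\<tau> * \<rho>\<^sub>2)) * X + \<tau> / 2 * W\<^sub>1"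
      using \<tau>0 \<rho>\<^sub>2 by (simp add: mult.commute)
    moreover have "\<epsilon>\<^sub>1 * W\<^sub>0 \<le> 1 / 2 * W\<^sub>0" "\<epsilon>\<^sub>1 * W\<^sub>1 \<le> 1 / 2 * W\<^sub>1"
      by (rule mult_right_mono[OF half nonneg(2)], rule mult_right_mono[OF half nonneg(3)])
    moreover have "0 \<le> \<tau> * W\<^sub>0" using \<tau>0 nonneg by simp
    moreover have "\<epsilon>\<^sub>1 * X = X / 2 - 1 / (2 * (\<tau> * \<rho>\<^sub>2)) * X"
      unfolding \<epsilon>1 left_diff_distrib by simp
    moreover have "(1 + \<tau>) / 2 * (W\<^sub>0 + W\<^sub>1) = W\<^sub>0 / 2 + W\<^sub>1 / 2 + \<tau> * W\<^sub>0 / 2 + \<tau> / 2 * W\<^sub>1"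
      by (simp add: field_simps)
    moreover have "\<epsilon>\<^sub>1 * (X + (W\<^sub>0 + W\<^sub>1)) = \<epsilon>\<^sub>1 * X + \<epsilon>\<^sub>1 * W\<^sub>0 + \<epsilon>\<^sub>1 * W\<^sub>1"
      by (simp add: distrib_left)
    ultimately show ?thesis
      unfolding energy unfolding X_def[symmetric] W\<^sub>0_def[symmetric] W\<^sub>1_def[symmetric] by linarith
  qed
  show "consensus_energy (1 + \<tau>) m x w \<le> \<epsilon>\<^sub>2 * (sq_E x + ((norm (coord w i1))\<^sup>2 / m + sq_EF w))"
  proof -
    have "\<bar>cross_EF x w\<bar> \<le> \<tau> * \<rho>\<^sub>2 / 2 * X + 1 / (2 * (\<tau> * \<rho>\<^sub>2) * \<rho>\<^sub>2) * W\<^sub>1"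
      unfolding X_def W\<^sub>1_def using \<tau>0 \<rho>\<^sub>2 by (intro cross_EF_bound) auto
    moreover have "1 / (2 * (\<tau> * \<rho>\<^sub>2) * \<rho>\<^sub>2) = 1 / (2 * \<tau> * \<rho>\<^sub>2\<^sup>2)"
      by (simp add: power2_eq_square mult_ac)
    moreover have "(1 + \<tau> * \<rho>\<^sub>2) / 2 * X \<le> \<epsilon>\<^sub>2 * X"
      using nonneg by (intro mult_right_mono) (auto simp: \<epsilon>\<^sub>2)
    moreover have "((1 + \<tau>) / 2 + 1 / (2 * \<tau> * \<rho>\<^sub>2\<^sup>2)) * (W\<^sub>0 + W\<^sub>1) \<le> \<epsilon>\<^sub>2 * (W\<^sub>0 + W\<^sub>1)"
      using nonneg by (intro mult_right_mono) (auto simp: \<epsilon>\<^sub>2)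
    moreover have "0 \<le> 1 / (2 * \<tau> * \<rho>\<^sub>2\<^sup>2) * W\<^sub>0" using \<tau>0 nonneg by simp
    moreover have "(1 + \<tau> * \<rho>\<^sub>2) / 2 * X = X / 2 + \<tau> * \<rho>\<^sub>2 / 2 * X" by (simp add: field_simps)
    moreover have "(t + c) * (W\<^sub>0 + W\<^sub>1) = t * (W\<^sub>0 + W\<^sub>1) + c * W\<^sub>0 + c * W\<^sub>1" for t c
      by (simp add: algebra_simps)
    ultimately show ?thesis
      unfolding energy unfolding X_def[symmetric] W\<^sub>0_def[symmetric] W\<^sub>1_def[symmetric] distrib_left[of \<epsilon>\<^sub>2 X]
      by (smt (verit))
  qed
qed

end

lemma norm_add4_sq: "(norm (a + b + c + d :: 'a::real_inner))\<^sup>2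
    \<le> 4 * ((norm a)\<^sup>2 + (norm b)\<^sup>2 + (norm c)\<^sup>2 + (norm d)\<^sup>2)"
proof -
  have "0 \<le> (norm (a - b))\<^sup>2 + (norm (a - c))\<^sup>2 + (norm (a - d))\<^sup>2 + (norm (b - c))\<^sup>2
      + (norm (b - d))\<^sup>2 + (norm (c - d))\<^sup>2"
    by simp
  then show ?thesis
    by (simp add: power2_norm_eq_inner inner_add_left inner_add_right inner_diff_left inner_diff_right
        inner_commute)
qed

section \<open>Step length, compression error and the coupled recursion\<close>

context compressed_run
begin

text \<open>The move of one agent is bounded by the stacked move, a sum of four vectors in
  eigencoordinates, whence the factor 4. The F-weights divide |w|^2 by an eigenvalue, and undoing
  this costs at most \<rho>.\<close>

lemma norm_increment:
  assumes lam: "\<And>i. i \<noteq> i1 \<Longrightarrow> lam i \<le> \<rho>" and m: "0 < m" "m \<le> \<rho>"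
  shows "(norm (x i (Suc k) - x i k))\<^sup>2
    \<le> 4 * \<alpha>\<^sup>2 * (\<beta>\<^sup>2 * \<rho>\<^sup>2 * sq_E (err k)
        + max (\<beta>\<^sup>2 * \<rho>\<^sup>2 + l\<^sup>2) (\<gamma>\<^sup>2 * \<rho>)
          * (sq_E (\<lambda>j. x j k) + ((norm (coord (w k) i1))\<^sup>2 / m + sq_EF (w k))))"
proof -
  let ?x = "coord (\<lambda>j. x j k)" and ?e = "coord (err k)" and ?w = "coord (w k)"
    and ?h = "coord (\<lambda>j. gk k j - g0 k j)"
  define z where "z j = x j (Suc k) - x j k" for j
  have \<rho>: "0 < \<rho>" using m by simp
  have "z = (\<lambda>j. (-\<alpha>) *\<^sub>R (\<beta> *\<^sub>R block_mult L (\<lambda>j. x j k + err k j) j + \<gamma> *\<^sub>R w k j + (gk k j - g0 k j)))"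
    by (simp add: z_def x_step fun_eq_iff)
  then have "coord z i = (-\<alpha>) *\<^sub>R ((\<beta> * eigval i) *\<^sub>R ?x i + (\<beta> * eigval i) *\<^sub>R ?e i + \<gamma> *\<^sub>R ?w i + ?h i)" for i
    by (simp only: coord_scaleR coord_add coord_L scaleR_right_distrib scaleR_scaleR mult.assoc)
  then have norm_z: "(norm (coord z i))\<^sup>2
      \<le> \<alpha>\<^sup>2 * (4 * ((\<beta> * eigval i)\<^sup>2 * (norm (?x i))\<^sup>2 + (\<beta> * eigval i)\<^sup>2 * (norm (?e i))\<^sup>2 + \<gamma>\<^sup>2 * (norm (?w i))\<^sup>2 + (norm (?h i))\<^sup>2))" for i
    using norm_add4_sq[of "(\<beta> * eigval i) *\<^sub>R ?x i" "(\<beta> * eigval i) *\<^sub>R ?e i" "\<gamma> *\<^sub>R ?w i" "?h i"]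
    by (simp add: power_mult_distrib mult_left_mono)
  have off: "(norm (coord z i))\<^sup>2
      \<le> 4 * \<alpha>\<^sup>2 * (\<beta>\<^sup>2 * \<rho>\<^sup>2 * (norm (?x i))\<^sup>2 + \<beta>\<^sup>2 * \<rho>\<^sup>2 * (norm (?e i))\<^sup>2
          + \<gamma>\<^sup>2 * \<rho> * ((norm (?w i))\<^sup>2 / lam i) + (norm (?h i))\<^sup>2)" if "i \<in> -{i1}" for i
  proof -
    have i: "0 < lam i" "lam i \<le> \<rho>" "eigval i = lam i" using that lam lam_pos by (auto simp: eigval_def)
    have "(\<beta> * eigval i)\<^sup>2 \<le> \<beta>\<^sup>2 * \<rho>\<^sup>2"
      unfolding power_mult_distrib using i by (intro mult_left_mono power_mono) auto
    then have 1: "(\<beta> * eigval i)\<^sup>2 * a\<^sup>2 \<le> \<beta>\<^sup>2 * \<rho>\<^sup>2 * a\<^sup>2" for a by (rule mult_right_mono) simp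
    have "(norm (?w i))\<^sup>2 / lam i * lam i \<le> (norm (?w i))\<^sup>2 / lam i * \<rho>"
      using i by (intro mult_left_mono) auto
    then have "\<gamma>\<^sup>2 * (norm (?w i))\<^sup>2 \<le> \<gamma>\<^sup>2 * (\<rho> * ((norm (?w i))\<^sup>2 / lam i))"
      using i by (intro mult_left_mono) (auto simp: mult.commute)
    then have 2: "\<gamma>\<^sup>2 * (norm (?w i))\<^sup>2 \<le> \<gamma>\<^sup>2 * \<rho> * ((norm (?w i))\<^sup>2 / lam i)" by (simp only: mult.assoc)
    have "(norm (coord z i))\<^sup>2 \<le> \<alpha>\<^sup>2 * (4 * (\<beta>\<^sup>2 * \<rho>\<^sup>2 * (norm (?x i))\<^sup>2 + \<beta>\<^sup>2 * \<rho>\<^sup>2 * (norm (?e i))\<^sup>2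
          + \<gamma>\<^sup>2 * \<rho> * ((norm (?w i))\<^sup>2 / lam i) + (norm (?h i))\<^sup>2))"
      by (intro order_trans[OF norm_z] mult_left_mono add_mono 1 2 order_refl) auto
    then show ?thesis by (simp only: mult_ac)
  qed
  \<comment> \<open>The eigenvalue at \<open>i1\<close> is 0, so only w and the gradient difference
    remain, and m takes the place of the eigenvalue.\<close>
  have mean: "(norm (coord z i1))\<^sup>2
      \<le> 4 * \<alpha>\<^sup>2 * (\<gamma>\<^sup>2 * \<rho> * ((norm (?w i1))\<^sup>2 / m) + (norm (?h i1))\<^sup>2)"
  proof -
    have "(norm (?w i1))\<^sup>2 / m * m \<le> (norm (?w i1))\<^sup>2 / m * \<rho>"
      using m by (intro mult_left_mono) auto
    then have "\<gamma>\<^sup>2 * (norm (?w i1))\<^sup>2 \<le> \<gamma>\<^sup>2 * (\<rho> * ((norm (?w i1))\<^sup>2 / m))"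
      using m by (intro mult_left_mono) (auto simp: mult.commute)
    then have 2: "\<gamma>\<^sup>2 * (norm (?w i1))\<^sup>2 \<le> \<gamma>\<^sup>2 * \<rho> * ((norm (?w i1))\<^sup>2 / m)" by (simp only: mult.assoc)
    have "(norm (coord z i1))\<^sup>2 \<le> \<alpha>\<^sup>2 * (4 * (\<gamma>\<^sup>2 * (norm (?w i1))\<^sup>2 + (norm (?h i1))\<^sup>2))"
      using norm_z[of i1] by (simp add: eigval_def)
    also have "\<dots> \<le> \<alpha>\<^sup>2 * (4 * (\<gamma>\<^sup>2 * \<rho> * ((norm (?w i1))\<^sup>2 / m) + (norm (?h i1))\<^sup>2))"
      by (intro mult_left_mono add_mono 2 order_refl) auto
    finally show ?thesis by (simp only: mult_ac)
  qed
  have "(norm (z i))\<^sup>2 \<le> (\<Sum>j\<in>UNIV. (norm (z j))\<^sup>2)"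
    by (rule member_le_sum) auto
  also have "\<dots> = (norm (coord z i1))\<^sup>2 + (\<Sum>i\<in>-{i1}. (norm (coord z i))\<^sup>2)"
    by (rule sum_norm_coord_split[symmetric])
  also have "\<dots> \<le> 4 * \<alpha>\<^sup>2 * (\<gamma>\<^sup>2 * \<rho> * ((norm (?w i1))\<^sup>2 / m) + (norm (?h i1))\<^sup>2)
     + (\<Sum>i\<in>-{i1}. 4 * \<alpha>\<^sup>2 * (\<beta>\<^sup>2 * \<rho>\<^sup>2 * (norm (?x i))\<^sup>2 + \<beta>\<^sup>2 * \<rho>\<^sup>2 * (norm (?e i))\<^sup>2
          + \<gamma>\<^sup>2 * \<rho> * ((norm (?w i))\<^sup>2 / lam i) + (norm (?h i))\<^sup>2))"
    by (intro add_mono mean sum_mono off)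
  also have "(\<Sum>i\<in>-{i1}. 4 * \<alpha>\<^sup>2 * (\<beta>\<^sup>2 * \<rho>\<^sup>2 * (norm (?x i))\<^sup>2 + \<beta>\<^sup>2 * \<rho>\<^sup>2 * (norm (?e i))\<^sup>2
          + \<gamma>\<^sup>2 * \<rho> * ((norm (?w i))\<^sup>2 / lam i) + (norm (?h i))\<^sup>2))
     = 4 * \<alpha>\<^sup>2 * (\<beta>\<^sup>2 * \<rho>\<^sup>2 * sq_E (\<lambda>j. x j k) + \<beta>\<^sup>2 * \<rho>\<^sup>2 * sq_E (err k) + \<gamma>\<^sup>2 * \<rho> * sq_EF (w k)
        + sq_E (\<lambda>j. gk k j - g0 k j))"
    unfolding sq_E_def sq_EF_def by (simp only: sum_distrib_left[symmetric] sum.distrib)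
  finally have 1: "(norm (z i))\<^sup>2 \<le> 4 * \<alpha>\<^sup>2 * (\<gamma>\<^sup>2 * \<rho> * ((norm (?w i1))\<^sup>2 / m) + (norm (?h i1))\<^sup>2)
     + 4 * \<alpha>\<^sup>2 * (\<beta>\<^sup>2 * \<rho>\<^sup>2 * sq_E (\<lambda>j. x j k) + \<beta>\<^sup>2 * \<rho>\<^sup>2 * sq_E (err k) + \<gamma>\<^sup>2 * \<rho> * sq_EF (w k)
        + sq_E (\<lambda>j. gk k j - g0 k j))" .
  define M where "M = max (\<beta>\<^sup>2 * \<rho>\<^sup>2 + l\<^sup>2) (\<gamma>\<^sup>2 * \<rho>)"
  define W where "W = (norm (?w i1))\<^sup>2 / m + sq_EF (w k)"
  have "0 \<le> W" using m by (simp add: W_def sq_EF_nonneg)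
  then have "\<gamma>\<^sup>2 * \<rho> * W \<le> M * W" by (intro mult_right_mono) (auto simp: M_def)
  moreover have "(\<beta>\<^sup>2 * \<rho>\<^sup>2 + l\<^sup>2) * sq_E (\<lambda>j. x j k) \<le> M * sq_E (\<lambda>j. x j k)"
    by (intro mult_right_mono sq_E_nonneg) (auto simp: M_def)
  moreover have "(norm (?h i1))\<^sup>2 + sq_E (\<lambda>j. gk k j - g0 k j) \<le> l\<^sup>2 * sq_E (\<lambda>j. x j k)"
    by (rule sum_norm_gk_diff)
  ultimately have "\<beta>\<^sup>2 * \<rho>\<^sup>2 * sq_E (\<lambda>j. x j k) + \<gamma>\<^sup>2 * \<rho> * W + ((norm (?h i1))\<^sup>2 + sq_E (\<lambda>j. gk k j - g0 k j))
      \<le> M * (sq_E (\<lambda>j. x j k) + W)"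
    unfolding distrib_left distrib_right by linarith
  then have "4 * \<alpha>\<^sup>2 * (\<beta>\<^sup>2 * \<rho>\<^sup>2 * sq_E (err k) + (\<beta>\<^sup>2 * \<rho>\<^sup>2 * sq_E (\<lambda>j. x j k) + \<gamma>\<^sup>2 * \<rho> * W
        + ((norm (?h i1))\<^sup>2 + sq_E (\<lambda>j. gk k j - g0 k j))))
      \<le> 4 * \<alpha>\<^sup>2 * (\<beta>\<^sup>2 * \<rho>\<^sup>2 * sq_E (err k) + M * (sq_E (\<lambda>j. x j k) + W))"
    by (intro mult_left_mono add_left_mono) auto
  moreover have "4 * \<alpha>\<^sup>2 * (\<gamma>\<^sup>2 * \<rho> * ((norm (?w i1))\<^sup>2 / m) + (norm (?h i1))\<^sup>2)
     + 4 * \<alpha>\<^sup>2 * (\<beta>\<^sup>2 * \<rho>\<^sup>2 * sq_E (\<lambda>j. x j k) + \<beta>\<^sup>2 * \<rho>\<^sup>2 * sq_E (err k) + \<gamma>\<^sup>2 * \<rho> * sq_EF (w k)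
        + sq_E (\<lambda>j. gk k j - g0 k j))
     = 4 * \<alpha>\<^sup>2 * (\<beta>\<^sup>2 * \<rho>\<^sup>2 * sq_E (err k) + (\<beta>\<^sup>2 * \<rho>\<^sup>2 * sq_E (\<lambda>j. x j k) + \<gamma>\<^sup>2 * \<rho> * W
        + ((norm (?h i1))\<^sup>2 + sq_E (\<lambda>j. gk k j - g0 k j))))"
    unfolding W_def by (simp only: distrib_left add_ac)
  ultimately show ?thesis using 1 unfolding z_def M_def W_def by linarith
qed

text \<open>In units of s_k the new error combines the compressor error, with weight \<omega>r, and
  the input, with weight \<omega>r - 1. The bounds C(1-\<delta>) and C give \<omega>r(1-\<delta>) +
  (1-\<omega>r) = 1-\<omega>r\<delta>, where \<omega>r <= 1 fixes the sign of the second
  weight.\<close>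

lemma compression_error:
  assumes compressor: "locally_bounded_compressor p r C \<delta> Q" and \<omega>: "\<omega> * r \<le> 1"
    and bound: "lp_norm p (x i k - xh i (int k - 1)) \<le> C * s k"
  shows "lp_norm p (err k i) \<le> C * s k * (1 - \<omega> * r * \<delta>)"
proof -
  have p: "1 \<le> p" and r: "0 < r" and C: "0 < C"
    and Q: "\<And>z. lp_norm p z \<le> C \<Longrightarrow> lp_norm p (Q z /\<^sub>R r - z) \<le> C * (1 - \<delta>)"
    using compressor by (auto simp: locally_bounded_compressor_def)
  have sk: "0 < s k" by (rule params_pos)
  define z where "z = (x i k - xh i (int k - 1)) /\<^sub>R s k"
  have "lp_norm p z = lp_norm p (x i k - xh i (int k - 1)) / s k"
    unfolding z_def lp_norm_scaleR[OF p] using sk by (simp add: divide_inverse mult.commute)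
  also have "\<dots> \<le> C" using bound sk by (simp add: field_simps)
  finally have z: "lp_norm p z \<le> C" .
  have "x i k - xh i (int k - 1) = s k *\<^sub>R z" using sk by (simp add: z_def)
  moreover have "q i k = Q z" unfolding q_eq z_def ..
  ultimately have "err k i = s k *\<^sub>R (\<omega> *\<^sub>R Q z - z)"
    by (simp add: err_def xh_eq[of i k] algebra_simps)
  also have "\<omega> *\<^sub>R Q z - z = (\<omega> * r) *\<^sub>R (Q z /\<^sub>R r - z) + (\<omega> * r - 1) *\<^sub>R z"
    using r by (simp add: scaleR_right_diff_distrib scaleR_left_diff_distrib)
  finally have "lp_norm p (err k i) = s k * lp_norm p ((\<omega> * r) *\<^sub>R (Q z /\<^sub>R r - z) + (\<omega> * r - 1) *\<^sub>R z)"
    using sk by (simp add: lp_norm_scaleR[OF p])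
  also have "\<dots> \<le> s k * (lp_norm p ((\<omega> * r) *\<^sub>R (Q z /\<^sub>R r - z)) + lp_norm p ((\<omega> * r - 1) *\<^sub>R z))"
    using sk by (intro mult_left_mono lp_norm_triangle p) auto
  also have "\<dots> = s k * (\<omega> * r * lp_norm p (Q z /\<^sub>R r - z) + (1 - \<omega> * r) * lp_norm p z)"
    unfolding lp_norm_scaleR[OF p] using \<omega> r params_pos by (simp add: abs_mult)
  also have "\<dots> \<le> s k * (\<omega> * r * (C * (1 - \<delta>)) + (1 - \<omega> * r) * C)"
    using sk[THEN less_imp_le] \<omega> r params_pos by (intro mult_left_mono add_mono Q z) auto
  finally show ?thesis by (simp add: algebra_simps)
qed

text \<open>The offset c, later the infimum of f, stays free because it cancels in the
  descent.\<close>

definition lyapunov :: "real \<Rightarrow> real \<Rightarrow> nat \<Rightarrow> real" where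
  "lyapunov m c k = consensus_energy ((\<beta> + \<gamma>) / \<gamma>) m (\<lambda>j. x j k) (w k)
     + real CARD('n) * (favg (xbar k) - c)"

lemma lyapunov_descent:
  assumes \<rho>\<^sub>2: "0 < \<rho>\<^sub>2" and lam: "\<And>i. i \<noteq> i1 \<Longrightarrow> \<rho>\<^sub>2 \<le> lam i" "\<And>i. i \<noteq> i1 \<Longrightarrow> lam i \<le> \<rho>"
    and m: "\<rho>\<^sub>2 \<le> m" "m \<le> \<rho>" and \<beta>\<gamma>: "\<gamma> \<le> \<rho>\<^sub>2 * \<beta>" and \<gamma>: "5 / \<rho>\<^sub>2 < \<gamma>"
    and \<phi>\<^sub>1_def: "\<phi>\<^sub>1 = (1 / 2) * (\<rho>\<^sub>2 * \<beta> - (3 * \<gamma> + 2 + 2 * l\<^sup>2))"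
    and \<phi>\<^sub>2_def: "\<phi>\<^sub>2 = 3 * \<rho>\<^sup>2 * \<beta>\<^sup>2 - \<rho>\<^sub>2 * \<beta> * \<gamma> + (\<rho> + 2) * \<gamma>\<^sup>2 + 1 + (5 / 2) * l\<^sup>2"
    and \<phi>\<^sub>3_def: "\<phi>\<^sub>3 = \<gamma> / 2 - (5 / 2) * (1 / \<rho>\<^sub>2)"
    and \<phi>\<^sub>4_def: "\<phi>\<^sub>4 = 2 * \<rho> * \<gamma>\<^sup>2 + (1 / 2) * \<rho>"
    and \<phi>\<^sub>5_def: "\<phi>\<^sub>5 = 1 / 8 - (\<beta> + \<gamma>)\<^sup>2 / \<gamma> ^ 5 * (1 / \<rho>\<^sub>2) * l\<^sup>2
                        - 1 / (2 * \<gamma>\<^sup>2) * (1 / \<rho>\<^sub>2\<^sup>2) * l\<^sup>2"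
    and \<phi>\<^sub>6_def: "\<phi>\<^sub>6 = (\<beta> + \<gamma>) / (2 * \<gamma> ^ 3) * (1 / \<rho>\<^sub>2) * l\<^sup>2
                        + 1 / (2 * \<gamma>\<^sup>2) * (1 / \<rho>\<^sub>2\<^sup>2) * l\<^sup>2
                        + (1 / 2) * (1 / \<rho>\<^sub>2\<^sup>2) * l\<^sup>2 + l\<^sup>2 / 2 + l / 2"
    and \<phi>\<^sub>7_def: "\<phi>\<^sub>7 = (\<rho> + 1) * \<gamma> + (1 / 2) * \<rho> * \<beta>"
    and \<phi>\<^sub>8_def: "\<phi>\<^sub>8 = 3 * \<rho>\<^sup>2 * \<beta>\<^sup>2 + (\<rho> - 2 * \<rho>\<^sub>2) * \<beta> * \<gamma> + (\<rho> + 2) * \<gamma>\<^sup>2 + 1"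
  shows "lyapunov m c (Suc k) \<le> lyapunov m c k - \<alpha> * (\<phi>\<^sub>1 - \<alpha> * \<phi>\<^sub>2) * sq_E (\<lambda>j. x j k)
    - \<alpha> * (\<phi>\<^sub>3 - \<alpha> * \<phi>\<^sub>4) * ((norm (coord (w k) i1))\<^sup>2 / m + sq_EF (w k))
    - \<alpha> * (\<phi>\<^sub>5 - \<alpha> * \<phi>\<^sub>6) * (norm (coord (gk k) i1))\<^sup>2
    - \<alpha> / 4 * (norm (coord (g0 k) i1))\<^sup>2 + \<alpha> * (\<phi>\<^sub>7 + \<alpha> * \<phi>\<^sub>8) * sq_E (err k)"
  unfolding lyapunov_def
proof (rule descent_combination[OF \<rho>\<^sub>2 m(1) params_pos(1-3) _ \<gamma> refl refl refl refl refl \<phi>\<^sub>1_def \<phi>\<^sub>2_def \<phi>\<^sub>3_def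
      \<phi>\<^sub>4_def \<phi>\<^sub>5_def \<phi>\<^sub>6_def \<phi>\<^sub>7_def \<phi>\<^sub>8_def])
  show "0 < \<rho>" using \<rho>\<^sub>2 m by linarith
  show "consensus_energy ((\<beta> + \<gamma>) / \<gamma>) m (\<lambda>j. x j (Suc k)) (w (Suc k))
    \<le> consensus_energy ((\<beta> + \<gamma>) / \<gamma>) m (\<lambda>j. x j k) (w k)
      + (- \<alpha> * (\<rho>\<^sub>2 * \<beta> / 2 - 3 * \<gamma> / 2 - 1)
         + \<alpha>\<^sup>2 * (3 * \<rho>\<^sup>2 * \<beta>\<^sup>2 - \<rho>\<^sub>2 * \<beta> * \<gamma> + (\<rho> + 2) * \<gamma>\<^sup>2 + 1)) * sq_E (\<lambda>j. x j k)
      + (- \<alpha> * (\<gamma> / 2 - 1 / (2 * \<rho>\<^sub>2)) + \<alpha>\<^sup>2 * (2 * \<rho> * \<gamma>\<^sup>2 + \<rho> / 2)) * sq_EF (w k)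
      + (\<alpha> * ((\<rho> + 1) * \<gamma> + \<rho> * \<beta> / 2)
         + \<alpha>\<^sup>2 * (3 * \<rho>\<^sup>2 * \<beta>\<^sup>2 + (\<rho> - 2 * \<rho>\<^sub>2) * \<beta> * \<gamma> + (\<rho> + 2) * \<gamma>\<^sup>2 + 1)) * sq_E (err k)
      + (\<alpha> + 5 / 2 * \<alpha>\<^sup>2) * sq_E (\<lambda>j. gk k j - g0 k j)
      + ((\<beta> + \<gamma>)\<^sup>2 / (\<alpha> * \<gamma> ^ 5 * \<rho>\<^sub>2) + 1 / (2 * \<alpha> * \<gamma>\<^sup>2 * \<rho>\<^sub>2\<^sup>2) + (\<beta> + \<gamma>) / (2 * \<gamma> ^ 3 * \<rho>\<^sub>2)
         + 1 / (2 * \<gamma>\<^sup>2 * \<rho>\<^sub>2\<^sup>2) + 1 / (2 * \<rho>\<^sub>2\<^sup>2) + 1 / 2) * (\<Sum>i\<in>UNIV. (norm (g0 (Suc k) i - g0 k i))\<^sup>2)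
      + \<alpha> * \<gamma> / 4 * ((norm (coord (w k) i1))\<^sup>2 / m)"
    by (rule consensus_energy_step[OF \<rho>\<^sub>2 lam m(1) params_pos(1-3) \<beta>\<gamma> x_step w_step refl refl refl refl refl refl])
  show "(norm (coord (w k) i1))\<^sup>2 / m = (norm (coord (g0 k) i1))\<^sup>2 / \<gamma>\<^sup>2 / m"
    by (simp add: coord_w_i1 power_divide power_mult_distrib)
  show "sq_E (\<lambda>j. gk k j - g0 k j) + (norm (coord (\<lambda>j. gk k j - g0 k j) i1))\<^sup>2 \<le> l\<^sup>2 * sq_E (\<lambda>j. x j k)"
    using sum_norm_gk_diff by (simp add: add.commute)
  show "real CARD('n) * (favg (xbar (Suc k)) - c) \<le> real CARD('n) * (favg (xbar k) - c)
    - \<alpha> / 2 * ((norm (coord (gk k) i1))\<^sup>2 + (norm (coord (g0 k) i1))\<^sup>2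
        - (norm (coord (\<lambda>j. gk k j - g0 k j) i1))\<^sup>2)
    + \<alpha>\<^sup>2 * l / 2 * (norm (coord (gk k) i1))\<^sup>2"
    using favg_step[of k] by (simp add: right_diff_distrib)
qed (use sum_norm_g0_diff sq_EF_nonneg in auto)

text \<open>\<open>V\<close> is abstract: only its recursion and its control of the increments
  matter. \<psi>_3 and \<psi>_4 are the coefficients b and a/\<epsilon>_1 of the increment bound
  after the change of norm and Young's inequality.\<close>

lemma linear_rate:
  fixes V :: "nat \<Rightarrow> real"
  assumes compressor: "locally_bounded_compressor p r C \<delta> Q" and \<omega>: "\<omega> * r \<le> 1"
    and s: "s = (\<lambda>k. s\<^sub>0 * \<epsilon> ^ k)"
    and dt: "dt = d_tilde CARD('d) p" and dh: "dh = d_hat CARD('d) p"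
    and \<epsilon>\<^sub>5: "\<epsilon>\<^sub>5 = \<omega> * r * (\<delta> - \<delta>\<^sup>2 / 2)"
    and V_step: "\<And>k. V (Suc k) \<le> (1 - \<alpha> * \<epsilon>\<^sub>6) * V k + \<alpha> * \<psi>\<^sub>2 * sq_E (err k)"
    and contraction: "0 \<le> 1 - \<alpha> * \<epsilon>\<^sub>6" and \<psi>\<^sub>2: "0 \<le> \<psi>\<^sub>2"
    and increment: "\<And>i k. (norm (x i (Suc k) - x i k))\<^sup>2 \<le> 4 * \<alpha>\<^sup>2 * (b * sq_E (err k) + a / \<epsilon>\<^sub>1 * V k)"
    and nonneg: "0 \<le> a" "0 \<le> b" "0 < \<epsilon>\<^sub>1"
    and \<psi>\<^sub>3: "\<psi>\<^sub>3 = 4 * (1 + 1 / \<epsilon>\<^sub>5) * dh\<^sup>2 * b" and \<psi>\<^sub>4: "\<psi>\<^sub>4 = 4 * (1 + 1 / \<epsilon>\<^sub>5) * dh\<^sup>2 * a / \<epsilon>\<^sub>1"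
    and \<psi>\<^sub>5: "0 < \<psi>\<^sub>5"
    and rate_V: "1 - \<alpha> * (\<epsilon>\<^sub>6 - (1 - 2 * \<epsilon>\<^sub>5) * \<psi>\<^sub>2 / \<psi>\<^sub>5) \<le> \<epsilon>\<^sup>2"
    and rate_x: "1 - (\<epsilon>\<^sub>5 + 2 * \<epsilon>\<^sub>5\<^sup>2) + \<alpha>\<^sup>2 * real CARD('n) * dt\<^sup>2 * ((1 - 2 * \<epsilon>\<^sub>5) * \<psi>\<^sub>3 + \<psi>\<^sub>4 * \<psi>\<^sub>5) \<le> \<epsilon>\<^sup>2"
    and V_0: "V 0 \<le> real CARD('n) * dt\<^sup>2 * \<psi>\<^sub>5 * C\<^sup>2 * s\<^sub>0\<^sup>2"
    and x_0: "\<And>i. lp_norm p (x i 0) \<le> C * s\<^sub>0"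
  shows "V k \<le> real CARD('n) * dt\<^sup>2 * \<psi>\<^sub>5 * C\<^sup>2 * (s k)\<^sup>2"
proof -
  let ?n = "real CARD('n)"
  have p: "1 \<le> p" and r: "0 < r" and C: "0 < C" and \<delta>: "0 < \<delta>" "\<delta> \<le> 1"
    using compressor by (auto simp: locally_bounded_compressor_def)
  have \<omega>0: "0 < \<omega>" by (rule params_pos)
  have dt0: "0 < dt" unfolding dt by (rule d_tilde_pos) simp
  have \<epsilon>5: "0 < \<epsilon>\<^sub>5"
  proof -
    have "\<delta>\<^sup>2 \<le> \<delta>" using \<delta> by (simp add: power2_eq_square mult_left_le)
    then show ?thesis using \<delta> r \<omega>0 by (simp add: \<epsilon>\<^sub>5)
  qed
  \<comment> \<open>Since \<omega>r <= 1, the square is at most 1 - 2\<omega>r\<delta> +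
    \<omega>r\<delta>^2, which is the origin of \<epsilon>_5.\<close>
  have contr: "(1 - \<omega> * r * \<delta>)\<^sup>2 \<le> 1 - 2 * \<epsilon>\<^sub>5"
  proof -
    have "\<omega> * r * (\<omega> * r * \<delta>\<^sup>2) \<le> 1 * (\<omega> * r * \<delta>\<^sup>2)"
      using \<omega> r \<omega>0 by (intro mult_right_mono) auto
    then show ?thesis by (simp add: \<epsilon>\<^sub>5 power2_eq_square algebra_simps)
  qed
  then have \<epsilon>5_half: "0 \<le> 1 - 2 * \<epsilon>\<^sub>5" by (rule order_trans[OF zero_le_power2])
  have "V k \<le> ?n * dt\<^sup>2 * \<psi>\<^sub>5 * C\<^sup>2 * (s k)\<^sup>2 \<and> (\<forall>i. lp_norm p (x i k - xh i (int k - 1)) \<le> C * s k)"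
  proof (induction k)
    case 0
    then show ?case using V_0 x_0 by (simp add: s initial)
  next
    case (Suc k)
    then have V_le: "V k \<le> ?n * dt\<^sup>2 * \<psi>\<^sub>5 * C\<^sup>2 * (s k)\<^sup>2"
      and x_le: "\<And>i. lp_norm p (x i k - xh i (int k - 1)) \<le> C * s k" by auto
    define T where "T = C\<^sup>2 * (s k)\<^sup>2"
    have T0: "0 \<le> T" by (simp add: T_def)
    have sS: "s (Suc k) = \<epsilon> * s k" by (simp add: s)
    have sk: "0 < s k" "0 < s (Suc k)" using params_pos by auto
    have err_lp: "(lp_norm p (err k i))\<^sup>2 \<le> (1 - 2 * \<epsilon>\<^sub>5) * T" for i
    proof -
      have "(lp_norm p (err k i))\<^sup>2 \<le> (C * s k * (1 - \<omega> * r * \<delta>))\<^sup>2"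
        by (intro power_mono compression_error[OF compressor \<omega> x_le] lp_norm_nonneg)
      also have "\<dots> = (1 - \<omega> * r * \<delta>)\<^sup>2 * T" by (simp add: T_def power_mult_distrib)
      also have "\<dots> \<le> (1 - 2 * \<epsilon>\<^sub>5) * T" by (rule mult_right_mono[OF contr T0])
      finally show ?thesis .
    qed
    have err_sq: "sq_E (err k) \<le> ?n * dt\<^sup>2 * ((1 - 2 * \<epsilon>\<^sub>5) * T)"
    proof -
      have "sq_E (err k) \<le> (\<Sum>i\<in>UNIV. (norm (err k i))\<^sup>2)" by (rule sq_E_le)
      also have "\<dots> \<le> (\<Sum>i\<in>(UNIV::'n set). dt\<^sup>2 * ((1 - 2 * \<epsilon>\<^sub>5) * T))"
      proof (rule sum_mono)
        fix i
        have "(norm (err k i))\<^sup>2 \<le> (dt * lp_norm p (err k i))\<^sup>2"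
          unfolding dt by (intro power_mono norm_le_lp_norm p) auto
        also have "\<dots> = dt\<^sup>2 * (lp_norm p (err k i))\<^sup>2" by (simp add: power_mult_distrib)
        also have "\<dots> \<le> dt\<^sup>2 * ((1 - 2 * \<epsilon>\<^sub>5) * T)" by (intro mult_left_mono err_lp) auto
        finally show "(norm (err k i))\<^sup>2 \<le> dt\<^sup>2 * ((1 - 2 * \<epsilon>\<^sub>5) * T)" .
      qed
      finally show ?thesis by (simp add: mult_ac)
    qed
    have V_le': "V k \<le> ?n * dt\<^sup>2 * \<psi>\<^sub>5 * T" using V_le by (simp add: T_def mult_ac)
    \<comment> \<open>Inserting the bound on \<open>V k\<close> is legitimate because its factor 1 -
      \<alpha>\<epsilon>_6 is nonnegative.\<close>
    have "V (Suc k) \<le> (1 - \<alpha> * \<epsilon>\<^sub>6) * (?n * dt\<^sup>2 * \<psi>\<^sub>5 * T) + \<alpha> * \<psi>\<^sub>2 * (?n * dt\<^sup>2 * ((1 - 2 * \<epsilon>\<^sub>5) * T))"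
      using params_pos(1) \<psi>\<^sub>2 contraction
      by (intro order_trans[OF V_step] add_mono mult_left_mono V_le' err_sq) auto
    also have "\<dots> = (1 - \<alpha> * (\<epsilon>\<^sub>6 - (1 - 2 * \<epsilon>\<^sub>5) * \<psi>\<^sub>2 / \<psi>\<^sub>5)) * (?n * dt\<^sup>2 * \<psi>\<^sub>5 * T)"
      using \<psi>\<^sub>5 by (simp add: field_simps)
    also have "\<dots> \<le> \<epsilon>\<^sup>2 * (?n * dt\<^sup>2 * \<psi>\<^sub>5 * T)"
      using \<psi>\<^sub>5 T0 by (intro mult_right_mono rate_V) auto
    finally have V_Suc: "V (Suc k) \<le> ?n * dt\<^sup>2 * \<psi>\<^sub>5 * C\<^sup>2 * (s (Suc k))\<^sup>2"
      by (simp add: sS T_def power_mult_distrib mult_ac)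
    have "lp_norm p (x i (Suc k) - xh i (int (Suc k) - 1)) \<le> C * s (Suc k)" for i
    proof -
      define d where "d = x i (Suc k) - x i k"
      define A B where "A = lp_norm p (err k i)" and "B = lp_norm p d"
      have neg: "lp_norm p (- err k i) = A"
        using lp_norm_scaleR[OF p, of "-1" "err k i"] by (simp add: A_def)
      \<comment> \<open>The next compressor input compares with time k, so it is the increment of x
        minus the current error.\<close>
      have "x i (Suc k) - xh i (int (Suc k) - 1) = d + - err k i"
        by (simp add: d_def err_def)
      then have "lp_norm p (x i (Suc k) - xh i (int (Suc k) - 1)) \<le> B + A"
        using lp_norm_triangle[OF p, of d "- err k i"] by (simp add: neg B_def)
      then have "(lp_norm p (x i (Suc k) - xh i (int (Suc k) - 1)))\<^sup>2 \<le> (B + A)\<^sup>2"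
        by (intro power_mono lp_norm_nonneg)
      also have "\<dots> \<le> (1 + \<epsilon>\<^sub>5) * A\<^sup>2 + (1 + 1 / \<epsilon>\<^sub>5) * B\<^sup>2"
      proof -
        have "A * B \<le> \<epsilon>\<^sub>5 / 2 * A\<^sup>2 + B\<^sup>2 / (2 * \<epsilon>\<^sub>5)" by (rule young_mult[OF \<epsilon>5])
        then show ?thesis by (simp add: power2_sum algebra_simps)
      qed
      also have "\<dots> \<le> (1 + \<epsilon>\<^sub>5) * ((1 - 2 * \<epsilon>\<^sub>5) * T) + (1 + 1 / \<epsilon>\<^sub>5) * (dh\<^sup>2 * (4 * \<alpha>\<^sup>2 *
          (b * (?n * dt\<^sup>2 * ((1 - 2 * \<epsilon>\<^sub>5) * T)) + a / \<epsilon>\<^sub>1 * (?n * dt\<^sup>2 * \<psi>\<^sub>5 * T))))"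
      proof (intro add_mono mult_left_mono)
        show "A\<^sup>2 \<le> (1 - 2 * \<epsilon>\<^sub>5) * T" unfolding A_def by (rule err_lp)
        have "B\<^sup>2 \<le> (dh * norm d)\<^sup>2"
          unfolding B_def dh by (intro power_mono lp_norm_le_norm lp_norm_nonneg p)
        also have "\<dots> = dh\<^sup>2 * (norm d)\<^sup>2" by (simp add: power_mult_distrib)
        also have "\<dots> \<le> dh\<^sup>2 * (4 * \<alpha>\<^sup>2 *
          (b * (?n * dt\<^sup>2 * ((1 - 2 * \<epsilon>\<^sub>5) * T)) + a / \<epsilon>\<^sub>1 * (?n * dt\<^sup>2 * \<psi>\<^sub>5 * T)))"
        proof (rule mult_left_mono)
          have "(norm d)\<^sup>2 \<le> 4 * \<alpha>\<^sup>2 * (b * sq_E (err k) + a / \<epsilon>\<^sub>1 * V k)"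
            unfolding d_def by (rule increment)
          also have "\<dots> \<le> 4 * \<alpha>\<^sup>2 * (b * (?n * dt\<^sup>2 * ((1 - 2 * \<epsilon>\<^sub>5) * T)) + a / \<epsilon>\<^sub>1 * (?n * dt\<^sup>2 * \<psi>\<^sub>5 * T))"
            using nonneg by (intro mult_left_mono add_mono err_sq V_le') auto
          finally show "(norm d)\<^sup>2 \<le> \<dots>" .
        qed simp
        finally show "B\<^sup>2 \<le> \<dots>" .
      qed (use \<epsilon>5 in auto)
      also have "\<dots> = (1 - (\<epsilon>\<^sub>5 + 2 * \<epsilon>\<^sub>5\<^sup>2) + \<alpha>\<^sup>2 * ?n * dt\<^sup>2 * ((1 - 2 * \<epsilon>\<^sub>5) * \<psi>\<^sub>3 + \<psi>\<^sub>4 * \<psi>\<^sub>5)) * T"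
      proof -
        define c\<^sub>1 c\<^sub>2 where "c\<^sub>1 = 1 + 1 / \<epsilon>\<^sub>5" and "c\<^sub>2 = a / \<epsilon>\<^sub>1"
        have "\<psi>\<^sub>4 = 4 * c\<^sub>1 * dh\<^sup>2 * c\<^sub>2" by (simp add: \<psi>\<^sub>4 c\<^sub>1_def c\<^sub>2_def)
        moreover have "\<psi>\<^sub>3 = 4 * c\<^sub>1 * dh\<^sup>2 * b" by (simp add: \<psi>\<^sub>3 c\<^sub>1_def)
        ultimately show ?thesis
          unfolding c\<^sub>1_def[symmetric] c\<^sub>2_def[symmetric] by (simp add: algebra_simps power2_eq_square[of \<epsilon>\<^sub>5])
      qed
      also have "\<dots> \<le> \<epsilon>\<^sup>2 * T" by (rule mult_right_mono[OF rate_x T0])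
      also have "\<dots> = (C * s (Suc k))\<^sup>2" by (simp add: sS T_def power_mult_distrib)
      finally show ?thesis
        by (rule power2_le_imp_le) (intro mult_nonneg_nonneg less_imp_le C sk)
    qed
    then show ?case using V_Suc by blast
  qed
  then show ?thesis by blast
qed

end

theorem theorem3:
  fixes n d :: nat
    and A L P :: "real^'n^'n" and i1 :: 'n and lam :: "'n \<Rightarrow> real" and lam_n1 :: real
    and EE FF :: "real^('n::finite \<times> 'd::finite)^('n \<times> 'd)"
    and f :: "'n \<Rightarrow> real^'d \<Rightarrow> real" and favg :: "real^'d \<Rightarrow> real" and fstar \<l> \<nu> :: real
    and Q :: "real^'d \<Rightarrow> real^'d" and p :: ereal and r C \<delta> dh dt :: real
    and x v q :: "'n \<Rightarrow> nat \<Rightarrow> real^'d" and xh y :: "'n \<Rightarrow> int \<Rightarrow> real^'d"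
    and s :: "nat \<Rightarrow> real" and xbar :: "nat \<Rightarrow> real^'d" and x0 v0 g0 gbar0 :: "real^('n::finite \<times> 'd::finite)"
    and \<alpha> \<beta> \<gamma> \<omega> \<tau>\<^sub>1 s\<^sub>0 \<epsilon> :: real
    and \<rho> \<rho>\<^sub>2 \<kappa>\<^sub>1 \<kappa>\<^sub>2 \<phi>\<^sub>1 \<phi>\<^sub>2 \<phi>\<^sub>3 \<phi>\<^sub>4 \<phi>\<^sub>5 \<phi>\<^sub>6 \<phi>\<^sub>7 \<phi>\<^sub>8 :: real
    and \<epsilon>\<^sub>1 \<epsilon>\<^sub>2 \<epsilon>\<^sub>3 \<epsilon>\<^sub>5 \<epsilon>\<^sub>6 \<psi>\<^sub>2 \<psi>\<^sub>3 \<psi>\<^sub>4 \<psi>\<^sub>5 :: real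
    and \<kappa>\<^sub>0hat \<kappa>\<^sub>5 \<kappa>\<^sub>0' :: ereal and \<kappa>\<^sub>6' \<kappa>\<^sub>\<nu> \<kappa>\<^sub>9 \<kappa>\<^sub>1\<^sub>0 :: real
  assumes n_def: "n = CARD('n)" and n_ge_2: "2 \<le> n" and d_def: "d = CARD('d)"
    \<comment> \<open>network\<close>
    and graph: "connected_weighted_graph A"
    and L_def: "L = laplacian A"
    and \<rho>_def: "\<rho> = spectral_radius L"
    and \<rho>\<^sub>2_def: "\<rho>\<^sub>2 = least_pos_eigenvalue L"
    and eigendecomposition: "laplacian_eigendecomposition L i1 P lam"
    and lam_n1: "lam_n1 \<in> {Min (lam ` (UNIV - {i1})) .. Max (lam ` (UNIV - {i1}))}"
    and EE_def: "EE = kronecker E_mat (mat 1)"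
    and FF_def: "FF = kronecker (F_mat i1 P lam lam_n1) (mat 1)"
    \<comment> \<open>cost functions\<close>
    and differentiable: "\<And>i z. f i differentiable (at z)"
    and l_pos: "0 < \<l>"
    and smooth: "\<And>i z w. norm (gradient (f i) z - gradient (f i) w) \<le> \<l> * norm (z - w)"
    and favg_def: "favg = (\<lambda>z. (1 / real n) * (\<Sum>i\<in>UNIV. f i z))"
    and bounded_below: "bdd_below (range favg)"
    and fstar_def: "fstar = Inf (range favg)"
    and \<nu>_pos: "0 < \<nu>"
    and PL: "\<And>z. (1 / 2) * (norm (gradient favg z))\<^sup>2 \<ge> \<nu> * (favg z - fstar)"
    \<comment> \<open>compressor\<close>
    and compressor: "locally_bounded_compressor p r C \<delta> Q"
    and dh_def: "dh = d_hat d p" and dt_def: "dt = d_tilde d p"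
    \<comment> \<open>algorithm\<close>
    and algorithm: "unified_compression_algorithm L f Q \<alpha> \<beta> \<gamma> \<omega> s x v q xh y"
    and xbar_def: "xbar = (\<lambda>k. (1 / real n) *\<^sub>R (\<Sum>i\<in>UNIV. x i k))"
    \<comment> \<open>constants\<close>
    and \<kappa>\<^sub>1_def: "\<kappa>\<^sub>1 = 4 / \<rho>\<^sub>2"
    and \<kappa>\<^sub>2_def: "\<kappa>\<^sub>2 = Max {2 + 2 * \<l>\<^sup>2, 5 / \<rho>\<^sub>2,
                          root 3 (16 * \<l>\<^sup>2 * (\<kappa>\<^sub>1 + 1)\<^sup>2 / \<rho>\<^sub>2), 2 * sqrt 2 * \<l> / \<rho>\<^sub>2}"
    and \<phi>\<^sub>1_def: "\<phi>\<^sub>1 = (1 / 2) * (\<rho>\<^sub>2 * \<beta> - (3 * \<gamma> + 2 + 2 * \<l>\<^sup>2))"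
    and \<phi>\<^sub>2_def: "\<phi>\<^sub>2 = 3 * \<rho>\<^sup>2 * \<beta>\<^sup>2 - \<rho>\<^sub>2 * \<beta> * \<gamma> + (\<rho> + 2) * \<gamma>\<^sup>2 + 1 + (5 / 2) * \<l>\<^sup>2"
    and \<phi>\<^sub>3_def: "\<phi>\<^sub>3 = \<gamma> / 2 - (5 / 2) * (1 / \<rho>\<^sub>2)"
    and \<phi>\<^sub>4_def: "\<phi>\<^sub>4 = 2 * \<rho> * \<gamma>\<^sup>2 + (1 / 2) * \<rho>"
    and \<phi>\<^sub>5_def: "\<phi>\<^sub>5 = 1 / 8 - (\<beta> + \<gamma>)\<^sup>2 / \<gamma> ^ 5 * (1 / \<rho>\<^sub>2) * \<l>\<^sup>2
                        - 1 / (2 * \<gamma>\<^sup>2) * (1 / \<rho>\<^sub>2\<^sup>2) * \<l>\<^sup>2"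
    and \<phi>\<^sub>6_def: "\<phi>\<^sub>6 = (\<beta> + \<gamma>) / (2 * \<gamma> ^ 3) * (1 / \<rho>\<^sub>2) * \<l>\<^sup>2
                        + 1 / (2 * \<gamma>\<^sup>2) * (1 / \<rho>\<^sub>2\<^sup>2) * \<l>\<^sup>2
                        + (1 / 2) * (1 / \<rho>\<^sub>2\<^sup>2) * \<l>\<^sup>2 + \<l>\<^sup>2 / 2 + \<l> / 2"
    and \<phi>\<^sub>7_def: "\<phi>\<^sub>7 = (\<rho> + 1) * \<gamma> + (1 / 2) * \<rho> * \<beta>"
    and \<phi>\<^sub>8_def: "\<phi>\<^sub>8 = 3 * \<rho>\<^sup>2 * \<beta>\<^sup>2 + (\<rho> - 2 * \<rho>\<^sub>2) * \<beta> * \<gamma> + (\<rho> + 2) * \<gamma>\<^sup>2 + 1"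
    and \<kappa>\<^sub>0hat_def: "\<kappa>\<^sub>0hat = Min {ereal \<phi>\<^sub>1 / ereal \<phi>\<^sub>2, ereal \<phi>\<^sub>3 / ereal \<phi>\<^sub>4, ereal \<phi>\<^sub>5 / ereal \<phi>\<^sub>6}"
    and \<epsilon>\<^sub>1_def: "\<epsilon>\<^sub>1 = (\<tau>\<^sub>1 * \<rho>\<^sub>2 - 1) / (2 * \<tau>\<^sub>1 * \<rho>\<^sub>2)"
    and \<epsilon>\<^sub>2_def: "\<epsilon>\<^sub>2 = max ((1 + \<tau>\<^sub>1 * \<rho>\<^sub>2) / 2) ((1 + \<tau>\<^sub>1) / 2 + 1 / (2 * \<tau>\<^sub>1 * \<rho>\<^sub>2\<^sup>2))"
    and \<epsilon>\<^sub>3_def: "\<epsilon>\<^sub>3 = min (\<phi>\<^sub>1 - \<alpha> * \<phi>\<^sub>2) (\<phi>\<^sub>3 - \<alpha> * \<phi>\<^sub>4)"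
    and \<epsilon>\<^sub>5_def: "\<epsilon>\<^sub>5 = \<omega> * r * (\<delta> - \<delta>\<^sup>2 / 2)"
    and \<epsilon>\<^sub>6_def: "\<epsilon>\<^sub>6 = min (\<nu> / 2) \<epsilon>\<^sub>3 / \<epsilon>\<^sub>2"
    and \<psi>\<^sub>2_def: "\<psi>\<^sub>2 = \<phi>\<^sub>7 + \<alpha> * \<phi>\<^sub>8"
    and \<psi>\<^sub>3_def: "\<psi>\<^sub>3 = 4 * (1 + 1 / \<epsilon>\<^sub>5) * dh\<^sup>2 * \<beta>\<^sup>2 * \<rho>\<^sup>2"
    and \<psi>\<^sub>4_def: "\<psi>\<^sub>4 = 4 * (1 + 1 / \<epsilon>\<^sub>5) * dh\<^sup>2 * max (\<beta>\<^sup>2 * \<rho>\<^sup>2 + \<l>\<^sup>2) (\<gamma>\<^sup>2 * \<rho>) / \<epsilon>\<^sub>1"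
    and \<psi>\<^sub>5_pos: "0 < \<psi>\<^sub>5"
    and \<psi>\<^sub>5_gt: "(1 - 2 * \<epsilon>\<^sub>5) * \<psi>\<^sub>2 / \<epsilon>\<^sub>6 < \<psi>\<^sub>5"
    and \<kappa>\<^sub>5_def: "\<kappa>\<^sub>5 = (if \<exists>a>0. 1 = a * min (\<phi>\<^sub>1 - a * \<phi>\<^sub>2) (\<phi>\<^sub>3 - a * \<phi>\<^sub>4)
                     then ereal (LEAST a. 0 < a \<and> 1 = a * min (\<phi>\<^sub>1 - a * \<phi>\<^sub>2) (\<phi>\<^sub>3 - a * \<phi>\<^sub>4))
                     else \<infinity>)"
    and \<kappa>\<^sub>6'_def: "\<kappa>\<^sub>6' = sqrt ((\<epsilon>\<^sub>5 + 2 * \<epsilon>\<^sub>5\<^sup>2) / ((1 - 2 * \<epsilon>\<^sub>5) * \<psi>\<^sub>3 + \<psi>\<^sub>4 * \<psi>\<^sub>5))"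
    and \<kappa>\<^sub>0'_def: "\<kappa>\<^sub>0' = Min {\<kappa>\<^sub>0hat, \<kappa>\<^sub>5, ereal (\<kappa>\<^sub>6' / (sqrt (real n) * dt))}"
    and x0_def: "x0 = col (\<lambda>i. x i 0)" and v0_def: "v0 = col (\<lambda>i. v i 0)"
    and g0_def: "g0 = col (\<lambda>i. gradient (f i) (xbar 0))"
    and gbar0_def: "gbar0 = col (\<lambda>i. gradient favg (xbar 0))"
    and \<kappa>\<^sub>\<nu>_def: "\<kappa>\<^sub>\<nu> = (1 / 2) * wnorm_sq EE x0
                     + (1 / 2) * wnorm_sq (((\<beta> + \<gamma>) / \<gamma>) *\<^sub>R FF) (v0 + (1 / \<gamma>) *\<^sub>R g0)
                     + x0 \<bullet> ((EE ** FF) *v (v0 + (1 / \<gamma>) *\<^sub>R g0))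
                     + 1 / (2 * \<nu>) * (norm gbar0)\<^sup>2"
    and \<kappa>\<^sub>9_def: "\<kappa>\<^sub>9 = sqrt (1 - \<alpha> * (\<epsilon>\<^sub>6 - (1 - 2 * \<epsilon>\<^sub>5) * \<psi>\<^sub>2 / \<psi>\<^sub>5))"
    and \<kappa>\<^sub>1\<^sub>0_def: "\<kappa>\<^sub>1\<^sub>0 = sqrt (1 - (\<epsilon>\<^sub>5 + 2 * \<epsilon>\<^sub>5\<^sup>2)
                            + \<alpha>\<^sup>2 * real n * dt\<^sup>2 * ((1 - 2 * \<epsilon>\<^sub>5) * \<psi>\<^sub>3 + \<psi>\<^sub>4 * \<psi>\<^sub>5))"
    \<comment> \<open>parameter choice\<close>
    and \<alpha>_pos: "0 < \<alpha>" and \<alpha>_less: "ereal \<alpha> < \<kappa>\<^sub>0'"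
    and \<beta>_eq: "\<beta> = \<tau>\<^sub>1 * \<gamma>" and \<gamma>_gt: "\<kappa>\<^sub>2 < \<gamma>"
    and \<omega>_pos: "0 < \<omega>" and \<omega>_le: "\<omega> \<le> 1 / r" and \<tau>\<^sub>1_gt: "\<kappa>\<^sub>1 < \<tau>\<^sub>1"
    and \<epsilon>_gt: "max \<kappa>\<^sub>9 \<kappa>\<^sub>1\<^sub>0 < \<epsilon>" and \<epsilon>_less: "\<epsilon> < 1"
    and s\<^sub>0_ge: "max (sqrt (\<kappa>\<^sub>\<nu> / (real n * dt\<^sup>2 * \<psi>\<^sub>5 * C\<^sup>2)))
                     (Max (range (\<lambda>i. lp_norm p (x i 0))) / C) \<le> s\<^sub>0"
    and s_def: "s = (\<lambda>k. s\<^sub>0 * \<epsilon> ^ k)"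
  shows "\<exists>M. \<forall>k. favg (xbar k) - fstar + (1 / real n) * (\<Sum>i\<in>UNIV. (norm (x i k - xbar k))\<^sup>2)
                 \<le> M * \<epsilon> ^ (2 * k)"
proof -
  interpret R: compressed_run P i1 lam L f Q \<l> \<alpha> \<beta> \<gamma> \<omega> s x v q xh y
    by unfold_locales (rule eigendecomposition differentiable smooth algorithm)+
  have pos: "0 < \<alpha>" "0 < \<beta>" "0 < \<gamma>" by (rule R.params_pos)+
  have n0: "0 < real n" using n_ge_2 by simp
  have xbar: "xbar = R.xbar"
    unfolding xbar_def R.xbar_def R.avg_def n_def ..
  have favg: "favg = R.favg"
    unfolding favg_def R.favg_def[abs_def] n_def ..

  \<comment> \<open>Spectral bounds\<close>
  have "card (UNIV - {i1}) \<noteq> 0" using n_ge_2 n_def by (simp add: card_Diff_singleton)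
  then obtain i\<^sub>0 where i0: "i\<^sub>0 \<noteq> i1" by (metis DiffE card_eq_0_iff ex_in_conv insertI1)
  have \<rho>2: "0 < \<rho>\<^sub>2" using R.least_pos_eigenvalue_pos[OF i0] by (simp add: \<rho>\<^sub>2_def)
  have lam: "\<rho>\<^sub>2 \<le> lam i" "lam i \<le> \<rho>" if "i \<noteq> i1" for i
    using R.least_pos_eigenvalue_le[OF that] R.le_spectral_radius[OF that] by (simp_all add: \<rho>\<^sub>2_def \<rho>_def)
  have m: "\<rho>\<^sub>2 \<le> lam_n1" "lam_n1 \<le> \<rho>"
  proof -
    have "\<rho>\<^sub>2 \<le> Min (lam ` (UNIV - {i1}))" "Max (lam ` (UNIV - {i1})) \<le> \<rho>"
      using lam i0 by (subst Min_ge_iff Max_le_iff; auto)+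
    then show "\<rho>\<^sub>2 \<le> lam_n1" "lam_n1 \<le> \<rho>" using lam_n1 by auto
  qed
  have \<rho>: "0 < \<rho>" "\<rho>\<^sub>2 \<le> \<rho>" and m0: "0 < lam_n1" using m \<rho>2 by auto

  have \<gamma>: "5 / \<rho>\<^sub>2 < \<gamma>"
    using \<gamma>_gt unfolding \<kappa>\<^sub>2_def by (subst (asm) Max_less_iff) auto
  have \<tau>: "4 < \<tau>\<^sub>1 * \<rho>\<^sub>2" using \<tau>\<^sub>1_gt \<rho>2 by (simp add: \<kappa>\<^sub>1_def field_simps)
  have \<beta>\<gamma>: "\<gamma> \<le> \<rho>\<^sub>2 * \<beta>"
  proof -
    have "1 * \<gamma> \<le> (\<tau>\<^sub>1 * \<rho>\<^sub>2) * \<gamma>" using \<tau> pos by (intro mult_right_mono) auto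
    then show ?thesis by (simp add: \<beta>_eq mult_ac)
  qed
  have b: "(\<beta> + \<gamma>) / \<gamma> = 1 + \<tau>\<^sub>1" using pos by (simp add: \<beta>_eq field_simps)
  have \<rho>\<beta>: "\<gamma> \<le> \<rho> * \<beta>" using \<beta>\<gamma> \<rho> pos by (meson mult_right_mono order_trans less_imp_le)

  \<comment> \<open>Signs and sizes of the constants\<close>
  have \<rho>\<beta>\<gamma>: "\<rho> * (\<beta> * \<gamma>) \<le> \<rho>\<^sup>2 * \<beta>\<^sup>2"
  proof -
    have "\<rho> * \<beta> * \<gamma> \<le> \<rho> * \<beta> * (\<rho> * \<beta>)" using \<rho> pos \<rho>\<beta> by (intro mult_left_mono) auto
    then show ?thesis by (simp add: power2_eq_square mult_ac)
  qed
  have \<rho>2\<beta>\<gamma>: "\<rho>\<^sub>2 * (\<beta> * \<gamma>) \<le> \<rho> * (\<beta> * \<gamma>)" using \<rho> pos by (intro mult_right_mono) auto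
  have sq_nonneg: "0 \<le> \<rho>\<^sup>2 * \<beta>\<^sup>2" "0 \<le> (\<rho> + 2) * \<gamma>\<^sup>2" "0 \<le> \<l>\<^sup>2" using \<rho> by auto
  \<comment> \<open>Of the three copies of \<rho>^2\<beta>^2 at most one is lost to
    \<rho>_2\<beta>\<gamma>; the other two serve to show \<alpha>\<epsilon>_6 <= 1.\<close>
  have \<phi>2: "2 * (\<rho>\<^sup>2 * \<beta>\<^sup>2) < \<phi>\<^sub>2"
  proof -
    have "\<phi>\<^sub>2 = 3 * (\<rho>\<^sup>2 * \<beta>\<^sup>2) - \<rho>\<^sub>2 * (\<beta> * \<gamma>) + (\<rho> + 2) * \<gamma>\<^sup>2 + 1 + (5 / 2) * \<l>\<^sup>2"
      by (simp add: \<phi>\<^sub>2_def mult.assoc)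
    then show ?thesis using \<rho>\<beta>\<gamma> \<rho>2\<beta>\<gamma> sq_nonneg by linarith
  qed
  have \<phi>2_pos: "0 < \<phi>\<^sub>2" using \<phi>2 sq_nonneg(1) by linarith
  have \<phi>4_pos: "0 < \<phi>\<^sub>4"
    unfolding \<phi>\<^sub>4_def using \<rho> pos by (intro add_pos_pos) auto
  have \<phi>6_pos: "0 < \<phi>\<^sub>6"
    unfolding \<phi>\<^sub>6_def using \<rho>2 pos l_pos by (intro add_nonneg_pos add_nonneg_nonneg) auto
  have \<phi>8: "0 \<le> \<phi>\<^sub>8"
  proof -
    have "\<phi>\<^sub>8 = 3 * (\<rho>\<^sup>2 * \<beta>\<^sup>2) + \<rho> * (\<beta> * \<gamma>) - 2 * (\<rho>\<^sub>2 * (\<beta> * \<gamma>)) + (\<rho> + 2) * \<gamma>\<^sup>2 + 1"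
      by (simp add: \<phi>\<^sub>8_def algebra_simps)
    then show ?thesis using \<rho>\<beta>\<gamma> \<rho>2\<beta>\<gamma> sq_nonneg by linarith
  qed
  have \<psi>2: "0 \<le> \<psi>\<^sub>2"
    unfolding \<psi>\<^sub>2_def \<phi>\<^sub>7_def using \<rho> pos \<phi>8 by (intro add_nonneg_nonneg) auto

  \<comment> \<open>With positive denominators the extended quotients are ordinary ones, so the step
    size bound makes the three decrease coefficients positive.\<close>
  have "ereal \<alpha> < \<kappa>\<^sub>0hat" using \<alpha>_less unfolding \<kappa>\<^sub>0'_def by (subst (asm) Min_gr_iff) auto
  moreover have "\<kappa>\<^sub>0hat \<le> ereal \<phi>\<^sub>1 / ereal \<phi>\<^sub>2" "\<kappa>\<^sub>0hat \<le> ereal \<phi>\<^sub>3 / ereal \<phi>\<^sub>4"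
    "\<kappa>\<^sub>0hat \<le> ereal \<phi>\<^sub>5 / ereal \<phi>\<^sub>6"
    unfolding \<kappa>\<^sub>0hat_def by (rule Min_le; blast)+
  moreover have "ereal \<phi>\<^sub>1 / ereal \<phi>\<^sub>2 = ereal (\<phi>\<^sub>1 / \<phi>\<^sub>2)" "ereal \<phi>\<^sub>3 / ereal \<phi>\<^sub>4 = ereal (\<phi>\<^sub>3 / \<phi>\<^sub>4)"
    "ereal \<phi>\<^sub>5 / ereal \<phi>\<^sub>6 = ereal (\<phi>\<^sub>5 / \<phi>\<^sub>6)"
    using \<phi>2_pos \<phi>4_pos \<phi>6_pos by (auto intro!: ereal_divide)
  ultimately have "\<alpha> < \<phi>\<^sub>1 / \<phi>\<^sub>2" "\<alpha> < \<phi>\<^sub>3 / \<phi>\<^sub>4" "\<alpha> < \<phi>\<^sub>5 / \<phi>\<^sub>6"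
    by (metis less_le_trans less_ereal.simps(1))+
  then have \<phi>135: "0 < \<phi>\<^sub>1 - \<alpha> * \<phi>\<^sub>2" "0 < \<phi>\<^sub>3 - \<alpha> * \<phi>\<^sub>4" "0 < \<phi>\<^sub>5 - \<alpha> * \<phi>\<^sub>6"
    using \<phi>2_pos \<phi>4_pos \<phi>6_pos by (simp_all add: pos_less_divide_eq)
  have \<epsilon>3: "0 < \<epsilon>\<^sub>3" "\<epsilon>\<^sub>3 \<le> \<phi>\<^sub>1 - \<alpha> * \<phi>\<^sub>2" "\<epsilon>\<^sub>3 \<le> \<phi>\<^sub>3 - \<alpha> * \<phi>\<^sub>4"
    using \<phi>135 by (auto simp: \<epsilon>\<^sub>3_def)
  have \<epsilon>2: "1 \<le> \<epsilon>\<^sub>2" using \<tau> by (simp add: \<epsilon>\<^sub>2_def le_max_iff_disj)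
  have \<tau>0: "0 < \<tau>\<^sub>1" using \<beta>_eq pos by (simp add: zero_less_mult_iff)
  have \<epsilon>1: "0 < \<epsilon>\<^sub>1" using \<tau> \<tau>0 \<rho>2 by (simp add: \<epsilon>\<^sub>1_def)
  define c where "c = min (\<nu> / 2) \<epsilon>\<^sub>3"
  have c: "0 < c" "c \<le> \<nu> / 2" "c \<le> \<epsilon>\<^sub>3" "\<epsilon>\<^sub>6 = c / \<epsilon>\<^sub>2"
    using \<nu>_pos \<epsilon>3 by (auto simp: c_def \<epsilon>\<^sub>6_def)
  \<comment> \<open>As a function of \<alpha>, \<alpha>(\<phi>_1 - \<alpha>\<phi>_2) is a parabola
    with maximum \<phi>_1^2/(4\<phi>_2), below 1 since \<phi>_1 <= \<rho>\<beta> and \<phi>_2 >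
    2\<rho>^2\<beta>^2. It bounds \<alpha>\<epsilon>_6 because \<epsilon>_2 >= 1.\<close>
  have \<alpha>\<epsilon>6: "0 \<le> 1 - \<alpha> * \<epsilon>\<^sub>6"
  proof -
    have "\<phi>\<^sub>1 \<le> \<rho> * \<beta>"
    proof -
      have "\<rho>\<^sub>2 * \<beta> \<le> \<rho> * \<beta>" "0 \<le> \<rho> * \<beta>" using \<rho> pos by (auto intro: mult_right_mono)
      moreover have "2 * \<phi>\<^sub>1 = \<rho>\<^sub>2 * \<beta> - (3 * \<gamma> + 2 + 2 * \<l>\<^sup>2)" by (simp add: \<phi>\<^sub>1_def)
      ultimately show ?thesis using pos sq_nonneg(3) by linarith
    qed
    moreover have "0 < \<phi>\<^sub>1" using \<phi>135(1) mult_pos_pos[OF pos(1) \<phi>2_pos] by linarith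
    ultimately have "\<phi>\<^sub>1\<^sup>2 \<le> (\<rho> * \<beta>)\<^sup>2" by (intro power_mono) auto
    moreover have "(\<rho> * \<beta>)\<^sup>2 = \<rho>\<^sup>2 * \<beta>\<^sup>2" by (rule power_mult_distrib)
    moreover have "4 * \<phi>\<^sub>2 * (\<alpha> * (\<phi>\<^sub>1 - \<alpha> * \<phi>\<^sub>2)) = \<phi>\<^sub>1\<^sup>2 - (2 * \<alpha> * \<phi>\<^sub>2 - \<phi>\<^sub>1)\<^sup>2"
      by (simp add: power2_eq_square algebra_simps)
    moreover have "0 \<le> (2 * \<alpha> * \<phi>\<^sub>2 - \<phi>\<^sub>1)\<^sup>2" by simp
    ultimately have "4 * \<phi>\<^sub>2 * (\<alpha> * (\<phi>\<^sub>1 - \<alpha> * \<phi>\<^sub>2)) \<le> 4 * \<phi>\<^sub>2 * 1"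
      using \<phi>2 sq_nonneg(1) by linarith
    then have "\<alpha> * (\<phi>\<^sub>1 - \<alpha> * \<phi>\<^sub>2) \<le> 1" using \<phi>2_pos by simp
    moreover have "\<alpha> * c \<le> \<alpha> * (\<phi>\<^sub>1 - \<alpha> * \<phi>\<^sub>2)" using pos c \<epsilon>3 by (intro mult_left_mono) auto
    moreover have "\<alpha> * \<epsilon>\<^sub>6 \<le> \<alpha> * c"
      using pos c \<epsilon>2 by (intro mult_left_mono) (auto simp: divide_le_eq mult_le_cancel_left1)
    ultimately show ?thesis by linarith
  qed

  \<comment> \<open>The Lyapunov function and its recursion\<close>
  define V where "V = R.lyapunov lam_n1 fstar"
  define X where "X k = R.sq_E (\<lambda>j. x j k)" for k
  define W where "W k = (norm (R.coord (R.w k) i1))\<^sup>2 / lam_n1 + R.sq_EF (R.w k)" for k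
  define \<Phi> where "\<Phi> k = real n * (favg (xbar k) - fstar)" for k
  have fstar_le: "fstar \<le> favg z" for z
    unfolding fstar_def by (rule cInf_lower[OF _ bounded_below]) simp
  have XW: "0 \<le> X k" "0 \<le> W k" "0 \<le> \<Phi> k" for k
    using m0 n0 fstar_le[of "xbar k"] by (auto simp: X_def W_def \<Phi>_def R.sq_E_nonneg R.sq_EF_nonneg)
  have V_eq: "V k = R.consensus_energy (1 + \<tau>\<^sub>1) lam_n1 (\<lambda>j. x j k) (R.w k) + \<Phi> k" for k
    by (simp add: V_def R.lyapunov_def b \<Phi>_def xbar favg n_def)
  have V_lower: "\<epsilon>\<^sub>1 * (X k + W k) + \<Phi> k \<le> V k" for k
    unfolding V_eq X_def W_def
    by (intro add_right_mono R.consensus_energy_bounds(1)[OF \<rho>2 _ m0 _ \<epsilon>\<^sub>1_def \<epsilon>\<^sub>2_def] lam) (use \<tau> in auto)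
  have V_upper: "V k \<le> \<epsilon>\<^sub>2 * (X k + W k + \<Phi> k)" for k
  proof -
    have "V k \<le> \<epsilon>\<^sub>2 * (X k + W k) + \<Phi> k"
      unfolding V_eq X_def W_def
      by (intro add_right_mono R.consensus_energy_bounds(2)[OF \<rho>2 _ m0 _ \<epsilon>\<^sub>1_def \<epsilon>\<^sub>2_def] lam) (use \<tau> in auto)
    moreover have "1 * \<Phi> k \<le> \<epsilon>\<^sub>2 * \<Phi> k" by (intro mult_right_mono \<epsilon>2 XW)
    ultimately show ?thesis by (simp add: distrib_left)
  qed
  \<comment> \<open>The Polyak-Lojasiewicz condition times 2n. With the remaining \<alpha>/4 it
    yields \<alpha>\<nu>/2 times the gap, hence the entry \<nu>/2 in \<epsilon>_6.\<close>
  have \<Phi>_PL: "2 * \<nu> * \<Phi> k \<le> (norm (R.coord (R.g0 k) i1))\<^sup>2" for k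
  proof -
    have "real n * (\<nu> * (favg (xbar k) - fstar)) \<le> real n * ((1 / 2) * (norm (gradient favg (xbar k)))\<^sup>2)"
      using n0 by (intro mult_left_mono PL) auto
    then show ?thesis by (simp add: R.norm_coord_g0 \<Phi>_def n_def favg xbar mult_ac)
  qed

  have V_step: "V (Suc k) \<le> (1 - \<alpha> * \<epsilon>\<^sub>6) * V k + \<alpha> * \<psi>\<^sub>2 * R.sq_E (R.err k)" for k
  proof -
    have "V (Suc k) \<le> V k - \<alpha> * (\<phi>\<^sub>1 - \<alpha> * \<phi>\<^sub>2) * X k - \<alpha> * (\<phi>\<^sub>3 - \<alpha> * \<phi>\<^sub>4) * W k
      - \<alpha> * (\<phi>\<^sub>5 - \<alpha> * \<phi>\<^sub>6) * (norm (R.coord (R.gk k) i1))\<^sup>2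
      - \<alpha> / 4 * (norm (R.coord (R.g0 k) i1))\<^sup>2 + \<alpha> * \<psi>\<^sub>2 * R.sq_E (R.err k)"
      unfolding V_def X_def W_def \<psi>\<^sub>2_def
      by (rule R.lyapunov_descent[OF \<rho>2 lam m \<beta>\<gamma> \<gamma> \<phi>\<^sub>1_def \<phi>\<^sub>2_def \<phi>\<^sub>3_def \<phi>\<^sub>4_def \<phi>\<^sub>5_def \<phi>\<^sub>6_def \<phi>\<^sub>7_def \<phi>\<^sub>8_def])
    moreover have "\<alpha> * c * X k \<le> \<alpha> * (\<phi>\<^sub>1 - \<alpha> * \<phi>\<^sub>2) * X k" "\<alpha> * c * W k \<le> \<alpha> * (\<phi>\<^sub>3 - \<alpha> * \<phi>\<^sub>4) * W k"
      using pos c \<epsilon>3 by (intro mult_right_mono mult_left_mono XW; simp)+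
    moreover have "0 \<le> \<alpha> * (\<phi>\<^sub>5 - \<alpha> * \<phi>\<^sub>6) * (norm (R.coord (R.gk k) i1))\<^sup>2"
      using pos \<phi>135 by simp
    moreover have "\<alpha> * c * \<Phi> k \<le> \<alpha> / 4 * (norm (R.coord (R.g0 k) i1))\<^sup>2"
    proof -
      have "\<alpha> * c * \<Phi> k \<le> \<alpha> * (\<nu> / 2) * \<Phi> k"
        using pos c by (intro mult_right_mono mult_left_mono XW) auto
      also have "\<dots> = \<alpha> / 4 * (2 * \<nu> * \<Phi> k)" by simp
      also have "\<dots> \<le> \<alpha> / 4 * (norm (R.coord (R.g0 k) i1))\<^sup>2"
        using pos by (intro mult_left_mono \<Phi>_PL) auto
      finally show ?thesis .
    qed
    \<comment> \<open>All three parts of V decrease at rate at least \<open>c\<close>; the upper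
      bound on V costs the factor \<epsilon>_2, and c/\<epsilon>_2 is \<epsilon>_6.\<close>
    moreover have "\<alpha> * \<epsilon>\<^sub>6 * V k \<le> \<alpha> * c * X k + \<alpha> * c * W k + \<alpha> * c * \<Phi> k"
    proof -
      have "\<alpha> * \<epsilon>\<^sub>6 * V k \<le> \<alpha> * \<epsilon>\<^sub>6 * (\<epsilon>\<^sub>2 * (X k + W k + \<Phi> k))"
        using pos c \<epsilon>2 by (intro mult_left_mono V_upper) auto
      also have "\<dots> = \<alpha> * c * (X k + W k + \<Phi> k)" using \<epsilon>2 by (simp add: c)
      finally show ?thesis by (simp add: distrib_left)
    qed
    ultimately show ?thesis by (simp add: left_diff_distrib)
  qed

  define M where "M = max (\<beta>\<^sup>2 * \<rho>\<^sup>2 + \<l>\<^sup>2) (\<gamma>\<^sup>2 * \<rho>)"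
  have M0: "0 \<le> M" using \<rho> by (auto simp: M_def le_max_iff_disj)
  \<comment> \<open>The optimality gap is nonnegative, so V dominates \<epsilon>_1(X+W); hence the
    division by \<epsilon>_1 in \<psi>_4.\<close>
  have increment: "(norm (x i (Suc k) - x i k))\<^sup>2
      \<le> 4 * \<alpha>\<^sup>2 * (\<beta>\<^sup>2 * \<rho>\<^sup>2 * R.sq_E (R.err k) + M / \<epsilon>\<^sub>1 * V k)" for i k
  proof -
    have "\<epsilon>\<^sub>1 * (X k + W k) \<le> V k" using V_lower[of k] XW[of k] by linarith
    then have "M * (X k + W k) \<le> M / \<epsilon>\<^sub>1 * V k"
      using \<epsilon>1 M0 mult_left_mono[of "X k + W k" "V k / \<epsilon>\<^sub>1" M] by (simp add: field_simps)
    then have "4 * \<alpha>\<^sup>2 * (\<beta>\<^sup>2 * \<rho>\<^sup>2 * R.sq_E (R.err k) + M * (X k + W k))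
        \<le> 4 * \<alpha>\<^sup>2 * (\<beta>\<^sup>2 * \<rho>\<^sup>2 * R.sq_E (R.err k) + M / \<epsilon>\<^sub>1 * V k)"
      by (intro mult_left_mono add_left_mono) auto
    moreover have "(norm (x i (Suc k) - x i k))\<^sup>2
        \<le> 4 * \<alpha>\<^sup>2 * (\<beta>\<^sup>2 * \<rho>\<^sup>2 * R.sq_E (R.err k) + M * (X k + W k))"
      unfolding M_def X_def W_def by (rule R.norm_increment[OF lam(2) m0 m(2)])
    ultimately show ?thesis by linarith
  qed

  \<comment> \<open>\<kappa>_\<nu> is V at time 0 with the optimality gap replaced by its
    Polyak-Lojasiewicz bound, so the condition on s_0 does not involve the infimum of f.\<close>
  have V_0: "V 0 \<le> \<kappa>\<^sub>\<nu>"
  proof -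
    have w0: "v0 + (1 / \<gamma>) *\<^sub>R g0 = col (R.w 0)"
      by (simp add: v0_def g0_def col_def R.w_def R.g0_def vec_eq_iff xbar)
    have gbar: "(norm gbar0)\<^sup>2 = (norm (R.coord (R.g0 0) i1))\<^sup>2"
      unfolding R.norm_coord_g0 unfolding power2_norm_eq_inner by (simp add: gbar0_def inner_col favg xbar)
    have "\<kappa>\<^sub>\<nu> = R.consensus_energy (1 + \<tau>\<^sub>1) lam_n1 (\<lambda>j. x j 0) (R.w 0)
        + 1 / (2 * \<nu>) * (norm (R.coord (R.g0 0) i1))\<^sup>2"
      unfolding \<kappa>\<^sub>\<nu>_def w0 gbar unfolding x0_def EE_def FF_def b R.wnorm_sq_E R.wnorm_sq_F R.inner_EF
      by (simp add: R.consensus_energy_def R.sq_E_def R.sq_EF_def R.cross_EF_def)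
    moreover have "\<Phi> 0 \<le> 1 / (2 * \<nu>) * (norm (R.coord (R.g0 0) i1))\<^sup>2"
      using \<Phi>_PL[of 0] \<nu>_pos by (simp add: field_simps)
    ultimately show ?thesis by (simp add: V_eq)
  qed

  \<comment> \<open>Initial conditions and convergence rate\<close>
  have r: "0 < r" and C: "0 < C"
    using compressor by (auto simp: locally_bounded_compressor_def)
  have dt0: "0 < dt" unfolding dt_def by (rule d_tilde_pos) (simp add: d_def)
  have s0: "0 < s\<^sub>0" using R.params_pos(5)[of 0] by (simp add: s_def)
  have \<epsilon>0: "0 < \<epsilon>" using R.params_pos(5)[of 1] s0 by (simp add: s_def zero_less_mult_iff)
  have init_V: "V 0 \<le> real n * dt\<^sup>2 * \<psi>\<^sub>5 * C\<^sup>2 * s\<^sub>0\<^sup>2"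
  proof -
    define D where "D = real n * dt\<^sup>2 * \<psi>\<^sub>5 * C\<^sup>2"
    have D: "0 < D" using n0 dt0 \<psi>\<^sub>5_pos C by (simp add: D_def)
    have "sqrt (\<kappa>\<^sub>\<nu> / D) \<le> s\<^sub>0" using s\<^sub>0_ge by (simp add: D_def)
    then have "\<kappa>\<^sub>\<nu> / D \<le> s\<^sub>0\<^sup>2" by (rule sqrt_le_D)
    then have "\<kappa>\<^sub>\<nu> \<le> D * s\<^sub>0\<^sup>2" using D by (simp add: field_simps)
    then show ?thesis using V_0 by (simp add: D_def)
  qed
  have init_x: "lp_norm p (x i 0) \<le> C * s\<^sub>0" for i
  proof -
    have "lp_norm p (x i 0) \<le> Max (range (\<lambda>i. lp_norm p (x i 0)))" by (intro Max_ge) auto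
    also have "\<dots> \<le> C * s\<^sub>0" using s\<^sub>0_ge C by (simp add: field_simps)
    finally show ?thesis .
  qed
  \<comment> \<open>Squaring is sound whatever the sign of the radicand, as a negative a lies below
    \<epsilon>^2 anyway.\<close>
  have sqrt_less: "a \<le> \<epsilon>\<^sup>2" if "sqrt a < \<epsilon>" for a
    using that \<epsilon>0 by (intro sqrt_le_D less_imp_le)
  have rates: "1 - \<alpha> * (\<epsilon>\<^sub>6 - (1 - 2 * \<epsilon>\<^sub>5) * \<psi>\<^sub>2 / \<psi>\<^sub>5) \<le> \<epsilon>\<^sup>2"
    "1 - (\<epsilon>\<^sub>5 + 2 * \<epsilon>\<^sub>5\<^sup>2) + \<alpha>\<^sup>2 * real n * dt\<^sup>2 * ((1 - 2 * \<epsilon>\<^sub>5) * \<psi>\<^sub>3 + \<psi>\<^sub>4 * \<psi>\<^sub>5) \<le> \<epsilon>\<^sup>2"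
    using \<epsilon>_gt by (auto intro!: sqrt_less simp: \<kappa>\<^sub>9_def \<kappa>\<^sub>1\<^sub>0_def)
  have \<omega>r: "\<omega> * r \<le> 1" using \<omega>_le r by (simp add: field_simps)
  have \<psi>3: "\<psi>\<^sub>3 = 4 * (1 + 1 / \<epsilon>\<^sub>5) * dh\<^sup>2 * (\<beta>\<^sup>2 * \<rho>\<^sup>2)" by (simp add: \<psi>\<^sub>3_def mult.assoc)
  have V_rate: "V k \<le> real n * dt\<^sup>2 * \<psi>\<^sub>5 * C\<^sup>2 * (s k)\<^sup>2" for k
    unfolding n_def
    by (rule R.linear_rate[OF compressor \<omega>r s_def dt_def[unfolded d_def] dh_def[unfolded d_def] \<epsilon>\<^sub>5_def
        V_step \<alpha>\<epsilon>6 \<psi>2 increment M0 _ \<epsilon>1 \<psi>3 \<psi>\<^sub>4_def[folded M_def] \<psi>\<^sub>5_pos rates[unfolded n_def]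
        init_V[unfolded n_def] init_x]) simp

  \<comment> \<open>The gap is at most V and the consensus error at most V/\<epsilon>_1, which gives
    the factor 1 + 1/\<epsilon>_1.\<close>
  have bound: "favg (xbar k) - fstar + (1 / real n) * (\<Sum>i\<in>UNIV. (norm (x i k - xbar k))\<^sup>2)
      \<le> ((1 / real n) * (1 + 1 / \<epsilon>\<^sub>1) * (real n * dt\<^sup>2 * \<psi>\<^sub>5 * C\<^sup>2 * s\<^sub>0\<^sup>2)) * \<epsilon> ^ (2 * k)" for k
  proof -
    have "\<epsilon>\<^sub>1 * X k + \<epsilon>\<^sub>1 * W k + \<Phi> k \<le> V k" using V_lower[of k] by (simp add: distrib_left)
    moreover have "0 \<le> \<epsilon>\<^sub>1 * X k" "0 \<le> \<epsilon>\<^sub>1 * W k" using \<epsilon>1 XW by auto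
    ultimately have "\<Phi> k \<le> V k" and "\<epsilon>\<^sub>1 * X k \<le> V k" using XW[of k] by linarith+
    then have "\<Phi> k \<le> V k" "X k \<le> V k / \<epsilon>\<^sub>1" using \<epsilon>1 by (simp_all add: field_simps)
    then have "\<Phi> k + X k \<le> (1 + 1 / \<epsilon>\<^sub>1) * V k" by (simp add: distrib_right)
    also have "\<dots> \<le> (1 + 1 / \<epsilon>\<^sub>1) * (real n * dt\<^sup>2 * \<psi>\<^sub>5 * C\<^sup>2 * (s k)\<^sup>2)"
      using \<epsilon>1 by (intro mult_left_mono V_rate) auto
    finally have "(1 / real n) * (\<Phi> k + X k)
        \<le> (1 / real n) * ((1 + 1 / \<epsilon>\<^sub>1) * (real n * dt\<^sup>2 * \<psi>\<^sub>5 * C\<^sup>2 * (s k)\<^sup>2))"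
      using n0 by (intro mult_left_mono) auto
    moreover have "(1 / real n) * (\<Phi> k + X k)
        = favg (xbar k) - fstar + (1 / real n) * (\<Sum>i\<in>UNIV. (norm (x i k - xbar k))\<^sup>2)"
      using n0 by (simp add: \<Phi>_def X_def R.sq_E_x xbar distrib_left)
    moreover have "(s k)\<^sup>2 = s\<^sub>0\<^sup>2 * \<epsilon> ^ (2 * k)"
      by (simp add: s_def power_mult_distrib power_mult mult.commute[of 2])
    ultimately show ?thesis using n0 by (simp add: mult_ac)
  qed
  then show ?thesis by blast
qed

end
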